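(* Let $\bullet\in\{c,bc\}$, $\mu\in\mathcal P(\mathcal X)$, $\nu\in\mathcal P(\mathcal Y)$, $P=\mu\otimes\nu$, and let $c:\mathcal X\times\mathcal Y\to\mathbb R$ be continuous and bounded. Then any dual maximizer $$h^*\in\arg\max_{h\in\mathcal H_\bullet}\int h-\exp(h-c)\,dP+1$$ with $h^*=f^*+g^*=\sum_{t=1}^Nf_t^*+g_t^*$ satisfies the adapted versions of the Schrödinger equations, i.e.: (1) setting $c_N=c$ and $$a_t=-\log\int\exp(g_t^*-c_t)\,d\nu_t^{Y_{1:t-1}}\ (t=1,\dots,N),\qquad c_t=\int a_{t+1}\,d\mu_{t+1}^{X_{1:t}}\ (t=1,\dots,N-1),$$ one has $f_1^*=a_1$ and $f_{t+1}^*=a_{t+1}-c_t$ for $t=1,\dots,N-1$; (2) in the bicausal case $\bullet=bc$, $g^*$ satisfies the anticausal analogue: setting $d_N=c$ and $$b_t=-\log\int\exp(f_t^*-d_t)\,d\mu_t^{X_{1:t-1}}\ (t=1,\dots,N),\qquad d_t=\int b_{t+1}\,d\nu_{t+1}^{Y_{1:t}}\ (t=1,\dots,N-1),$$ one has $g_1^*=b_1$ and $g_{t+1}^*=b_{t+1}-d_t$ for $t=1,\dots,N-1$; (3) in the causal case $\bullet=c$, $g^*=-\log\int\exp(f^*-c)\,d\mu$. Further, using the normalization $\int f_1^*\,d\mu_1=\int g_1^*\,d\nu_1$, there exists a constant $C_N$ only depending on $N$ such that $$\max\{\|h^*\|_\infty,\|f_1^*\|_\infty,\|f_2^*\|_\infty,\dots,\|f_N^*\|_\infty,\|g_1^*\|_\infty,\dots,\|g_N^*\|_\infty\}\le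 C_N\|c\|_\infty.$$
   Context: $N\in\mathbb N$; $\mathcal X=\mathcal X_1\times\dots\times\mathcal X_N$ and $\mathcal Y=\mathcal Y_1\times\dots\times\mathcal Y_N$ are Polish path spaces; $X_t,Y_t$ are coordinate projections, $x_{1:t}=(x_1,\dots,x_t)$, $\mathcal X_{1:t}=\mathcal X_1\times\dots\times\mathcal X_t$, etc. $\|f\|_\infty:=\sup_{(x,y)\in\mathcal X\times\mathcal Y}|f(x,y)|$ is the supremum norm of a function $f:\mathcal X\times\mathcal Y\to\mathbb R$. $\mu_t^{X_{1:t-1}}$ is the regular conditional law of $X_t$ given $X_{1:t-1}$ under $\mu$ ($\mu_1$ is the law of $X_1$ if $t=1$), $\nu_t^{Y_{1:t-1}}$ that of $Y_t$ given $Y_{1:t-1}$ under $\nu$. Integration against such a kernel integrates out the corresponding coordinate: $c_t,d_t$ are functions of $(x_{1:t},y_{1:t})$, $a_t$ is a function of $(x_{1:t},y_{1:t-1})$, $b_t$ is a function of $(x_{1:t-1},y_{1:t})$; in (3) the integral is over the variable $x\in\mathcal X$. Function spaces: $\mathcal S_{\mathcal Y}$ is the set of bounded measurable functions of $y$. $\mathcal A_{\mathcal X,\mu,1}$ (resp. $\mathcal A_{\mathcal Y,\nu,1}$) is the set of bounded measurable functions of $x_1$ (resp. $y_1$). For $t=2,\dots,N$, $\mathcal A_{\mathcal X,\mu,t}$ consists of the functions $a_t(x_{1:t},y_{1:t-1})-\int a_t(x_{1:t-1},\tilde x_t,y_{1:t-1})\,\mu_t^{x_{1:t-1}}(d\tilde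 x_t)$ with $a_t$ bounded measurable on $\mathcal X_{1:t}\times\mathcal Y_{1:t-1}$, and $\mathcal A_{\mathcal Y,\nu,t}$ of the functions $a_t(x_{1:t-1},y_{1:t})-\int a_t(x_{1:t-1},y_{1:t-1},\tilde y_t)\,\nu_t^{y_{1:t-1}}(d\tilde y_t)$ with $a_t$ bounded measurable on $\mathcal X_{1:t-1}\times\mathcal Y_{1:t}$. $\mathcal S_{\mathcal X,\mu}=\{\sum_{t=1}^Nf_t:f_t\in\mathcal A_{\mathcal X,\mu,t}\}$, $\mathcal S_{\mathcal Y,\nu}=\{\sum_{t=1}^Ng_t:g_t\in\mathcal A_{\mathcal Y,\nu,t}\}$. $\mathcal H_c=\mathcal S_{\mathcal X,\mu}+\mathcal S_{\mathcal Y}$ (causal optimal transport), $\mathcal H_{bc}=\mathcal S_{\mathcal X,\mu}+\mathcal S_{\mathcal Y,\nu}$ (bicausal optimal transport). In the decomposition of $h^*$: $f^*=\sum_tf_t^*\in\mathcal S_{\mathcal X,\mu}$ with $f_t^*\in\mathcal A_{\mathcal X,\mu,t}$; $g^*=\sum_tg_t^*$ with $g_t^*\in\mathcal A_{\mathcal Y,\nu,t}$. If $\bullet=c$, then $g^*\in\mathcal S_{\mathcal Y}\subseteq\mathcal S_{\mathcal Y,\nu}$ and $g_t^*(y_{1:t})=A_t(y_{1:t})-A_{t-1}(y_{1:t-1})$ for $t\ge2$, $g_1^*=A_1$, where $A_N=g^*$, $A_{t-1}(y_{1:t-1})=\int A_t(y_{1:t-1},\tilde y_t)\,\nu_t^{y_{1:t-1}}(d\tilde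 y_t)$. The normalization is achieved by adding a constant to $f_1^*$ and subtracting it from $g_1^*$.
   Formalization: Equations (1)-(3) hold P-a.s., and the sup-norm bound holds for normalized P-a.s. equal versions of h*, f_t*, g_t* (false for arbitrary maximizers, which can be changed on null sets). Polish spaces sit in fixed host sets chosen before C_N; the reals host all up to homeomorphism. *)

theory Defs
  imports "HOL-Probability.Probability"
begin

section \<open>Polish path spaces\<close>

text \<open>
  The factors \<open>X\<^sub>1, \<dots>, X\<^sub>N\<close> are Polish spaces on arbitrary, possibly different, subsets of one
  ambient type, given by a family \<open>X :: nat \<Rightarrow> 'a topology\<close> of which only the indices \<open>1, \<dots>, N\<close>
  matter.  A path is an extensional function on \<open>{1..N}\<close>.
\<close>

definition polish :: "'a topology \<Rightarrow> bool" where
  "polish T \<longleftrightarrow> completely_metrizable_space T \<and> separable_space T"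

definition borel_of :: "'a topology \<Rightarrow> 'a measure" where
  "borel_of T = sigma (topspace T) {U. openin T U}"

text \<open>
  The space of initial segments \<open>x\<^bsub>1:t\<^esub>\<close>, a one-point space for \<open>t = 0\<close>.  By second countability
  its product sigma-algebra is the Borel sigma-algebra of the product topology.
\<close>

definition paths :: "(nat \<Rightarrow> 'a topology) \<Rightarrow> nat \<Rightarrow> (nat \<Rightarrow> 'a) measure" where
  "paths X t = PiM {1..t} (\<lambda>s. borel_of (X s))"

definition pre :: "nat \<Rightarrow> (nat \<Rightarrow> 'a) \<Rightarrow> nat \<Rightarrow> 'a" where
  "pre t x = restrict x {1..t}"

text \<open>
  \<open>k\<close> is a version of the regular conditional law of the \<open>t\<close>-th coordinate given the first \<open>t - 1\<close>
  ones under \<open>\<mu>\<close>.  For \<open>t = 1\<close> the only initial segment is \<open>pre 0 x = (\<lambda>_. undefined)\<close>, and the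
  kernel is just the law of the first coordinate.
\<close>

definition cond_law ::
    "(nat \<Rightarrow> 'a topology) \<Rightarrow> (nat \<Rightarrow> 'a) measure \<Rightarrow> nat \<Rightarrow> ((nat \<Rightarrow> 'a) \<Rightarrow> 'a measure) \<Rightarrow> bool" where
  "cond_law X \<mu> t k \<longleftrightarrow>
     k \<in> paths X (t - 1) \<rightarrow>\<^sub>M prob_algebra (borel_of (X t)) \<and>
     (\<forall>A \<in> sets (paths X (t - 1)). \<forall>B \<in> sets (borel_of (X t)).
        emeasure \<mu> {x \<in> space \<mu>. pre (t - 1) x \<in> A \<and> x t \<in> B} =
        (\<integral>\<^sup>+ x. indicator A (pre (t - 1) x) * emeasure (k (pre (t - 1) x)) B \<partial>\<mu>))"

definition law_on_paths ::
    "nat \<Rightarrow> (nat \<Rightarrow> 'a topology) \<Rightarrow> (nat \<Rightarrow> 'a) measure \<Rightarrow> (nat \<Rightarrow> (nat \<Rightarrow> 'a) \<Rightarrow> 'a measure) \<Rightarrow> bool"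
  where
  "law_on_paths N X \<mu> K \<longleftrightarrow>
     (\<forall>t\<in>{1..N}. polish (X t)) \<and> prob_space \<mu> \<and> sets \<mu> = sets (paths X N) \<and>
     (\<forall>t\<in>{1..N}. cond_law X \<mu> t (K t))"


section \<open>Functions on the product of the path spaces\<close>

text \<open>
  A function of \<open>(x\<^bsub>1:s\<^esub>, y\<^bsub>1:t\<^esub>)\<close> is identified with the function of the full pair of paths that
  factors through these initial segments.
\<close>

type_synonym ('a, 'b) pathfun = "(nat \<Rightarrow> 'a) \<times> (nat \<Rightarrow> 'b) \<Rightarrow> real"

definition bdd_meas ::
    "(nat \<Rightarrow> 'a topology) \<Rightarrow> (nat \<Rightarrow> 'b topology) \<Rightarrow> nat \<Rightarrow> nat \<Rightarrow> ('a, 'b) pathfun set" where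
  "bdd_meas X Y s t =
     {(\<lambda>(x, y). \<phi> (pre s x, pre t y)) | \<phi>.
        \<phi> \<in> borel_measurable (paths X s \<Otimes>\<^sub>M paths Y t) \<and>
        bounded (\<phi> ` space (paths X s \<Otimes>\<^sub>M paths Y t))}"

text \<open>
  Integration of the coordinate \<open>x\<^sub>t\<close> against \<open>\<mu>\<^sub>t\<close>, and of \<open>y\<^sub>t\<close> against \<open>\<nu>\<^sub>t\<close>; the former is
  meant for functions that depend on \<open>x\<close> only through \<open>x\<^bsub>1:t\<^esub>\<close>, the latter analogously.
\<close>

definition int_x ::
    "(nat \<Rightarrow> (nat \<Rightarrow> 'a) \<Rightarrow> 'a measure) \<Rightarrow> nat \<Rightarrow> ('a, 'b) pathfun \<Rightarrow> ('a, 'b) pathfun" where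
  "int_x K t \<phi> = (\<lambda>(x, y). \<integral> z. \<phi> (x(t := z), y) \<partial>K t (pre (t - 1) x))"

definition int_y ::
    "(nat \<Rightarrow> (nat \<Rightarrow> 'b) \<Rightarrow> 'b measure) \<Rightarrow> nat \<Rightarrow> ('a, 'b) pathfun \<Rightarrow> ('a, 'b) pathfun" where
  "int_y L t \<phi> = (\<lambda>(x, y). \<integral> z. \<phi> (x, y(t := z)) \<partial>L t (pre (t - 1) y))"

definition sup_norm :: "'c set \<Rightarrow> ('c \<Rightarrow> real) \<Rightarrow> real" where
  "sup_norm S \<phi> = (SUP z\<in>S. \<bar>\<phi> z\<bar>)"


section \<open>Dual function spaces\<close>

definition A_X ::
    "(nat \<Rightarrow> 'a topology) \<Rightarrow> (nat \<Rightarrow> 'b topology) \<Rightarrow> (nat \<Rightarrow> (nat \<Rightarrow> 'a) \<Rightarrow> 'a measure) \<Rightarrow>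
     nat \<Rightarrow> ('a, 'b) pathfun set" where
  "A_X X Y K t =
     (if t = 1 then bdd_meas X Y 1 0
      else {(\<lambda>z. a z - int_x K t a z) | a. a \<in> bdd_meas X Y t (t - 1)})"

definition A_Y ::
    "(nat \<Rightarrow> 'a topology) \<Rightarrow> (nat \<Rightarrow> 'b topology) \<Rightarrow> (nat \<Rightarrow> (nat \<Rightarrow> 'b) \<Rightarrow> 'b measure) \<Rightarrow>
     nat \<Rightarrow> ('a, 'b) pathfun set" where
  "A_Y X Y L t =
     (if t = 1 then bdd_meas X Y 0 1
      else {(\<lambda>z. a z - int_y L t a z) | a. a \<in> bdd_meas X Y (t - 1) t})"

definition S_X ::
    "nat \<Rightarrow> (nat \<Rightarrow> 'a topology) \<Rightarrow> (nat \<Rightarrow> 'b topology) \<Rightarrow>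
     (nat \<Rightarrow> (nat \<Rightarrow> 'a) \<Rightarrow> 'a measure) \<Rightarrow> ('a, 'b) pathfun set" where
  "S_X N X Y K = {(\<lambda>z. \<Sum>t=1..N. f t z) | f. \<forall>t\<in>{1..N}. f t \<in> A_X X Y K t}"

definition S_Y_bicausal ::
    "nat \<Rightarrow> (nat \<Rightarrow> 'a topology) \<Rightarrow> (nat \<Rightarrow> 'b topology) \<Rightarrow>
     (nat \<Rightarrow> (nat \<Rightarrow> 'b) \<Rightarrow> 'b measure) \<Rightarrow> ('a, 'b) pathfun set" where
  "S_Y_bicausal N X Y L = {(\<lambda>z. \<Sum>t=1..N. g t z) | g. \<forall>t\<in>{1..N}. g t \<in> A_Y X Y L t}"

definition S_Y ::
    "nat \<Rightarrow> (nat \<Rightarrow> 'a topology) \<Rightarrow> (nat \<Rightarrow> 'b topology) \<Rightarrow> ('a, 'b) pathfun set" where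
  "S_Y N X Y = bdd_meas X Y 0 N"

datatype mode = Causal | Bicausal

definition dual_space ::
    "mode \<Rightarrow> nat \<Rightarrow> (nat \<Rightarrow> 'a topology) \<Rightarrow> (nat \<Rightarrow> 'b topology) \<Rightarrow>
     (nat \<Rightarrow> (nat \<Rightarrow> 'a) \<Rightarrow> 'a measure) \<Rightarrow> (nat \<Rightarrow> (nat \<Rightarrow> 'b) \<Rightarrow> 'b measure) \<Rightarrow>
     ('a, 'b) pathfun set" where
  "dual_space m N X Y K L =
     {(\<lambda>z. f z + g z) | f g.
        f \<in> S_X N X Y K \<and>
        g \<in> (case m of Causal \<Rightarrow> S_Y N X Y | Bicausal \<Rightarrow> S_Y_bicausal N X Y L)}"

definition dual_value ::
    "((nat \<Rightarrow> 'a) \<times> (nat \<Rightarrow> 'b)) measure \<Rightarrow> ('a, 'b) pathfun \<Rightarrow> ('a, 'b) pathfun \<Rightarrow> real" where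
  "dual_value P c h = (\<integral> z. (h z - exp (h z - c z)) \<partial>P) + 1"


section \<open>Decompositions and backward recursions\<close>

text \<open>\<open>A\<^sub>N = g\<close> and \<open>A\<^sub>t = \<integral> A\<^bsub>t+1\<^esub> d\<nu>\<^bsub>t+1\<^esub>\<close>.\<close>

function cond_proj ::
    "(nat \<Rightarrow> (nat \<Rightarrow> 'b) \<Rightarrow> 'b measure) \<Rightarrow> nat \<Rightarrow> ('a, 'b) pathfun \<Rightarrow> nat \<Rightarrow> ('a, 'b) pathfun" where
  "cond_proj L N g t = (if t < N then int_y L (t + 1) (cond_proj L N g (t + 1)) else g)"
  by pat_completeness auto
termination by (relation "Wellfounded.measure (\<lambda>(L, N, g, t). N - t)") auto

text \<open>
  \<open>f\<close> and \<open>gN\<close> play the roles of \<open>(f\<^sub>t\<^sup>*)\<^sub>t\<close> and \<open>g\<^sup>*\<close>, and \<open>g\<close> that of \<open>(g\<^sub>t\<^sup>*)\<^sub>t\<close>.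
\<close>

definition decomposition ::
    "mode \<Rightarrow> nat \<Rightarrow> (nat \<Rightarrow> 'a topology) \<Rightarrow> (nat \<Rightarrow> 'b topology) \<Rightarrow>
     (nat \<Rightarrow> (nat \<Rightarrow> 'a) \<Rightarrow> 'a measure) \<Rightarrow> (nat \<Rightarrow> (nat \<Rightarrow> 'b) \<Rightarrow> 'b measure) \<Rightarrow>
     ('a, 'b) pathfun \<Rightarrow> (nat \<Rightarrow> ('a, 'b) pathfun) \<Rightarrow> ('a, 'b) pathfun \<Rightarrow>
     (nat \<Rightarrow> ('a, 'b) pathfun) \<Rightarrow> bool" where
  "decomposition m N X Y K L h f gN g \<longleftrightarrow>
     h = (\<lambda>z. (\<Sum>t=1..N. f t z) + gN z) \<and>
     (\<forall>t\<in>{1..N}. f t \<in> A_X X Y K t) \<and>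
     (case m of
        Causal \<Rightarrow>
          gN \<in> S_Y N X Y \<and>
          g 1 = cond_proj L N gN 1 \<and>
          (\<forall>t\<in>{2..N}. g t = (\<lambda>z. cond_proj L N gN t z - cond_proj L N gN (t - 1) z))
      | Bicausal \<Rightarrow>
          (\<forall>t\<in>{1..N}. g t \<in> A_Y X Y L t) \<and> gN = (\<lambda>z. \<Sum>t=1..N. g t z))"

text \<open>
  With \<open>I = int_x K\<close>, \<open>J = int_y L\<close> and \<open>u = g\<close>, \<open>value_fun\<close> gives the functions \<open>c\<^sub>t\<close> of the causal
  recursion and \<open>potential\<close> the functions \<open>a\<^sub>t\<close>.  With \<open>I = int_y L\<close>, \<open>J = int_x K\<close> and \<open>u = f\<close>
  they give the functions \<open>d\<^sub>t\<close> and \<open>b\<^sub>t\<close> of the anticausal recursion.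
\<close>

function value_fun ::
    "(nat \<Rightarrow> ('a, 'b) pathfun \<Rightarrow> ('a, 'b) pathfun) \<Rightarrow> (nat \<Rightarrow> ('a, 'b) pathfun \<Rightarrow> ('a, 'b) pathfun) \<Rightarrow>
     nat \<Rightarrow> ('a, 'b) pathfun \<Rightarrow> (nat \<Rightarrow> ('a, 'b) pathfun) \<Rightarrow> nat \<Rightarrow> ('a, 'b) pathfun" where
  "value_fun I J N c u t =
     (if t < N
      then I (t + 1) (\<lambda>z. - ln (J (t + 1) (\<lambda>w. exp (u (t + 1) w - value_fun I J N c u (t + 1) w)) z))
      else c)"
  by pat_completeness auto
termination by (relation "Wellfounded.measure (\<lambda>(I, J, N, c, u, t). N - t)") auto

definition potential ::
    "(nat \<Rightarrow> ('a, 'b) pathfun \<Rightarrow> ('a, 'b) pathfun) \<Rightarrow> (nat \<Rightarrow> ('a, 'b) pathfun \<Rightarrow> ('a, 'b) pathfun) \<Rightarrow>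
     nat \<Rightarrow> ('a, 'b) pathfun \<Rightarrow> (nat \<Rightarrow> ('a, 'b) pathfun) \<Rightarrow> nat \<Rightarrow> ('a, 'b) pathfun" where
  "potential I J N c u t =
     (\<lambda>z. - ln (J t (\<lambda>w. exp (u t w - value_fun I J N c u t w)) z))"

declare cond_proj.simps [simp del] value_fun.simps [simp del]

text \<open>
  The initial segment of length \<open>0\<close> being unique, both sides are constant functions, namely
  \<open>\<integral> f\<^sub>1 d\<mu>\<^sub>1\<close> and \<open>\<integral> g\<^sub>1 d\<nu>\<^sub>1\<close>.
\<close>

definition normalized ::
    "(nat \<Rightarrow> (nat \<Rightarrow> 'a) \<Rightarrow> 'a measure) \<Rightarrow> (nat \<Rightarrow> (nat \<Rightarrow> 'b) \<Rightarrow> 'b measure) \<Rightarrow>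
     (nat \<Rightarrow> ('a, 'b) pathfun) \<Rightarrow> (nat \<Rightarrow> ('a, 'b) pathfun) \<Rightarrow> bool" where
  "normalized K L f g \<longleftrightarrow> int_x K 1 (f 1) = int_y L 1 (g 1)"

end

theory Submission
  imports Defs
begin

text \<open>
  The first-order condition for \<open>h = f + g\<close> says that \<open>\<rho> = exp (h - c)\<close> satisfies
  \<open>E[k \<rho>] = E[k]\<close> for every \<open>k\<close> in the dual space, i.e. that \<open>\<rho> dP\<close> is (bi)causal.  Integrating out
  \<open>y\<^sub>N, x\<^sub>N, y\<^bsub>N-1\<^esub>, \<dots>\<close> one after the other, backward induction shows that the conditional
  expectation of \<open>\<rho>\<close> given \<open>(x\<^bsub>1:t\<^esub>, y\<^bsub>1:t\<^esub>)\<close> is \<open>exp (\<Sum>s\<le>t. (f\<^sub>s + g\<^sub>s) - c\<^sub>t)\<close>: causality makes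
  \<open>f\<^sub>t - a\<^sub>t\<close> a function of \<open>(x\<^bsub>1:t-1\<^esub>, y\<^bsub>1:t-1\<^esub>)\<close>, and since \<open>f\<^sub>t\<close> is centred this function is \<open>-c\<^bsub>t-1\<^esub>\<close>.

  For the bounds, the map \<open>\<phi> \<mapsto> - ln \<integral> exp \<phi>\<close> is nonexpansive for the supremum norm.  So if
  \<open>c\<^sub>t\<close> is within \<open>\<gamma>\<close> of a function that does not depend on \<open>x\<^sub>t\<close>, then \<open>a\<^sub>t\<close> and \<open>c\<^bsub>t-1\<^esub>\<close> are within
  \<open>\<gamma>\<close> of a common function of \<open>(x\<^bsub>1:t-1\<^esub>, y\<^bsub>1:t-1\<^esub>)\<close>, and \<open>\<bar>f\<^sub>t\<bar> \<le> 2\<gamma>\<close> almost everywhere.  In the causal case such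
  functions of \<open>y\<close> alone persist along the recursion with \<open>\<gamma> = \<parallel>c\<parallel>\<close>; in the bicausal case the
  bounds for \<open>f\<^sub>t\<close> and \<open>g\<^sub>t\<close> feed each other and \<open>\<gamma>\<close> grows by a factor of 3 per step.
  Truncating the potentials and centring them again gives everywhere bounded versions.
\<close>

section \<open>Abstract conditional integration\<close>

text \<open>No bounds on f and g in terms of \<parallel>c\<parallel> are known at the start, and in
  causal mode optimality in g is tested only against functions of the whole path y, so no anticausal
  recursion controls g. Hence c_t is compared not with 0 but with some r free of x_t: passing to g_t
  - c_t and g_t - r leaves the difference unchanged, however large g_t is. Afterwards equation (3)
  bounds g. In bicausal mode r = 0 suffices: |c_t| \<le> \<gamma> and its analogue for d_t give
  |f_t|, |g_t| \<le> 2\<gamma> for t \<ge> 2, so |c| one step earlier is at most \<gamma> +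
  2\<gamma>, whence the factor 3. The means of f_1 and g_1 are determined only up to opposite
  shifts; normalization makes each of them half of \<integral>h, and this integral is controlled by
  optimality.

  The recursion uses only pointwise rules of a conditional expectation, so one proof serves both
  directions, and the same rules cover the marginal. Dependence on initial segments is encoded as
  invariance on \<open>space P\<close>, which passes to pointwise operations at once; measurable
  factors are recovered by completing segments to full paths.\<close>

definition adapted ::
    "'z measure \<Rightarrow> (nat \<Rightarrow> 'z \<Rightarrow> 'u) \<Rightarrow> (nat \<Rightarrow> 'z \<Rightarrow> 'v) \<Rightarrow> nat \<Rightarrow> nat \<Rightarrow> ('z \<Rightarrow> real) set" where
  "adapted P p q s t = {\<phi> \<in> borel_measurable P.
     (\<exists>C. \<forall>z\<in>space P. \<bar>\<phi> z\<bar> \<le> C) \<and>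
     (\<forall>z\<in>space P. \<forall>z'\<in>space P. p s z = p s z' \<longrightarrow> q t z = q t z' \<longrightarrow> \<phi> z = \<phi> z')}"

lemma adaptedI:
  assumes "\<phi> \<in> borel_measurable P" "\<And>z. z \<in> space P \<Longrightarrow> \<bar>\<phi> z\<bar> \<le> C"
    and "\<And>z z'. z \<in> space P \<Longrightarrow> z' \<in> space P \<Longrightarrow> p s z = p s z' \<Longrightarrow> q t z = q t z' \<Longrightarrow> \<phi> z = \<phi> z'"
  shows "\<phi> \<in> adapted P p q s t"
  using assms unfolding adapted_def by blast

lemma adapted_measurable: "\<phi> \<in> adapted P p q s t \<Longrightarrow> \<phi> \<in> borel_measurable P"
  by (simp add: adapted_def)

lemma adapted_bounded:
  assumes "\<phi> \<in> adapted P p q s t"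
  shows "\<exists>C>0. \<forall>z\<in>space P. \<bar>\<phi> z\<bar> \<le> C"
proof -
  from assms obtain C where C: "\<forall>z\<in>space P. \<bar>\<phi> z\<bar> \<le> C" unfolding adapted_def by blast
  show ?thesis by (rule exI[of _ "max C 1"]) (use C in auto)
qed

lemma adapted_eq:
  "\<phi> \<in> adapted P p q s t \<Longrightarrow> z \<in> space P \<Longrightarrow> z' \<in> space P \<Longrightarrow> p s z = p s z' \<Longrightarrow> q t z = q t z'
    \<Longrightarrow> \<phi> z = \<phi> z'"
  unfolding adapted_def by blast

lemma adapted_swap: "adapted P q p t s = adapted P p q s t"
  unfolding adapted_def by blast

lemma adapted_const [simp]: "(\<lambda>z. a) \<in> adapted P p q s t"
  by (rule adaptedI[where C = "\<bar>a\<bar>"]) auto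

lemma adapted_add:
  assumes "\<phi> \<in> adapted P p q s t" "\<psi> \<in> adapted P p q s t"
  shows "(\<lambda>z. \<phi> z + \<psi> z) \<in> adapted P p q s t"
proof -
  obtain C where C: "\<And>z. z \<in> space P \<Longrightarrow> \<bar>\<phi> z\<bar> \<le> C" using adapted_bounded[OF assms(1)] by blast
  obtain D where D: "\<And>z. z \<in> space P \<Longrightarrow> \<bar>\<psi> z\<bar> \<le> D" using adapted_bounded[OF assms(2)] by blast
  note [measurable] = assms[THEN adapted_measurable]
  show ?thesis
  proof (rule adaptedI)
    show "\<bar>\<phi> z + \<psi> z\<bar> \<le> C + D" if "z \<in> space P" for z using C[OF that] D[OF that] by linarith
    show "\<phi> z + \<psi> z = \<phi> z' + \<psi> z'"
      if "z \<in> space P" "z' \<in> space P" "p s z = p s z'" "q t z = q t z'" for z z'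
      using adapted_eq[OF assms(1) that] adapted_eq[OF assms(2) that] by simp
  qed measurable
qed

lemma adapted_mult:
  assumes "\<phi> \<in> adapted P p q s t" "\<psi> \<in> adapted P p q s t"
  shows "(\<lambda>z. \<phi> z * \<psi> z) \<in> adapted P p q s t"
proof -
  obtain C where C: "\<And>z. z \<in> space P \<Longrightarrow> \<bar>\<phi> z\<bar> \<le> C" "C > 0" using adapted_bounded[OF assms(1)] by blast
  obtain D where D: "\<And>z. z \<in> space P \<Longrightarrow> \<bar>\<psi> z\<bar> \<le> D" using adapted_bounded[OF assms(2)] by blast
  note [measurable] = assms[THEN adapted_measurable]
  show ?thesis
  proof (rule adaptedI)
    show "\<bar>\<phi> z * \<psi> z\<bar> \<le> C * D" if "z \<in> space P" for z
      unfolding abs_mult using C(1)[OF that] D[OF that] C(2) by (intro mult_mono) auto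
    show "\<phi> z * \<psi> z = \<phi> z' * \<psi> z'"
      if "z \<in> space P" "z' \<in> space P" "p s z = p s z'" "q t z = q t z'" for z z'
      using adapted_eq[OF assms(1) that] adapted_eq[OF assms(2) that] by simp
  qed measurable
qed

lemma adapted_compose:
  assumes "\<phi> \<in> adapted P p q s t" "F \<in> borel_measurable borel"
    and "\<And>z. z \<in> space P \<Longrightarrow> \<bar>F (\<phi> z)\<bar> \<le> D"
  shows "(\<lambda>z. F (\<phi> z)) \<in> adapted P p q s t"
proof (rule adaptedI)
  note [measurable] = assms(1)[THEN adapted_measurable] assms(2)
  show "(\<lambda>z. F (\<phi> z)) \<in> borel_measurable P" by measurable
  show "F (\<phi> z) = F (\<phi> z')"
    if "z \<in> space P" "z' \<in> space P" "p s z = p s z'" "q t z = q t z'" for z z'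
    using adapted_eq[OF assms(1) that] by simp
qed (rule assms(3))

lemma adapted_uminus: "\<phi> \<in> adapted P p q s t \<Longrightarrow> (\<lambda>z. - \<phi> z) \<in> adapted P p q s t"
  using adapted_mult[OF adapted_const[of "- 1"], of \<phi> P p q s t] by simp

lemma adapted_diff:
  "\<phi> \<in> adapted P p q s t \<Longrightarrow> \<psi> \<in> adapted P p q s t \<Longrightarrow> (\<lambda>z. \<phi> z - \<psi> z) \<in> adapted P p q s t"
  using adapted_add[of \<phi> P p q s t "\<lambda>z. - \<psi> z"] adapted_uminus[of \<psi> P p q s t] by simp

lemma adapted_sum:
  "(\<And>i. i \<in> A \<Longrightarrow> \<phi> i \<in> adapted P p q s t) \<Longrightarrow> (\<lambda>z. \<Sum>i\<in>A. \<phi> i z) \<in> adapted P p q s t"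
  by (induction A rule: infinite_finite_induct) (auto intro: adapted_add)

lemma adapted_exp:
  assumes "\<phi> \<in> adapted P p q s t"
  shows "(\<lambda>z. exp (\<phi> z)) \<in> adapted P p q s t"
proof -
  obtain C where C: "\<And>z. z \<in> space P \<Longrightarrow> \<bar>\<phi> z\<bar> \<le> C" using adapted_bounded[OF assms] by blast
  have "\<bar>exp (\<phi> z)\<bar> \<le> exp C" if "z \<in> space P" for z using C[OF that] by simp
  then show ?thesis by (rule adapted_compose[OF assms borel_measurable_exp])
qed

lemma adapted_ln:
  assumes "\<phi> \<in> adapted P p q s t" "\<epsilon> > 0" "\<And>z. z \<in> space P \<Longrightarrow> \<epsilon> \<le> \<phi> z"
  shows "(\<lambda>z. ln (\<phi> z)) \<in> adapted P p q s t"
proof -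
  obtain C where C: "C > 0" "\<And>z. z \<in> space P \<Longrightarrow> \<bar>\<phi> z\<bar> \<le> C" using adapted_bounded[OF assms(1)] by blast
  have "\<bar>ln (\<phi> z)\<bar> \<le> \<bar>ln \<epsilon>\<bar> + \<bar>ln C\<bar>" if "z \<in> space P" for z
  proof -
    have "ln \<epsilon> \<le> ln (\<phi> z)" "ln (\<phi> z) \<le> ln C"
      using assms(2,3) C that by (smt (verit) ln_le_cancel_iff)+
    then show ?thesis by linarith
  qed
  then show ?thesis by (rule adapted_compose[OF assms(1) borel_measurable_ln[OF measurable_ident_sets[OF refl]]])
qed

definition clip :: "real \<Rightarrow> real \<Rightarrow> real" where
  "clip B r = max (- B) (min B r)"

lemma abs_clip_le: "0 \<le> B \<Longrightarrow> \<bar>clip B r\<bar> \<le> B"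
  by (auto simp: clip_def)

lemma clip_eq: "\<bar>r\<bar> \<le> B \<Longrightarrow> clip B r = r"
  by (auto simp: clip_def)

lemma adapted_clip: "\<phi> \<in> adapted P p q s t \<Longrightarrow> 0 \<le> B \<Longrightarrow> (\<lambda>z. clip B (\<phi> z)) \<in> adapted P p q s t"
  by (rule adapted_compose[where F = "clip B" and D = B])
    (auto simp: abs_clip_le clip_def[abs_def])

lemma adapted_max:
  assumes "\<phi> \<in> adapted P p q s t"
  shows "(\<lambda>z. max 0 (\<phi> z)) \<in> adapted P p q s t"
proof -
  obtain C where C: "\<And>z. z \<in> space P \<Longrightarrow> \<bar>\<phi> z\<bar> \<le> C" "C > 0" using adapted_bounded[OF assms] by blast
  show ?thesis
    by (rule adapted_compose[OF assms, where F = "max 0" and D = C]) (use C in \<open>fastforce simp: abs_le_iff\<close>)+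
qed

text \<open>Minus the conditional log-Laplace transform. With this sign a_t is the soft integral of
  g_t - c_t, and a constant b goes to -b.\<close>

definition soft_int :: "(nat \<Rightarrow> ('z \<Rightarrow> real) \<Rightarrow> 'z \<Rightarrow> real) \<Rightarrow> nat \<Rightarrow> ('z \<Rightarrow> real) \<Rightarrow> 'z \<Rightarrow> real" where
  "soft_int I t \<phi> = (\<lambda>z. - ln (I t (\<lambda>w. exp (\<phi> w)) z))"

text \<open>The rules of a conditional expectation that integrates out coordinate t of p and leaves
  q frozen, demanded at every point of \<open>space P\<close> and not just almost everywhere.
  Kernels in x, kernels in y and the x-marginal are the three instances. By \<open>p_0\<close>,
  empty initial segments carry no information.\<close>

locale cond_ops = prob_space P for P :: "'z measure" +
  fixes p :: "nat \<Rightarrow> 'z \<Rightarrow> 'u" and q :: "nat \<Rightarrow> 'z \<Rightarrow> 'v" and N :: nat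
    and I :: "nat \<Rightarrow> ('z \<Rightarrow> real) \<Rightarrow> 'z \<Rightarrow> real"
  assumes p_mono: "s \<le> s' \<Longrightarrow> p s' z = p s' z' \<Longrightarrow> p s z = p s z'"
    and q_mono: "s \<le> s' \<Longrightarrow> q s' z = q s' z' \<Longrightarrow> q s z = q s z'"
    and p_0: "p 0 z = p 0 z'"
    and I_adapted: "t \<in> {1..N} \<Longrightarrow> \<phi> \<in> adapted P p q t s \<Longrightarrow> I t \<phi> \<in> adapted P p q (t - 1) s"
    and I_cong: "t \<in> {1..N} \<Longrightarrow> (\<And>w. w \<in> space P \<Longrightarrow> \<phi> w = \<psi> w) \<Longrightarrow> z \<in> space P \<Longrightarrow> I t \<phi> z = I t \<psi> z"
    and I_one: "t \<in> {1..N} \<Longrightarrow> z \<in> space P \<Longrightarrow> I t (\<lambda>_. 1) z = 1"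
    and I_add: "t \<in> {1..N} \<Longrightarrow> \<phi> \<in> adapted P p q t s \<Longrightarrow> \<psi> \<in> adapted P p q t s \<Longrightarrow> z \<in> space P \<Longrightarrow>
      I t (\<lambda>w. \<phi> w + \<psi> w) z = I t \<phi> z + I t \<psi> z"
    and I_mult: "t \<in> {1..N} \<Longrightarrow> \<psi> \<in> adapted P p q (t - 1) s \<Longrightarrow> \<phi> \<in> adapted P p q t s \<Longrightarrow> z \<in> space P \<Longrightarrow>
      I t (\<lambda>w. \<psi> w * \<phi> w) z = \<psi> z * I t \<phi> z"
    and I_nonneg: "t \<in> {1..N} \<Longrightarrow> \<phi> \<in> adapted P p q t s \<Longrightarrow> (\<And>w. w \<in> space P \<Longrightarrow> 0 \<le> \<phi> w) \<Longrightarrow>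
      z \<in> space P \<Longrightarrow> 0 \<le> I t \<phi> z"
    and expectation_I: "t \<in> {1..N} \<Longrightarrow> \<phi> \<in> adapted P p q t s \<Longrightarrow> expectation (I t \<phi>) = expectation \<phi>"
begin

lemma adapted_mono:
  assumes "s \<le> s'" "t \<le> t'" "\<phi> \<in> adapted P p q s t"
  shows "\<phi> \<in> adapted P p q s' t'"
proof -
  obtain C where C: "\<And>z. z \<in> space P \<Longrightarrow> \<bar>\<phi> z\<bar> \<le> C" using adapted_bounded[OF assms(3)] by blast
  show ?thesis
  proof (rule adaptedI[OF adapted_measurable[OF assms(3)] C])
    show "\<phi> z = \<phi> z'" if "z \<in> space P" "z' \<in> space P" "p s' z = p s' z'" "q t' z = q t' z'" for z z'
      using adapted_eq[OF assms(3) that(1,2) p_mono[OF assms(1) that(3)] q_mono[OF assms(2) that(4)]] .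
  qed
qed

lemma adapted_integrable:
  assumes "\<phi> \<in> adapted P p q s t"
  shows "integrable P \<phi>"
proof -
  obtain C where "\<And>z. z \<in> space P \<Longrightarrow> \<bar>\<phi> z\<bar> \<le> C" using adapted_bounded[OF assms] by blast
  then show ?thesis by (intro integrable_const_bound[where B = C] adapted_measurable[OF assms] AE_I2) simp
qed

lemma adapted_pred: "\<phi> \<in> adapted P p q (t - 1) s \<Longrightarrow> \<phi> \<in> adapted P p q t s"
  by (rule adapted_mono[of "t - 1" t]) simp_all

lemma I_pull:
  assumes "t \<in> {1..N}" "\<psi> \<in> adapted P p q (t - 1) s" "z \<in> space P"
  shows "I t \<psi> z = \<psi> z"
  using I_mult[OF assms(1,2) adapted_const[of 1] assms(3)] I_one[OF assms(1,3)] by simp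

lemma I_scale:
  "t \<in> {1..N} \<Longrightarrow> \<phi> \<in> adapted P p q t s \<Longrightarrow> z \<in> space P \<Longrightarrow> I t (\<lambda>w. a * \<phi> w) z = a * I t \<phi> z"
  by (rule I_mult[OF _ adapted_const])

lemma I_diff:
  assumes "t \<in> {1..N}" "\<phi> \<in> adapted P p q t s" "\<psi> \<in> adapted P p q t s" "z \<in> space P"
  shows "I t (\<lambda>w. \<phi> w - \<psi> w) z = I t \<phi> z - I t \<psi> z"
  using I_add[OF assms(1,2) adapted_uminus[OF assms(3)] assms(4)] I_scale[OF assms(1,3,4), of "- 1"]
  by simp

lemma I_mono:
  assumes "t \<in> {1..N}" "\<phi> \<in> adapted P p q t s" "\<psi> \<in> adapted P p q t s" "z \<in> space P"
    and "\<And>w. w \<in> space P \<Longrightarrow> \<phi> w \<le> \<psi> w"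
  shows "I t \<phi> z \<le> I t \<psi> z"
  using I_nonneg[OF assms(1) adapted_diff[OF assms(3,2)] _ assms(4)] I_diff[OF assms(1,3,2,4)] assms(5)
  by simp

lemma I_bound:
  assumes "t \<in> {1..N}" "\<phi> \<in> adapted P p q t s" "z \<in> space P"
    and "\<And>w. w \<in> space P \<Longrightarrow> \<bar>\<phi> w\<bar> \<le> B"
  shows "\<bar>I t \<phi> z\<bar> \<le> B"
proof -
  have "I t \<phi> z \<le> I t (\<lambda>_. B) z" "I t (\<lambda>_. - B) z \<le> I t \<phi> z"
    using assms(4) by (auto intro!: I_mono[OF assms(1) _ _ assms(3), of _ s] assms(2) simp: abs_le_iff minus_le_iff)
  moreover have "I t (\<lambda>_. b) z = b" for b
    by (rule I_pull[OF assms(1) adapted_const assms(3)])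
  ultimately show ?thesis by simp
qed

text \<open>An operator given pointwise need not respect null sets a priori. The positive part
  \<eta> of \<phi> - \<psi> has expectation 0; \<open>I t \<eta>\<close> is nonnegative with the
  same expectation, hence vanishes almost everywhere.\<close>

lemma I_AE_mono:
  assumes t: "t \<in> {1..N}" and \<phi>: "\<phi> \<in> adapted P p q t s" and \<psi>: "\<psi> \<in> adapted P p q t s"
    and le: "AE z in P. \<phi> z \<le> \<psi> z"
  shows "AE z in P. I t \<phi> z \<le> I t \<psi> z"
proof -
  define \<eta> where "\<eta> = (\<lambda>z. max 0 (\<phi> z - \<psi> z))"
  have \<eta>: "\<eta> \<in> adapted P p q t s" unfolding \<eta>_def by (intro adapted_max adapted_diff \<phi> \<psi>)
  have I\<eta>: "I t \<eta> \<in> adapted P p q (t - 1) s" by (rule I_adapted[OF t \<eta>])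
  have nonneg: "0 \<le> I t \<eta> z" if "z \<in> space P" for z
    by (rule I_nonneg[OF t \<eta> _ that]) (simp add: \<eta>_def)
  have "expectation \<eta> = 0"
  proof -
    have "AE z in P. \<eta> z = 0" using le by (auto simp: \<eta>_def)
    then have "expectation \<eta> = expectation (\<lambda>_. 0)"
      using adapted_measurable[OF \<eta>] by (intro integral_cong_AE) auto
    then show ?thesis by simp
  qed
  then have "expectation (I t \<eta>) = 0" using expectation_I[OF t \<eta>] by simp
  then have AE0: "AE z in P. I t \<eta> z = 0"
    using integral_nonneg_eq_0_iff_AE[OF adapted_integrable[OF I\<eta>]] nonneg by auto
  have le_sum: "I t \<phi> z \<le> I t \<psi> z + I t \<eta> z" if "z \<in> space P" for z
  proof -
    have "I t \<phi> z \<le> I t (\<lambda>w. \<psi> w + \<eta> w) z"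
      by (rule I_mono[OF t \<phi> adapted_add[OF \<psi> \<eta>] that]) (simp add: \<eta>_def)
    then show ?thesis using I_add[OF t \<psi> \<eta> that] by simp
  qed
  from AE0 AE_space show ?thesis by eventually_elim (use le_sum in force)
qed

lemma I_AE_cong:
  assumes "t \<in> {1..N}" "\<phi> \<in> adapted P p q t s" "\<psi> \<in> adapted P p q t s"
    and "AE z in P. \<phi> z = \<psi> z"
  shows "AE z in P. I t \<phi> z = I t \<psi> z"
proof -
  have "AE z in P. \<phi> z \<le> \<psi> z" "AE z in P. \<psi> z \<le> \<phi> z" using assms(4) by auto
  from I_AE_mono[OF assms(1-3) this(1)] I_AE_mono[OF assms(1,3,2) this(2)]
  have "AE z in P. I t \<phi> z \<le> I t \<psi> z" "AE z in P. I t \<psi> z \<le> I t \<phi> z" .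
  then show ?thesis by eventually_elim simp
qed

lemma I_AE_close:
  assumes t: "t \<in> {1..N}" and \<phi>: "\<phi> \<in> adapted P p q t s" and \<psi>: "\<psi> \<in> adapted P p q t s"
    and "AE z in P. \<bar>\<phi> z - \<psi> z\<bar> \<le> \<gamma>"
  shows "AE z in P. \<bar>I t \<phi> z - I t \<psi> z\<bar> \<le> \<gamma>"
proof -
  have *: "AE z in P. I t \<alpha> z \<le> I t \<beta> z + \<gamma>"
    if "\<alpha> \<in> adapted P p q t s" "\<beta> \<in> adapted P p q t s" "AE z in P. \<bar>\<alpha> z - \<beta> z\<bar> \<le> \<gamma>" for \<alpha> \<beta>
  proof -
    have "AE z in P. I t \<alpha> z \<le> I t (\<lambda>w. \<beta> w + \<gamma>) z" (is ?le)
      using that(3) by (intro I_AE_mono[OF t that(1)] adapted_add that(2)) auto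
    have eq: "I t (\<lambda>w. \<beta> w + \<gamma>) z = I t \<beta> z + \<gamma>" if "z \<in> space P" for z
      using I_add[OF t \<open>\<beta> \<in> _\<close> adapted_const that] I_pull[OF t adapted_const that] by simp
    from \<open>?le\<close> AE_space show ?thesis by eventually_elim (simp add: eq)
  qed
  from *[OF \<phi> \<psi> assms(4)] *[OF \<psi> \<phi>] assms(4)
  have "AE z in P. I t \<phi> z \<le> I t \<psi> z + \<gamma>" "AE z in P. I t \<psi> z \<le> I t \<phi> z + \<gamma>"
    by (auto simp: abs_minus_commute)
  then show ?thesis by eventually_elim linarith
qed

lemma centred:
  assumes "t \<in> {1..N}" "k \<in> adapted P p q t s" "z \<in> space P"
  shows "I t (\<lambda>w. k w - I t k w) z = 0"
  using I_diff[OF assms(1,2) adapted_pred[OF I_adapted[OF assms(1,2)]] assms(3)]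
    I_pull[OF assms(1) I_adapted[OF assms(1,2)] assms(3)] by simp

lemma expectation_mult_I:
  assumes t: "t \<in> {1..N}" and \<psi>: "\<psi> \<in> adapted P p q (t - 1) s" and \<phi>: "\<phi> \<in> adapted P p q t s"
  shows "expectation (\<lambda>z. \<psi> z * I t \<phi> z) = expectation (\<lambda>z. \<psi> z * \<phi> z)"
proof -
  have "expectation (\<lambda>z. \<psi> z * I t \<phi> z) = expectation (I t (\<lambda>z. \<psi> z * \<phi> z))"
    by (rule Bochner_Integration.integral_cong[OF refl]) (simp add: I_mult[OF t \<psi> \<phi>])
  also have "\<dots> = expectation (\<lambda>z. \<psi> z * \<phi> z)"
    by (rule expectation_I[OF t adapted_mult[OF adapted_pred[OF \<psi>] \<phi>]])
  finally show ?thesis .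
qed

text \<open>The test function is \<open>\<phi> - I t \<phi>\<close>.\<close>

lemma AE_eq_I:
  assumes t: "t \<in> {1..N}" and \<phi>: "\<phi> \<in> adapted P p q t s"
    and orth: "\<And>k. k \<in> adapted P p q t s \<Longrightarrow> (\<And>z. z \<in> space P \<Longrightarrow> I t k z = 0) \<Longrightarrow>
      expectation (\<lambda>z. k z * \<phi> z) = 0"
  shows "AE z in P. \<phi> z = I t \<phi> z"
proof -
  define k where "k = (\<lambda>z. \<phi> z - I t \<phi> z)"
  have I\<phi>: "I t \<phi> \<in> adapted P p q (t - 1) s" by (rule I_adapted[OF t \<phi>])
  have k: "k \<in> adapted P p q t s" unfolding k_def by (intro adapted_diff \<phi> adapted_pred[OF I\<phi>])
  have Ik: "I t k z = 0" if "z \<in> space P" for z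
    unfolding k_def by (rule centred[OF t \<phi> that])
  have "expectation (\<lambda>z. I t \<phi> z * k z) = expectation (\<lambda>z. I t \<phi> z * I t k z)"
    by (rule expectation_mult_I[OF t I\<phi> k, symmetric])
  also have "\<dots> = expectation (\<lambda>z. 0)"
    by (rule Bochner_Integration.integral_cong[OF refl]) (simp add: Ik)
  finally have 0: "expectation (\<lambda>z. I t \<phi> z * k z) = 0" by simp
  have "expectation (\<lambda>z. k z * k z) = expectation (\<lambda>z. k z * \<phi> z - I t \<phi> z * k z)"
    by (rule Bochner_Integration.integral_cong[OF refl]) (simp add: k_def algebra_simps)
  also have "\<dots> = expectation (\<lambda>z. k z * \<phi> z) - expectation (\<lambda>z. I t \<phi> z * k z)"
    by (intro Bochner_Integration.integral_diff adapted_integrable[of _ t s] adapted_mult k \<phi> adapted_pred[OF I\<phi>])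
  finally have "expectation (\<lambda>z. k z * k z) = 0" using 0 orth[OF k Ik] by simp
  then have "AE z in P. k z * k z = 0"
    using integral_nonneg_eq_0_iff_AE[OF adapted_integrable[OF adapted_mult[OF k k]]] by simp
  then show ?thesis by eventually_elim (simp add: k_def)
qed

text \<open>Testing with \<phi> - 1 makes the expectation of its square vanish. This is the
  counterpart of \<open>AE_eq_I\<close> for test classes without centring: time 1, and the functions
  of y in causal mode.\<close>

lemma AE_eq_1:
  assumes \<phi>: "\<phi> \<in> adapted P p q s t"
    and test: "\<And>k. k \<in> adapted P p q s t \<Longrightarrow> expectation (\<lambda>z. k z * \<phi> z) = expectation k"
  shows "AE z in P. \<phi> z = 1"
proof -
  define k where "k = (\<lambda>z. \<phi> z - 1)"
  have k: "k \<in> adapted P p q s t" unfolding k_def by (intro adapted_diff \<phi> adapted_const)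
  have "expectation (\<lambda>z. k z * k z) = expectation (\<lambda>z. k z * \<phi> z - k z)"
    by (simp add: k_def algebra_simps)
  also have "\<dots> = expectation (\<lambda>z. k z * \<phi> z) - expectation k"
    by (intro Bochner_Integration.integral_diff adapted_integrable[of _ s t] adapted_mult k \<phi>)
  finally have "expectation (\<lambda>z. k z * k z) = 0" using test[OF k] by simp
  then have "AE z in P. k z * k z = 0"
    using integral_nonneg_eq_0_iff_AE[OF adapted_integrable[OF adapted_mult[OF k k]]] by simp
  then show ?thesis by eventually_elim (simp add: k_def)
qed

lemma I_exp_lower:
  assumes "t \<in> {1..N}" "\<phi> \<in> adapted P p q t s"
  shows "\<exists>\<epsilon>>0. \<forall>z\<in>space P. \<epsilon> \<le> I t (\<lambda>w. exp (\<phi> w)) z"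
proof -
  obtain C where C: "\<And>z. z \<in> space P \<Longrightarrow> \<bar>\<phi> z\<bar> \<le> C" using adapted_bounded[OF assms(2)] by blast
  have "exp (- C) \<le> I t (\<lambda>w. exp (\<phi> w)) z" if "z \<in> space P" for z
  proof -
    have "I t (\<lambda>_. exp (- C)) z \<le> I t (\<lambda>w. exp (\<phi> w)) z"
      using C by (intro I_mono[OF assms(1) adapted_const adapted_exp[OF assms(2)] that]) (simp add: abs_le_iff minus_le_iff)
    then show ?thesis using I_pull[OF assms(1) adapted_const that] by simp
  qed
  then show ?thesis by (intro exI[of _ "exp (- C)"]) simp
qed

lemma soft_int_adapted:
  assumes "t \<in> {1..N}" "\<phi> \<in> adapted P p q t s"
  shows "soft_int I t \<phi> \<in> adapted P p q (t - 1) s"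
proof -
  obtain \<epsilon> where "\<epsilon> > 0" "\<And>z. z \<in> space P \<Longrightarrow> \<epsilon> \<le> I t (\<lambda>w. exp (\<phi> w)) z" using I_exp_lower[OF assms] by blast
  then show ?thesis unfolding soft_int_def
    by (intro adapted_uminus adapted_ln[of _ P p q "t - 1" s \<epsilon>] I_adapted[OF assms(1)] adapted_exp assms(2))
qed

lemma exp_soft_int:
  assumes "t \<in> {1..N}" "\<phi> \<in> adapted P p q t s" "z \<in> space P"
  shows "exp (- soft_int I t \<phi> z) = I t (\<lambda>w. exp (\<phi> w)) z"
proof -
  obtain \<epsilon> where "\<epsilon> > 0" "\<And>z. z \<in> space P \<Longrightarrow> \<epsilon> \<le> I t (\<lambda>w. exp (\<phi> w)) z"
    using I_exp_lower[OF assms(1,2)] by blast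
  then have "0 < I t (\<lambda>w. exp (\<phi> w)) z" using assms(3) by force
  then show ?thesis by (simp add: soft_int_def)
qed

text \<open>The factor exp \<psi> pulls out of the integral, so adding an earlier function \<psi> to
  the argument merely subtracts \<psi> from the soft integral. Both the recursion and the
  nonexpansiveness rest on this.\<close>

lemma I_exp_add:
  assumes "t \<in> {1..N}" "\<psi> \<in> adapted P p q (t - 1) s" "\<phi> \<in> adapted P p q t s" "z \<in> space P"
  shows "I t (\<lambda>w. exp (\<psi> w + \<phi> w)) z = exp (\<psi> z - soft_int I t \<phi> z)"
  using I_mult[OF assms(1) adapted_exp[OF assms(2)] adapted_exp[OF assms(3)] assms(4)]
    exp_soft_int[OF assms(1,3,4)] by (simp add: exp_add exp_diff exp_minus divide_inverse)

lemma soft_int_AE_close: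
  assumes t: "t \<in> {1..N}" and \<phi>: "\<phi> \<in> adapted P p q t s" and \<psi>: "\<psi> \<in> adapted P p q t s"
    and "AE z in P. \<bar>\<phi> z - \<psi> z\<bar> \<le> \<gamma>"
  shows "AE z in P. \<bar>soft_int I t \<phi> z - soft_int I t \<psi> z\<bar> \<le> \<gamma>"
proof -
  \<comment> \<open>One side of the estimate: monotonicity, after which the constant \<gamma>
    factors out of the exponential. Exchanging the two functions gives the other side.\<close>
  have *: "AE z in P. - soft_int I t \<alpha> z \<le> - soft_int I t \<beta> z + \<gamma>"
    if "\<alpha> \<in> adapted P p q t s" "\<beta> \<in> adapted P p q t s" "AE z in P. \<bar>\<alpha> z - \<beta> z\<bar> \<le> \<gamma>" for \<alpha> \<beta>
  proof -
    have "AE z in P. I t (\<lambda>w. exp (\<alpha> w)) z \<le> I t (\<lambda>w. exp (\<gamma> + \<beta> w)) z" (is ?le)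
      using that(3) by (intro I_AE_mono[OF t, of _ s] adapted_exp adapted_add adapted_const that(1,2)) auto
    have eq: "I t (\<lambda>w. exp (\<gamma> + \<beta> w)) z = exp (\<gamma> - soft_int I t \<beta> z)" if "z \<in> space P" for z
      by (rule I_exp_add[OF t adapted_const \<open>\<beta> \<in> _\<close> that])
    from \<open>?le\<close> AE_space have "AE z in P. exp (- soft_int I t \<alpha> z) \<le> exp (\<gamma> - soft_int I t \<beta> z)"
      by eventually_elim (simp add: exp_soft_int[OF t that(1)] eq)
    then show ?thesis by eventually_elim simp
  qed
  from *[OF \<phi> \<psi> assms(4)] *[OF \<psi> \<phi>] assms(4)
  have "AE z in P. - soft_int I t \<phi> z \<le> - soft_int I t \<psi> z + \<gamma>"
      "AE z in P. - soft_int I t \<psi> z \<le> - soft_int I t \<phi> z + \<gamma>"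
    by (auto simp: abs_minus_commute)
  then show ?thesis by eventually_elim linarith
qed

end

section \<open>Centred functions and their truncation\<close>

context cond_ops
begin

text \<open>Centring is expressed by a vanishing integral instead of the form a - I t a, so that
  linearity is immediate. Time 1 is exempt, as its class contains all bounded functions, in
  particular the constants.\<close>

definition centred_space :: "nat \<Rightarrow> ('z \<Rightarrow> real) set" where
  "centred_space t = {\<phi> \<in> adapted P p q t (t - 1). t \<noteq> 1 \<longrightarrow> (\<forall>z\<in>space P. I t \<phi> z = 0)}"

lemma centred_spaceD:
  "\<phi> \<in> centred_space t \<Longrightarrow> \<phi> \<in> adapted P p q t (t - 1)"
  "\<phi> \<in> centred_space t \<Longrightarrow> t \<noteq> 1 \<Longrightarrow> z \<in> space P \<Longrightarrow> I t \<phi> z = 0"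
  by (auto simp: centred_space_def)

lemma centred_space_expectation:
  assumes "t \<in> {2..N}" "\<phi> \<in> centred_space t"
  shows "expectation \<phi> = 0"
proof -
  have "expectation \<phi> = expectation (I t \<phi>)"
    using assms centred_spaceD(1)[OF assms(2)] by (intro expectation_I[symmetric, of _ _ "t - 1"]) auto
  also have "\<dots> = expectation (\<lambda>_. 0)"
    using assms by (intro Bochner_Integration.integral_cong[OF refl] centred_spaceD) auto
  finally show ?thesis by simp
qed

lemma centred_space_add_scale:
  assumes "t \<in> {1..N}" "\<phi> \<in> centred_space t" "\<psi> \<in> centred_space t"
  shows "(\<lambda>z. \<phi> z + a * \<psi> z) \<in> centred_space t"
proof -
  have *: "(\<lambda>z. a * \<psi> z) \<in> adapted P p q t (t - 1)"
    by (intro adapted_mult adapted_const centred_spaceD assms(3))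
  have "I t (\<lambda>z. \<phi> z + a * \<psi> z) z = I t \<phi> z + a * I t \<psi> z" if "z \<in> space P" for z
    using I_add[OF assms(1) centred_spaceD(1)[OF assms(2)] * that]
      I_scale[OF assms(1) centred_spaceD(1)[OF assms(3)] that] by simp
  then show ?thesis
    using centred_spaceD[OF assms(2)] centred_spaceD[OF assms(3)] adapted_add[OF _ *]
    unfolding centred_space_def by simp
qed

text \<open>Truncation at an almost everywhere bound changes f only on a null set but destroys the
  centring. Subtracting \<open>I t a\<close> restores it at the price of a factor 2, and is again a
  change on a null set because \<open>I t f\<close> vanishes.\<close>

lemma centred_clip:
  assumes t: "t \<in> {1..N}" and f: "f \<in> centred_space t" and "0 \<le> B" and bound: "AE z in P. \<bar>f z\<bar> \<le> B"
  shows "\<exists>\<phi>\<in>centred_space t. (\<forall>z\<in>space P. \<bar>\<phi> z\<bar> \<le> 2 * B) \<and> (AE z in P. \<phi> z = f z)"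
proof -
  define a where "a = (\<lambda>z. clip B (f z))"
  have a: "a \<in> adapted P p q t (t - 1)"
    unfolding a_def by (intro adapted_clip centred_spaceD(1)[OF f] assms(3))
  have a_le: "\<bar>a z\<bar> \<le> B" for z unfolding a_def by (rule abs_clip_le[OF assms(3)])
  have a_eq: "AE z in P. a z = f z"
    using bound by eventually_elim (simp add: a_def clip_eq)
  show ?thesis
  proof (cases "t = 1")
    case True
    have "\<bar>a z\<bar> \<le> 2 * B" for z using a_le[of z] assms(3) by linarith
    moreover have "a \<in> centred_space t" using a True by (simp add: centred_space_def)
    ultimately show ?thesis using a_eq by blast
  next
    case False
    have c: "(\<lambda>z. a z - I t a z) \<in> centred_space t"
      unfolding centred_space_def
      by (intro CollectI conjI impI ballI centred[OF t a] adapted_diff[OF a adapted_pred[OF I_adapted[OF t a]]])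
    have b: "\<bar>a z - I t a z\<bar> \<le> 2 * B" if "z \<in> space P" for z
      using a_le[of z] I_bound[OF t a that a_le] by linarith
    have "AE z in P. a z - I t a z = f z"
    proof -
      have I_f: "I t f z = 0" if "z \<in> space P" for z by (rule centred_spaceD(2)[OF f False that])
      from I_AE_cong[OF t a centred_spaceD(1)[OF f] a_eq] a_eq AE_space show ?thesis
        by eventually_elim (simp add: I_f)
    qed
    then show ?thesis by (intro bexI[OF _ c] conjI ballI b)
  qed
qed

end

section \<open>The backward recursion and its bounds\<close>

text \<open>Optimality enters only through test functions on the x side, which is what the two modes
  have in common. The bicausal mode instantiates the locale a second time with the two sides
  exchanged.\<close>

locale causal_system = X: cond_ops P p q N I + Y: cond_ops P q p N J
  for P :: "((nat \<Rightarrow> 'a) \<times> (nat \<Rightarrow> 'b)) measure"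
    and p :: "nat \<Rightarrow> (nat \<Rightarrow> 'a) \<times> (nat \<Rightarrow> 'b) \<Rightarrow> 'u" and q :: "nat \<Rightarrow> (nat \<Rightarrow> 'a) \<times> (nat \<Rightarrow> 'b) \<Rightarrow> 'v"
    and N :: nat and I J :: "nat \<Rightarrow> ('a, 'b) pathfun \<Rightarrow> ('a, 'b) pathfun" +
  fixes c :: "('a, 'b) pathfun" and f g :: "nat \<Rightarrow> ('a, 'b) pathfun"
  assumes N: "1 \<le> N"
    and c: "c \<in> adapted P p q N N"
    and f: "t \<in> {1..N} \<Longrightarrow> f t \<in> X.centred_space t"
    and g: "t \<in> {1..N} \<Longrightarrow> g t \<in> adapted P p q (t - 1) t"
    and first_order: "t \<in> {1..N} \<Longrightarrow> k \<in> X.centred_space t \<Longrightarrow>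
      (\<integral>z. k z * exp ((\<Sum>s=1..N. f s z + g s z) - c z) \<partial>P) = (\<integral>z. k z \<partial>P)"
begin

abbreviation "ad \<equiv> adapted P p q"

lemma Y_facts:
  "t \<in> {1..N} \<Longrightarrow> \<phi> \<in> ad s t \<Longrightarrow> soft_int J t \<phi> \<in> ad s (t - 1)"
  "t \<in> {1..N} \<Longrightarrow> \<psi> \<in> ad s (t - 1) \<Longrightarrow> \<phi> \<in> ad s t \<Longrightarrow> z \<in> space P \<Longrightarrow>
    J t (\<lambda>w. exp (\<psi> w + \<phi> w)) z = exp (\<psi> z - soft_int J t \<phi> z)"
  "t \<in> {1..N} \<Longrightarrow> \<psi> \<in> ad s (t - 1) \<Longrightarrow> \<phi> \<in> ad s t \<Longrightarrow>
    (\<integral>z. \<psi> z * J t \<phi> z \<partial>P) = (\<integral>z. \<psi> z * \<phi> z \<partial>P)"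
  "t \<in> {1..N} \<Longrightarrow> \<phi> \<in> ad s t \<Longrightarrow> \<psi> \<in> ad s t \<Longrightarrow> AE z in P. \<bar>\<phi> z - \<psi> z\<bar> \<le> \<gamma> \<Longrightarrow>
    AE z in P. \<bar>soft_int J t \<phi> z - soft_int J t \<psi> z\<bar> \<le> \<gamma>"
  using Y.soft_int_adapted[of t \<phi> s] Y.I_exp_add[of t \<psi> s \<phi> z] Y.expectation_mult_I[of t \<psi> s \<phi>]
    Y.soft_int_AE_close[of t \<phi> s \<psi> \<gamma>]
  unfolding adapted_swap[of P q p] by blast+

abbreviation "cv \<equiv> value_fun I J N c g"

definition av :: "nat \<Rightarrow> ('a, 'b) pathfun" where
  "av t = soft_int J t (\<lambda>w. g t w - cv t w)"

lemma potential_eq: "potential I J N c g t = av t"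
  by (simp add: potential_def av_def soft_int_def)

lemma cv_N: "cv N = c"
  by (subst value_fun.simps) simp

lemma cv_pred: "t \<in> {1..N} \<Longrightarrow> cv (t - 1) = I t (av t)"
  by (subst value_fun.simps) (auto simp: av_def soft_int_def)

lemma f_adapted: "t \<in> {1..N} \<Longrightarrow> f t \<in> ad t (t - 1)"
  by (rule X.centred_spaceD(1)[OF f])

lemma g_adapted: "t \<in> {1..N} \<Longrightarrow> g t \<in> ad t t"
  by (rule X.adapted_mono[OF _ _ g]) auto

lemma av_adapted': "t \<in> {1..N} \<Longrightarrow> cv t \<in> ad t t \<Longrightarrow> av t \<in> ad t (t - 1)"
  unfolding av_def by (intro Y_facts(1) adapted_diff g_adapted)

lemma cv_adapted: "t \<le> N \<Longrightarrow> cv t \<in> ad t t"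
proof (induction rule: inc_induct)
  case base
  then show ?case by (simp add: cv_N c)
next
  case (step n)
  then have "I (Suc n) (av (Suc n)) \<in> ad n n"
    using X.I_adapted[OF _ av_adapted', of "Suc n"] by simp
  then show ?case using cv_pred[of "Suc n"] step by simp
qed

lemma av_adapted: "t \<in> {1..N} \<Longrightarrow> av t \<in> ad t (t - 1)"
  by (rule av_adapted'[OF _ cv_adapted]) auto

definition S :: "nat \<Rightarrow> ('a, 'b) pathfun" where
  "S t = (\<lambda>z. \<Sum>s=1..t. f s z + g s z)"

lemma S_pred: "t \<in> {1..N} \<Longrightarrow> S t z = S (t - 1) z + f t z + g t z"
  by (cases t) (auto simp: S_def)

lemma S_adapted: "t \<le> N \<Longrightarrow> S t \<in> ad t t"
  unfolding S_def
  by (intro adapted_sum adapted_add X.adapted_mono[OF _ _ f_adapted] X.adapted_mono[OF _ _ g]) auto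

text \<open>Weak form of: the conditional expectation of exp(S N - c) given both initial segments of
  length t is exp(S t - cv t).\<close>

definition tested :: "nat \<Rightarrow> bool" where
  "tested t \<longleftrightarrow> (\<forall>k\<in>ad t t.
     (\<integral>z. k z * exp (S N z - c z) \<partial>P) = (\<integral>z. k z * exp (S t z - cv t z) \<partial>P))"

text \<open>Half a step of the backward induction: integrating out y_t alone turns g t - cv t into
  -av t. The result depends on x up to t and y up to t - 1, exactly the variables of the test
  functions in the first-order condition.\<close>

lemma tested_half:
  assumes t: "t \<in> {1..N}" and "tested t" and k: "k \<in> ad t (t - 1)"
  shows "(\<integral>z. k z * exp (S N z - c z) \<partial>P) = (\<integral>z. k z * exp (S (t - 1) z + (f t z - av t z)) \<partial>P)"
proof -
  have Sf: "(\<lambda>z. S (t - 1) z + f t z) \<in> ad t (t - 1)"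
    using t by (intro adapted_add f_adapted X.adapted_mono[OF _ _ S_adapted]) auto
  have gc: "(\<lambda>z. g t z - cv t z) \<in> ad t t"
    using t by (intro adapted_diff g_adapted cv_adapted) auto
  have R: "(\<lambda>z. exp (S t z - cv t z)) \<in> ad t t"
    using t by (intro adapted_exp adapted_diff S_adapted cv_adapted) auto
  have "(\<integral>z. k z * exp (S N z - c z) \<partial>P) = (\<integral>z. k z * exp (S t z - cv t z) \<partial>P)"
    using assms X.adapted_mono[OF _ _ k, of t t] by (auto simp: tested_def)
  also have "\<dots> = (\<integral>z. k z * J t (\<lambda>z. exp (S t z - cv t z)) z \<partial>P)"
    by (rule Y_facts(3)[OF t k R, symmetric])
  also have "\<dots> = (\<integral>z. k z * exp (S (t - 1) z + (f t z - av t z)) \<partial>P)"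
  proof (rule Bochner_Integration.integral_cong[OF refl])
    fix z assume "z \<in> space P"
    from Y_facts(2)[OF t Sf gc this]
    show "k z * J t (\<lambda>z. exp (S t z - cv t z)) z = k z * exp (S (t - 1) z + (f t z - av t z))"
      by (simp add: S_pred[OF t] av_def algebra_simps)
  qed
  finally show ?thesis .
qed

lemma f_eq_of_tested:
  assumes t: "t \<in> {2..N}" and "tested t"
  shows "AE z in P. f t z = av t z - cv (t - 1) z"
proof -
  have t1: "t \<in> {1..N}" and t_ne: "t \<noteq> 1" using t by auto
  define \<psi> where "\<psi> = (\<lambda>z. f t z - av t z)"
  have \<psi>: "\<psi> \<in> ad t (t - 1)" unfolding \<psi>_def by (intro adapted_diff f_adapted av_adapted t1)
  have S1: "S (t - 1) \<in> ad (t - 1) (t - 1)" using t by (intro S_adapted) auto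
  have Rm: "(\<lambda>z. exp (S (t - 1) z + \<psi> z)) \<in> ad t (t - 1)"
    by (intro adapted_exp adapted_add X.adapted_pred[OF S1] \<psi>)
  \<comment> \<open>Centred test functions have mean 0 for t \<ge> 2, so the first-order condition
    makes them orthogonal to the half-step density.\<close>
  have "AE z in P. exp (S (t - 1) z + \<psi> z) = I t (\<lambda>z. exp (S (t - 1) z + \<psi> z)) z"
  proof (rule X.AE_eq_I[OF t1 Rm])
    fix k assume k: "k \<in> ad t (t - 1)" "\<And>z. z \<in> space P \<Longrightarrow> I t k z = 0"
    then have kc: "k \<in> X.centred_space t" by (simp add: X.centred_space_def)
    have "(\<integral>z. k z * exp (S (t - 1) z + \<psi> z) \<partial>P) = (\<integral>z. k z * exp (S N z - c z) \<partial>P)"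
      unfolding \<psi>_def by (rule tested_half[OF t1 assms(2) k(1), symmetric])
    also have "\<dots> = (\<integral>z. k z \<partial>P)" unfolding S_def by (rule first_order[OF t1 kc])
    also have "\<dots> = 0" by (rule X.centred_space_expectation[OF t kc])
    finally show "(\<integral>z. k z * exp (S (t - 1) z + \<psi> z) \<partial>P) = 0" .
  qed
  \<comment> \<open>S (t - 1) is free of x_t and cancels from both sides; what remains exhibits
    \<psi> as a function free of x_t.\<close>
  then have \<psi>_eq: "AE z in P. \<psi> z = - soft_int I t \<psi> z"
    using AE_space by eventually_elim (simp add: X.I_exp_add[OF t1 S1 \<psi>] del: One_nat_def)
  have soft: "(\<lambda>z. - soft_int I t \<psi> z) \<in> ad (t - 1) (t - 1)"
    by (intro adapted_uminus X.soft_int_adapted t1 \<psi>)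
  have eq: "I t \<psi> z = - cv (t - 1) z" if "z \<in> space P" for z
    using X.I_diff[OF t1 f_adapted[OF t1] av_adapted[OF t1] that]
      X.centred_spaceD(2)[OF f[OF t1] t_ne that] by (simp add: \<psi>_def cv_pred[OF t1] del: One_nat_def)
  \<comment> \<open>A function free of x_t is its own integral, so \<psi> = I t \<psi> almost
    everywhere, and the centring of f t identifies the latter as -cv (t - 1).\<close>
  from X.I_AE_cong[OF t1 \<psi> X.adapted_pred[OF soft] \<psi>_eq] \<psi>_eq AE_space
  show ?thesis
    by eventually_elim (simp add: X.I_pull[OF t1 soft] eq del: One_nat_def, simp add: \<psi>_def)
qed

text \<open>The second half of the step: the formula just found replaces f t - av t by -cv (t - 1)
  under the integral.\<close>

lemma tested_pred:
  assumes t: "t \<in> {2..N}" and "tested t"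
  shows "tested (t - 1)"
  unfolding tested_def
proof
  have t1: "t \<in> {1..N}" using t by auto
  fix k assume k: "k \<in> ad (t - 1) (t - 1)"
  have [measurable]: "k \<in> borel_measurable P" "S (t - 1) \<in> borel_measurable P" "f t \<in> borel_measurable P"
      "av t \<in> borel_measurable P" "cv (t - 1) \<in> borel_measurable P"
    using adapted_measurable[OF k] adapted_measurable[OF S_adapted[of "t - 1"]] adapted_measurable[OF f_adapted[OF t1]]
      adapted_measurable[OF av_adapted[OF t1]] adapted_measurable[OF cv_adapted[of "t - 1"]] t
    by auto
  have "(\<integral>z. k z * exp (S N z - c z) \<partial>P) = (\<integral>z. k z * exp (S (t - 1) z + (f t z - av t z)) \<partial>P)"
    by (rule tested_half[OF t1 assms(2) X.adapted_pred[OF k]])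
  also have "\<dots> = (\<integral>z. k z * exp (S (t - 1) z - cv (t - 1) z) \<partial>P)"
  proof (rule integral_cong_AE)
    show "AE z in P. k z * exp (S (t - 1) z + (f t z - av t z)) = k z * exp (S (t - 1) z - cv (t - 1) z)"
      using f_eq_of_tested[OF assms] by eventually_elim simp
  qed measurable
  finally show "(\<integral>z. k z * exp (S N z - c z) \<partial>P) = (\<integral>z. k z * exp (S (t - 1) z - cv (t - 1) z) \<partial>P)" .
qed

lemma tested: "t \<in> {1..N} \<Longrightarrow> tested t"
proof -
  assume "t \<in> {1..N}"
  then have "t \<le> N" "1 \<le> t" by auto
  then show ?thesis
  proof (induction rule: inc_induct)
    case base
    then show ?case by (simp add: tested_def cv_N)
  next
    case (step n)
    then show ?case using tested_pred[of "Suc n"] by simp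
  qed
qed

theorem f_eq: "t \<in> {2..N} \<Longrightarrow> AE z in P. f t z = av t z - cv (t - 1) z"
  by (rule f_eq_of_tested[OF _ tested]) auto

text \<open>At time 1 the sum S 0 is empty and every bounded function of x_1 is a test function,
  constants included. The half-step density is therefore 1, and not merely free of x_1.\<close>

theorem f_1_eq: "AE z in P. f 1 z = av 1 z"
proof -
  have 1: "1 \<in> {1..N}" using N by simp
  have fa: "(\<lambda>z. f 1 z - av 1 z) \<in> ad 1 (1 - 1)"
    by (intro adapted_diff f_adapted[OF 1] av_adapted[OF 1])
  have "AE z in P. exp (f 1 z - av 1 z) = 1"
  proof (rule X.AE_eq_1[OF adapted_exp[OF fa]])
    fix k assume k: "k \<in> ad 1 (1 - 1)"
    then have kc: "k \<in> X.centred_space 1" by (simp add: X.centred_space_def)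
    have "(\<integral>z. k z * exp (f 1 z - av 1 z) \<partial>P) = (\<integral>z. k z * exp (S N z - c z) \<partial>P)"
      using tested_half[OF 1 tested[OF 1] k] by (simp add: S_def)
    also have "\<dots> = (\<integral>z. k z \<partial>P)" unfolding S_def by (rule first_order[OF 1 kc])
    finally show "(\<integral>z. k z * exp (f 1 z - av 1 z) \<partial>P) = (\<integral>z. k z \<partial>P)" .
  qed
  then show ?thesis by eventually_elim simp
qed

text \<open>The function g t cancels when g t - cv t is compared with g t - r, so the error stays
  \<gamma> without any bound on g t. As g t - r is free of x_t, so is its soft integral, which
  \<open>I t\<close> then leaves unchanged.\<close>

lemma value_step:
  assumes t: "t \<in> {1..N}" and r: "r \<in> ad (t - 1) t" and close: "AE z in P. \<bar>cv t z - r z\<bar> \<le> \<gamma>"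
  shows "AE z in P. \<bar>cv (t - 1) z - soft_int J t (\<lambda>w. g t w - r w) z\<bar> \<le> \<gamma>"
    and "AE z in P. \<bar>av t z - cv (t - 1) z\<bar> \<le> 2 * \<gamma>"
proof -
  let ?r' = "soft_int J t (\<lambda>w. g t w - r w)"
  have gr: "(\<lambda>w. g t w - r w) \<in> ad (t - 1) t" by (intro adapted_diff g t r)
  have gr': "(\<lambda>w. g t w - r w) \<in> ad t t" by (rule X.adapted_pred[OF gr])
  have gc: "(\<lambda>w. g t w - cv t w) \<in> ad t t" using t by (intro adapted_diff g_adapted cv_adapted) auto
  have r': "?r' \<in> ad (t - 1) (t - 1)" by (rule Y_facts(1)[OF t gr])
  have "AE z in P. \<bar>(g t z - cv t z) - (g t z - r z)\<bar> \<le> \<gamma>"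
    using close by eventually_elim linarith
  from Y_facts(4)[OF t gc gr' this]
  have av: "AE z in P. \<bar>av t z - ?r' z\<bar> \<le> \<gamma>" by (simp add: av_def)
  have "AE z in P. \<bar>I t (av t) z - I t ?r' z\<bar> \<le> \<gamma>"
    by (rule X.I_AE_close[OF t av_adapted[OF t] X.adapted_pred[OF r'] av])
  with AE_space show cv: "AE z in P. \<bar>cv (t - 1) z - ?r' z\<bar> \<le> \<gamma>"
    by eventually_elim (simp add: cv_pred[OF t] X.I_pull[OF t r'] del: One_nat_def)
  from av cv show "AE z in P. \<bar>av t z - cv (t - 1) z\<bar> \<le> 2 * \<gamma>" by eventually_elim linarith
qed

text \<open>At t = 1 the recursion still defines cv 0 = I 1 (av 1), a function of empty segments and
  hence constant. Its value is the mean of f 1, since f 1 = av 1 almost everywhere; subtracting this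
  mean replaces the centring of later times.\<close>

lemma f_bound:
  assumes t: "t \<in> {1..N}" and r: "r \<in> ad (t - 1) t" and close: "AE z in P. \<bar>cv t z - r z\<bar> \<le> \<gamma>"
  shows "AE z in P. \<bar>f t z - (if t = 1 then (\<integral>w. f 1 w \<partial>P) else 0)\<bar> \<le> 2 * \<gamma>"
proof (cases "t = 1")
  case True
  have cv0: "cv 0 \<in> ad 0 0" by (rule cv_adapted) simp
  have "cv 0 z = (\<integral>w. f 1 w \<partial>P)" if "z \<in> space P" for z
  proof -
    have "(\<integral>w. f 1 w \<partial>P) = (\<integral>w. av 1 w \<partial>P)"
      using f_1_eq f_adapted[of 1] av_adapted[of 1] t True
      by (intro integral_cong_AE) (auto dest: adapted_measurable)
    also have "\<dots> = (\<integral>w. cv 0 w \<partial>P)"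
      using X.expectation_I[OF t av_adapted[OF t]] cv_pred[OF t] True by simp
    also have "\<dots> = (\<integral>w. cv 0 z \<partial>P)"
      by (rule Bochner_Integration.integral_cong[OF refl])
        (rule adapted_eq[OF cv0 _ that X.p_0 Y.p_0])
    finally show ?thesis using X.prob_space by simp
  qed
  then have eq: "cv (t - 1) z = (\<integral>w. f 1 w \<partial>P)" if "z \<in> space P" for z
    using that True by simp
  from value_step(2)[OF assms] f_1_eq AE_space show ?thesis
    by eventually_elim (use eq True in force)
next
  case False
  then have "t \<in> {2..N}" using t by auto
  from value_step(2)[OF assms] f_eq[OF this] show ?thesis
    by eventually_elim (use False in simp)
qed

lemma f_bound_causal:
  assumes c_le: "\<And>z. z \<in> space P \<Longrightarrow> \<bar>c z\<bar> \<le> M" and g0: "\<And>t. t \<in> {1..N} \<Longrightarrow> g t \<in> ad 0 t"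
    and t: "t \<in> {1..N}"
  shows "AE z in P. \<bar>f t z - (if t = 1 then (\<integral>w. f 1 w \<partial>P) else 0)\<bar> \<le> 2 * M"
proof -
  \<comment> \<open>The comparison function starts as 0 at time N. Since every g t depends on y
    alone, it stays a function of y, and the error M does not grow.\<close>
  have "s \<le> N \<Longrightarrow> \<exists>r\<in>ad 0 s. AE z in P. \<bar>cv s z - r z\<bar> \<le> M" for s
  proof (induction rule: inc_induct)
    case base
    show ?case by (rule bexI[of _ "\<lambda>_. 0"]) (use c_le in \<open>auto simp: cv_N\<close>)
  next
    case (step n)
    then obtain r where r: "r \<in> ad 0 (Suc n)" "AE z in P. \<bar>cv (Suc n) z - r z\<bar> \<le> M" by blast
    have n: "Suc n \<in> {1..N}" using step by simp
    have r': "r \<in> ad (Suc n - 1) (Suc n)" by (rule X.adapted_mono[OF _ _ r(1)]) auto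
    have "soft_int J (Suc n) (\<lambda>w. g (Suc n) w - r w) \<in> ad 0 n"
      using Y_facts(1)[OF n, of _ 0] adapted_diff[OF g0[OF n] r(1)] by simp
    with value_step(1)[OF n r' r(2)] show ?case by (intro bexI) simp_all
  qed
  from this[of t] t obtain r where "r \<in> ad 0 t" "AE z in P. \<bar>cv t z - r z\<bar> \<le> M" by auto
  then show ?thesis by (intro f_bound[OF t, of r] X.adapted_mono[of 0 "t - 1" t t]) auto
qed

text \<open>This is \<open>value_step\<close> with r = 0: the comparison function is then the soft
  integral of g t, which nonexpansiveness keeps within \<delta> of the soft integral of 0, that is
  of 0.\<close>

lemma cv_pred_bound:
  assumes t: "t \<in> {1..N}" and "AE z in P. \<bar>cv t z\<bar> \<le> \<gamma>" and "AE z in P. \<bar>g t z\<bar> \<le> \<delta>"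
  shows "AE z in P. \<bar>cv (t - 1) z\<bar> \<le> \<gamma> + \<delta>"
proof -
  have 0: "AE z in P. \<bar>cv t z - 0\<bar> \<le> \<gamma>" "AE z in P. \<bar>(g t z - 0) - 0\<bar> \<le> \<delta>" using assms by simp_all
  have gt: "(\<lambda>z. g t z - 0) \<in> ad (t - 1) t" using g[OF t] by simp
  have soft_0: "soft_int J t (\<lambda>w. 0) z = 0" if "z \<in> space P" for z
    using Y.I_one[OF t that] by (simp add: soft_int_def)
  from value_step(1)[OF t adapted_const 0(1)] Y_facts(4)[OF t gt adapted_const 0(2)] AE_space
  show ?thesis by eventually_elim (use soft_0 in force)
qed

end

text \<open>Each value function is bounded through the potential of the opposite direction, so both
  recursions run in one induction.\<close>

lemma bicausal_bound:
  fixes \<gamma> :: "nat \<Rightarrow> real"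
  assumes "causal_system P p q N I J c f g" "causal_system P q p N J I c g f"
    and c_le: "\<And>z. z \<in> space P \<Longrightarrow> \<bar>c z\<bar> \<le> M" and t: "t \<in> {1..N}"
  shows "AE z in P. \<bar>f t z - (if t = 1 then (\<integral>w. f 1 w \<partial>P) else 0)\<bar> \<le> 2 * 3 ^ N * M"
    and "AE z in P. \<bar>g t z - (if t = 1 then (\<integral>w. g 1 w \<partial>P) else 0)\<bar> \<le> 2 * 3 ^ N * M"
proof -
  interpret F: causal_system P p q N I J c f g by fact
  interpret G: causal_system P q p N J I c g f by fact
  \<comment> \<open>Stopping at s = 1 keeps \<open>Suc n\<close> at least 2, where f and g are
    centred and no mean has to be subtracted.\<close>
  have "s \<le> N \<Longrightarrow> 1 \<le> s \<Longrightarrow>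
      (AE z in P. \<bar>F.cv s z\<bar> \<le> 3 ^ (N - s) * M) \<and> (AE z in P. \<bar>G.cv s z\<bar> \<le> 3 ^ (N - s) * M)" for s
  proof (induction rule: inc_induct)
    case base
    then show ?case using c_le by (simp add: F.cv_N G.cv_N)
  next
    case (step n)
    then have n: "Suc n \<in> {1..N}" and "Suc n \<noteq> 1" by auto
    have F: "AE z in P. \<bar>F.cv (Suc n) z - 0\<bar> \<le> 3 ^ (N - Suc n) * M"
      and G: "AE z in P. \<bar>G.cv (Suc n) z - 0\<bar> \<le> 3 ^ (N - Suc n) * M" using step by simp_all
    have fb: "AE z in P. \<bar>f (Suc n) z\<bar> \<le> 2 * (3 ^ (N - Suc n) * M)"
      using F.f_bound[OF n adapted_const F] \<open>Suc n \<noteq> 1\<close> by simp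
    have gb: "AE z in P. \<bar>g (Suc n) z\<bar> \<le> 2 * (3 ^ (N - Suc n) * M)"
      using G.f_bound[OF n adapted_const G] \<open>Suc n \<noteq> 1\<close> by simp
    have "N - n = Suc (N - Suc n)" using step by simp
    \<comment> \<open>The summands are the bound on the value function and twice that bound, the
      estimate for the opposite potential.\<close>
    then have *: "3 ^ (N - n) * M = 3 ^ (N - Suc n) * M + 2 * (3 ^ (N - Suc n) * M)" by simp
    show ?case
      unfolding * using F.cv_pred_bound[OF n _ gb, of "3 ^ (N - Suc n) * M"]
        G.cv_pred_bound[OF n _ fb, of "3 ^ (N - Suc n) * M"] F G by simp
  qed
  from this[of t] t
  have F: "AE z in P. \<bar>F.cv t z - 0\<bar> \<le> 3 ^ (N - t) * M"
    and G: "AE z in P. \<bar>G.cv t z - 0\<bar> \<le> 3 ^ (N - t) * M" by auto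
  obtain z where "z \<in> space P" using F.X.not_empty by blast
  then have "0 \<le> M" using c_le[of z] by linarith
  then have le: "2 * (3 ^ (N - t) * M) \<le> 2 * 3 ^ N * M"
    by (simp add: mult_right_mono power_increasing)
  from F.f_bound[OF t adapted_const F]
  show "AE z in P. \<bar>f t z - (if t = 1 then (\<integral>w. f 1 w \<partial>P) else 0)\<bar> \<le> 2 * 3 ^ N * M"
    by eventually_elim (use le in linarith)
  from G.f_bound[OF t adapted_const G]
  show "AE z in P. \<bar>g t z - (if t = 1 then (\<integral>w. g 1 w \<partial>P) else 0)\<bar> \<le> 2 * 3 ^ N * M"
    by eventually_elim (use le in linarith)
qed

section \<open>Disintegration along the conditional laws\<close>

text \<open>Pushing the kernel forward to the product space turns an integrand depending on the
  parameter z into a fixed one, for which measurability in the measure is known.\<close>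

lemma integral_measurable_kernel:
  fixes F :: "'b \<times> 'c \<Rightarrow> real"
  assumes k: "k \<in> M \<rightarrow>\<^sub>M prob_algebra B" and F: "F \<in> borel_measurable (M \<Otimes>\<^sub>M B)"
  shows "(\<lambda>z. \<integral>w. F (z, w) \<partial>k z) \<in> borel_measurable M"
proof -
  have k': "k \<in> M \<rightarrow>\<^sub>M subprob_algebra B" by (rule measurable_prob_algebraD[OF k])
  have "(\<lambda>z. distr (k z) (M \<Otimes>\<^sub>M B) (\<lambda>w. (z, w))) \<in> M \<rightarrow>\<^sub>M subprob_algebra (M \<Otimes>\<^sub>M B)"
    by (rule measurable_distr2[where f = "\<lambda>z w. (z, w)", OF _ k']) simp
  from measurable_compose[OF this integral_measurable_subprob_algebra[OF F]]
  have "(\<lambda>z. integral\<^sup>L (distr (k z) (M \<Otimes>\<^sub>M B) (\<lambda>w. (z, w))) F) \<in> borel_measurable M" .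
  moreover have "integral\<^sup>L (distr (k z) (M \<Otimes>\<^sub>M B) (\<lambda>w. (z, w))) F = (\<integral>w. F (z, w) \<partial>k z)"
    if "z \<in> space M" for z
    by (rule integral_distr[OF _ F])
      (simp add: measurable_cong_sets[OF sets_kernel[OF k' that] refl] measurable_Pair1'[OF that])
  ultimately show ?thesis by (simp cong: measurable_cong)
qed

text \<open>The kernel \<open>\<kappa> t\<close> resamples one coordinate, which \<open>upd t\<close> puts in place.\<close>

lemma cond_ops_kernel:
  fixes P :: "'z measure" and B :: "nat \<Rightarrow> 'w measure"
  assumes "prob_space P"
    and p_mono: "\<And>s s' z z'. s \<le> s' \<Longrightarrow> p s' z = p s' z' \<Longrightarrow> p s z = p s z'"
    and q_mono: "\<And>s s' z z'. s \<le> s' \<Longrightarrow> q s' z = q s' z' \<Longrightarrow> q s z = q s z'"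
    and p_0: "\<And>z z'. p 0 z = p 0 z'"
    and I: "\<And>t \<phi> z. I t \<phi> z = (\<integral>w. \<phi> (upd t w z) \<partial>\<kappa> t z)"
    and \<kappa>: "\<And>t. t \<in> {1..N} \<Longrightarrow> \<kappa> t \<in> P \<rightarrow>\<^sub>M prob_algebra (B t)"
    and upd: "\<And>t. t \<in> {1..N} \<Longrightarrow> (\<lambda>(z, w). upd t w z) \<in> P \<Otimes>\<^sub>M B t \<rightarrow>\<^sub>M P"
    and \<kappa>_local: "\<And>t z z'. p (t - 1) z = p (t - 1) z' \<Longrightarrow> \<kappa> t z = \<kappa> t z'"
    and p_upd: "\<And>t w z z'. t \<in> {1..N} \<Longrightarrow> p (t - 1) z = p (t - 1) z' \<Longrightarrow> p t (upd t w z) = p t (upd t w z')"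
    and p_upd_pred: "\<And>t w z. t \<in> {1..N} \<Longrightarrow> p (t - 1) (upd t w z) = p (t - 1) z"
    and q_upd: "\<And>s t w z. q s (upd t w z) = q s z"
    and expectation: "\<And>t s \<phi>. t \<in> {1..N} \<Longrightarrow> \<phi> \<in> adapted P p q t s \<Longrightarrow>
      I t \<phi> \<in> adapted P p q (t - 1) s \<Longrightarrow> (\<integral>z. I t \<phi> z \<partial>P) = (\<integral>z. \<phi> z \<partial>P)"
  shows "cond_ops P p q N I"
proof -
  interpret prob_space P by fact
  have prob: "prob_space (\<kappa> t z)" and sets_\<kappa>: "sets (\<kappa> t z) = sets (B t)"
    if "t \<in> {1..N}" "z \<in> space P" for t z
    using measurable_space[OF \<kappa>[OF that(1)] that(2)] by (auto simp: space_prob_algebra)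
  have space_\<kappa>: "space (\<kappa> t z) = space (B t)" if "t \<in> {1..N}" "z \<in> space P" for t z
    using sets_\<kappa>[OF that] by (rule sets_eq_imp_space_eq)
  have upd_space: "upd t w z \<in> space P" if "t \<in> {1..N}" "z \<in> space P" "w \<in> space (\<kappa> t z)" for t w z
    using measurable_space[OF upd[OF that(1)], of "(z, w)"] that space_\<kappa>[OF that(1,2)]
    by (simp add: space_pair_measure)
  have upd_z: "(\<lambda>w. upd t w z) \<in> \<kappa> t z \<rightarrow>\<^sub>M P" if "t \<in> {1..N}" "z \<in> space P" for t z
    unfolding measurable_cong_sets[OF sets_\<kappa>[OF that] refl]
    using measurable_compose[OF measurable_Pair1'[OF that(2)] upd[OF that(1)]] by simp
  have integrable: "integrable (\<kappa> t z) (\<lambda>w. \<phi> (upd t w z))"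
    if "t \<in> {1..N}" "z \<in> space P" "\<phi> \<in> adapted P p q t s" for t s z \<phi>
  proof -
    interpret k: prob_space "\<kappa> t z" by (rule prob[OF that(1,2)])
    from adapted_bounded[OF that(3)] obtain C where "\<And>z. z \<in> space P \<Longrightarrow> \<bar>\<phi> z\<bar> \<le> C" by blast
    then have "AE w in \<kappa> t z. norm (\<phi> (upd t w z)) \<le> C"
      using upd_space[OF that(1,2)] by (intro AE_I2) simp
    moreover have "(\<lambda>w. \<phi> (upd t w z)) \<in> borel_measurable (\<kappa> t z)"
      by (rule measurable_compose[OF upd_z[OF that(1,2)] adapted_measurable[OF that(3)]])
    ultimately show ?thesis by (rule k.integrable_const_bound)
  qed
  \<comment> \<open>Proved ahead of the locale axioms, because the hypothesis
    \<open>expectation\<close> has it as a premise.\<close>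
  have I_adapted: "I t \<phi> \<in> adapted P p q (t - 1) s" if t: "t \<in> {1..N}" and \<phi>: "\<phi> \<in> adapted P p q t s" for t \<phi> s
  proof -
    obtain C where C: "\<And>z. z \<in> space P \<Longrightarrow> \<bar>\<phi> z\<bar> \<le> C" using adapted_bounded[OF \<phi>] by blast
    show ?thesis
    proof (rule adaptedI)
      have "(\<lambda>x. \<phi> (case x of (z, w) \<Rightarrow> upd t w z)) \<in> borel_measurable (P \<Otimes>\<^sub>M B t)"
        by (rule measurable_compose[OF upd[OF t] adapted_measurable[OF \<phi>]])
      from integral_measurable_kernel[OF \<kappa>[OF t] this]
      show "I t \<phi> \<in> borel_measurable P" by (simp add: I[abs_def])
      show "\<bar>I t \<phi> z\<bar> \<le> C" if z: "z \<in> space P" for z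
      proof -
        interpret k: prob_space "\<kappa> t z" by (rule prob[OF t z])
        have "\<phi> (upd t w z) \<le> C" "- C \<le> \<phi> (upd t w z)" if "w \<in> space (\<kappa> t z)" for w
          using C[OF upd_space[OF t z that]] by auto
        then have "I t \<phi> z \<le> C" "- C \<le> I t \<phi> z" unfolding I
          by (auto intro!: k.integral_le_const k.integral_ge_const integrable[OF t z \<phi>])
        then show ?thesis by simp
      qed
      show "I t \<phi> z = I t \<phi> z'"
        if "z \<in> space P" "z' \<in> space P" "p (t - 1) z = p (t - 1) z'" "q s z = q s z'" for z z'
      proof -
        note eq = \<kappa>_local[OF that(3)]
        have "\<phi> (upd t w z) = \<phi> (upd t w z')" if "w \<in> space (\<kappa> t z')" for w
          using that upd_space[OF t \<open>z \<in> space P\<close>] upd_space[OF t \<open>z' \<in> space P\<close>] eq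
            \<open>p (t - 1) z = _\<close> \<open>q s z = _\<close>
          by (intro adapted_eq[OF \<phi>] p_upd[OF t]) (simp_all add: q_upd)
        then show ?thesis unfolding I eq by (intro Bochner_Integration.integral_cong) auto
      qed
    qed
  qed
  show ?thesis
  proof unfold_locales
    show "s \<le> s' \<Longrightarrow> p s' z = p s' z' \<Longrightarrow> p s z = p s z'" for s s' z z' by (rule p_mono)
    show "s \<le> s' \<Longrightarrow> q s' z = q s' z' \<Longrightarrow> q s z = q s z'" for s s' z z' by (rule q_mono)
    show "p 0 z = p 0 z'" for z z' by (rule p_0)
    show "expectation (I t \<phi>) = expectation \<phi>" if "t \<in> {1..N}" "\<phi> \<in> adapted P p q t s" for t \<phi> s
      by (rule expectation[OF that I_adapted[OF that]])
    show "I t \<phi> \<in> adapted P p q (t - 1) s" if "t \<in> {1..N}" "\<phi> \<in> adapted P p q t s" for t \<phi> s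
      by (rule I_adapted[OF that])
    show "I t \<phi> z = I t \<psi> z"
      if "t \<in> {1..N}" "\<And>w. w \<in> space P \<Longrightarrow> \<phi> w = \<psi> w" "z \<in> space P" for t \<phi> \<psi> z
      unfolding I using upd_space[OF that(1,3)] that(2) by (intro Bochner_Integration.integral_cong) auto
    show "I t (\<lambda>_. 1) z = 1" if "t \<in> {1..N}" "z \<in> space P" for t z
      using prob_space.prob_space[OF prob[OF that]] by (simp add: I)
    show "I t (\<lambda>w. \<phi> w + \<psi> w) z = I t \<phi> z + I t \<psi> z"
      if "t \<in> {1..N}" "\<phi> \<in> adapted P p q t s" "\<psi> \<in> adapted P p q t s" "z \<in> space P" for t \<phi> \<psi> s z
      unfolding I by (intro Bochner_Integration.integral_add integrable[of _ _ _ s] that)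
    show "0 \<le> I t \<phi> z"
      if "t \<in> {1..N}" "\<phi> \<in> adapted P p q t s" "\<And>w. w \<in> space P \<Longrightarrow> 0 \<le> \<phi> w" "z \<in> space P" for t \<phi> s z
      unfolding I using upd_space[OF that(1,4)] that(3) by (intro Bochner_Integration.integral_nonneg) auto
    show "I t (\<lambda>w. \<psi> w * \<phi> w) z = \<psi> z * I t \<phi> z"
      if t: "t \<in> {1..N}" and \<psi>: "\<psi> \<in> adapted P p q (t - 1) s" and "\<phi> \<in> adapted P p q t s"
        and z: "z \<in> space P" for t \<psi> s \<phi> z
    proof -
      have "\<psi> (upd t w z) = \<psi> z" if "w \<in> space (\<kappa> t z)" for w
        using upd_space[OF t z that] z by (rule adapted_eq[OF \<psi>]) (rule p_upd_pred[OF t], rule q_upd)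
      then have "I t (\<lambda>w. \<psi> w * \<phi> w) z = (\<integral>w. \<psi> z * \<phi> (upd t w z) \<partial>\<kappa> t z)"
        unfolding I by (intro Bochner_Integration.integral_cong) auto
      then show ?thesis by (simp add: I)
    qed
  qed
qed

section \<open>Initial segments of one path space and the disintegration of its law\<close>

lemma space_borel_of [simp]: "space (borel_of T) = topspace T"
  unfolding borel_of_def by (rule space_measure_of) (auto dest: openin_subset)

lemma space_paths: "space (paths X t) = (\<Pi>\<^sub>E s\<in>{1..t}. topspace (X s))"
  by (simp add: paths_def space_PiM)

lemma pre_eq_mono: "s \<le> s' \<Longrightarrow> pre s' x = pre s' x' \<Longrightarrow> pre s x = pre s x'"
  by (auto simp: pre_def fun_eq_iff restrict_def) (metis order_trans)

lemma pre_0 [simp]: "pre 0 x = (\<lambda>_. undefined)"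
  by (simp add: pre_def fun_eq_iff)

lemma pre_upd_pred: "t \<in> {1..N} \<Longrightarrow> pre (t - 1) (x(t := z)) = pre (t - 1) x"
  by (auto simp: pre_def fun_eq_iff restrict_def)

lemma pre_upd_cong:
  assumes "pre (t - 1) x = pre (t - 1) x'"
  shows "pre t (x(t := z)) = pre t (x'(t := z))"
proof
  fix s
  have "x s = x' s" if "s \<in> {1..t - 1}"
    using fun_cong[OF assms, of s] that by (simp add: pre_def)
  then show "pre t (x(t := z)) s = pre t (x'(t := z)) s"
    by (auto simp: pre_def restrict_def)
qed

lemma pre_self: "x \<in> space (paths X N) \<Longrightarrow> pre N x = x"
  by (auto simp: pre_def space_paths)

lemma measurable_pre: "s \<le> t \<Longrightarrow> pre s \<in> paths X t \<rightarrow>\<^sub>M paths X s"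
  unfolding pre_def paths_def by (rule measurable_restrict_subset) auto

lemma measurable_upd:
  "t \<in> {1..N} \<Longrightarrow> (\<lambda>(x, z). x(t := z)) \<in> paths X N \<Otimes>\<^sub>M borel_of (X t) \<rightarrow>\<^sub>M paths X N"
  using measurable_add_dim[of t "{1..N}" "\<lambda>s. borel_of (X s)"] by (simp add: paths_def insert_absorb)

locale path_law =
  fixes N :: nat and X :: "nat \<Rightarrow> 'a topology" and \<mu> :: "(nat \<Rightarrow> 'a) measure"
    and K :: "nat \<Rightarrow> (nat \<Rightarrow> 'a) \<Rightarrow> 'a measure"
  assumes law: "law_on_paths N X \<mu> K"
begin

sublocale prob_space \<mu>
  using law by (simp add: law_on_paths_def)

lemma sets_law [measurable_cong]: "sets \<mu> = sets (paths X N)"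
  using law by (simp add: law_on_paths_def)

lemma space_law: "space \<mu> = space (paths X N)"
  by (rule sets_eq_imp_space_eq[OF sets_law])

lemma kernel: "t \<in> {1..N} \<Longrightarrow> K t \<in> paths X (t - 1) \<rightarrow>\<^sub>M prob_algebra (borel_of (X t))"
  using law by (simp add: law_on_paths_def cond_law_def)

lemma measurable_pre_law: "t \<le> N \<Longrightarrow> pre t \<in> \<mu> \<rightarrow>\<^sub>M paths X t"
  using measurable_pre[of t N X] measurable_cong_sets[OF sets_law refl] by blast

lemma kernel_pre: "t \<in> {1..N} \<Longrightarrow> (\<lambda>x. K t (pre (t - 1) x)) \<in> \<mu> \<rightarrow>\<^sub>M prob_algebra (borel_of (X t))"
  by (rule measurable_compose[OF measurable_pre_law kernel]) auto

text \<open>Completing a segment by the coordinates of a fixed path gives a measurable right inverse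
  of \<open>pre s\<close> on segments. Composing with it produces a measurable factor of any
  function that depends only on the segment.\<close>

lemma extension:
  assumes "s \<le> N"
  shows "\<exists>e. e \<in> paths X s \<rightarrow>\<^sub>M \<mu> \<and> (\<forall>x. pre s (e (pre s x)) = pre s x)"
proof -
  obtain x0 where x0: "x0 \<in> space \<mu>" using not_empty by blast
  define e where "e = (\<lambda>w. \<lambda>i\<in>{1..N}. if i \<le> s then w i else x0 i)"
  have "(\<lambda>w. if i \<le> s then w i else x0 i) \<in> paths X s \<rightarrow>\<^sub>M borel_of (X i)" if i: "i \<in> {1..N}" for i
  proof (cases "i \<le> s")
    case True
    then have "(\<lambda>w. w i) \<in> paths X s \<rightarrow>\<^sub>M borel_of (X i)"
      unfolding paths_def using i by (intro measurable_component_singleton) auto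
    then show ?thesis using True by simp
  next
    case False
    moreover have "x0 i \<in> topspace (X i)" using x0 i by (auto simp: space_law space_paths)
    ultimately show ?thesis by simp
  qed
  then have "e \<in> paths X s \<rightarrow>\<^sub>M paths X N"
    unfolding e_def paths_def[of X N] by (rule measurable_restrict)
  then have "e \<in> paths X s \<rightarrow>\<^sub>M \<mu>" using measurable_cong_sets[OF refl sets_law] by blast
  moreover have "pre s (e (pre s x)) = pre s x" for x
    using assms by (auto simp: e_def pre_def fun_eq_iff restrict_def)
  ultimately show ?thesis by blast
qed

text \<open>The conditional law prescribes only the masses of rectangles. These form an
  intersection-stable generator, so the joint law of the segment and the next coordinate is the law
  of the segment followed by the kernel.\<close>

lemma integral_kernel_pair:
  fixes u :: "(nat \<Rightarrow> 'a) \<times> 'a \<Rightarrow> real"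
  assumes t: "t \<in> {1..N}" and u: "u \<in> borel_measurable (paths X (t - 1) \<Otimes>\<^sub>M borel_of (X t))"
    and bound: "\<And>w. w \<in> space (paths X (t - 1) \<Otimes>\<^sub>M borel_of (X t)) \<Longrightarrow> \<bar>u w\<bar> \<le> C"
  shows "(\<integral>x. u (pre (t - 1) x, x t) \<partial>\<mu>) = (\<integral>x. (\<integral>z. u (pre (t - 1) x, z) \<partial>K t (pre (t - 1) x)) \<partial>\<mu>)"
proof -
  let ?B = "borel_of (X t)" and ?W = "paths X (t - 1)"
  let ?S = "?W \<Otimes>\<^sub>M ?B"
  let ?D = "\<lambda>x. distr (K t (pre (t - 1) x)) ?S (\<lambda>z. (pre (t - 1) x, z))"
  have t': "t - 1 \<le> N" using t by auto
  have prob: "prob_space (K t (pre (t - 1) x))" and sets_K: "sets (K t (pre (t - 1) x)) = sets ?B"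
    if "x \<in> space \<mu>" for x
    using measurable_space[OF kernel_pre[OF t] that] by (auto simp: space_prob_algebra)
  have pre_space: "pre (t - 1) x \<in> space ?W" if "x \<in> space \<mu>" for x
    by (rule measurable_space[OF measurable_pre_law[OF t'] that])
  have pair: "(\<lambda>z. (pre (t - 1) x, z)) \<in> K t (pre (t - 1) x) \<rightarrow>\<^sub>M ?S" if "x \<in> space \<mu>" for x
    using measurable_Pair1'[OF pre_space[OF that], of ?B] measurable_cong_sets[OF sets_K[OF that] refl] by blast
  note [measurable] = measurable_pre_law[OF t']
  have D: "?D \<in> \<mu> \<rightarrow>\<^sub>M subprob_algebra ?S"
    by (rule measurable_distr2[where f = "\<lambda>x z. (pre (t - 1) x, z)", OF _ measurable_prob_algebraD[OF kernel_pre[OF t]]])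
      measurable
  have coord: "(\<lambda>x. x t) \<in> \<mu> \<rightarrow>\<^sub>M ?B"
    using measurable_component_singleton[of t "{1..N}" "\<lambda>s. borel_of (X s)"] t
      measurable_cong_sets[OF sets_law refl] unfolding paths_def by blast
  have joint: "(\<lambda>x. (pre (t - 1) x, x t)) \<in> \<mu> \<rightarrow>\<^sub>M ?S"
    using coord by measurable
  \<comment> \<open>The measure \<open>?D x\<close> is the kernel placed on the fibre over the
    segment of x, so the right-hand side is the composed law.\<close>
  have eq: "distr \<mu> ?S (\<lambda>x. (pre (t - 1) x, x t)) = \<mu> \<bind> ?D"
  proof (rule measure_eqI_generator_eq[OF Int_stable_pair_measure_generator[of ?W ?B]])
    show "{A \<times> B |A B. A \<in> sets ?W \<and> B \<in> sets ?B} \<subseteq> Pow (space ?S)"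
      using sets.sets_into_space[of _ ?W] sets.sets_into_space[of _ ?B] by (auto simp: space_pair_measure)
    show "sets (distr \<mu> ?S (\<lambda>x. (pre (t - 1) x, x t))) = sigma_sets (space ?S) {A \<times> B |A B. A \<in> sets ?W \<and> B \<in> sets ?B}"
      by (simp add: sets_pair_measure space_pair_measure)
    show "sets (\<mu> \<bind> ?D) = sigma_sets (space ?S) {A \<times> B |A B. A \<in> sets ?W \<and> B \<in> sets ?B}"
      using not_empty by (simp add: sets_bind[of _ _ ?S] sets_pair_measure space_pair_measure)
    show "range (\<lambda>_::nat. space ?S) \<subseteq> {A \<times> B |A B. A \<in> sets ?W \<and> B \<in> sets ?B}"
      using sets.top[of ?W] sets.top[of ?B] by (force simp: space_pair_measure)
    show "(\<Union>i::nat. space ?S) = space ?S" by simp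
    show "emeasure (distr \<mu> ?S (\<lambda>x. (pre (t - 1) x, x t))) (space ?S) \<noteq> \<infinity>"
      using prob_space.emeasure_space_1[OF prob_space_distr[OF joint]] by simp
  next
    fix R assume "R \<in> {A \<times> B |A B. A \<in> sets ?W \<and> B \<in> sets ?B}"
    then obtain A B where R: "R = A \<times> B" and A: "A \<in> sets ?W" and B: "B \<in> sets ?B" by auto
    then have RS: "R \<in> sets ?S" by auto
    have "emeasure (distr \<mu> ?S (\<lambda>x. (pre (t - 1) x, x t))) R
        = emeasure \<mu> {x \<in> space \<mu>. pre (t - 1) x \<in> A \<and> x t \<in> B}"
      by (subst emeasure_distr[OF joint RS]) (auto simp: R intro!: arg_cong[where f = "emeasure \<mu>"])
    also have "\<dots> = (\<integral>\<^sup>+x. indicator A (pre (t - 1) x) * emeasure (K t (pre (t - 1) x)) B \<partial>\<mu>)"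
      using law t A B unfolding law_on_paths_def cond_law_def by blast
    also have "\<dots> = (\<integral>\<^sup>+x. emeasure (?D x) R \<partial>\<mu>)"
    proof (rule nn_integral_cong)
      fix x assume x: "x \<in> space \<mu>"
      have "emeasure (?D x) R = emeasure (K t (pre (t - 1) x))
          ((\<lambda>z. (pre (t - 1) x, z)) -` R \<inter> space (K t (pre (t - 1) x)))"
        by (rule emeasure_distr[OF pair[OF x] RS])
      also have "(\<lambda>z. (pre (t - 1) x, z)) -` R \<inter> space (K t (pre (t - 1) x)) = (if pre (t - 1) x \<in> A then B else {})"
        using sets.sets_into_space[OF B] sets_eq_imp_space_eq[OF sets_K[OF x]] by (auto simp: R)
      finally show "indicator A (pre (t - 1) x) * emeasure (K t (pre (t - 1) x)) B = emeasure (?D x) R"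
        by simp
    qed
    also have "\<dots> = emeasure (\<mu> \<bind> ?D) R"
      by (rule emeasure_bind[OF not_empty D RS, symmetric])
    finally show "emeasure (distr \<mu> ?S (\<lambda>x. (pre (t - 1) x, x t))) R = emeasure (\<mu> \<bind> ?D) R" .
  qed
  have "(\<integral>x. u (pre (t - 1) x, x t) \<partial>\<mu>) = integral\<^sup>L (\<mu> \<bind> ?D) u"
    unfolding eq[symmetric] by (rule integral_distr[OF joint u, symmetric])
  also have "\<dots> = (\<integral>x. integral\<^sup>L (?D x) u \<partial>\<mu>)"
  proof (rule integral_bind[OF u bound D, where B' = 1])
    show "AE x in \<mu>. emeasure (?D x) (space (?D x)) \<le> ennreal 1"
    proof (rule AE_I2)
      fix x assume x: "x \<in> space \<mu>"
      from prob_space.emeasure_space_1[OF prob_space.prob_space_distr[OF prob[OF x] pair[OF x]]]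
      show "emeasure (?D x) (space (?D x)) \<le> ennreal 1" by simp
    qed
  qed unfold_locales
  also have "\<dots> = (\<integral>x. (\<integral>z. u (pre (t - 1) x, z) \<partial>K t (pre (t - 1) x)) \<partial>\<mu>)"
    by (rule Bochner_Integration.integral_cong[OF refl]) (rule integral_distr[OF pair u])
  finally show ?thesis .
qed

text \<open>Since u sees only \<open>pre t\<close>, it may be evaluated at any path with the right
  segment and t-th coordinate. The map \<open>ext\<close> builds such a path measurably from these
  two data, which reduces the claim to \<open>integral_kernel_pair\<close>.\<close>

lemma integral_kernel:
  fixes u :: "(nat \<Rightarrow> 'a) \<Rightarrow> real"
  assumes t: "t \<in> {1..N}" and u: "u \<in> borel_measurable \<mu>"
    and bound: "\<And>x. x \<in> space \<mu> \<Longrightarrow> \<bar>u x\<bar> \<le> C"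
    and depends: "\<And>x x'. x \<in> space \<mu> \<Longrightarrow> x' \<in> space \<mu> \<Longrightarrow> pre t x = pre t x' \<Longrightarrow> u x = u x'"
  shows "(\<integral>x. u x \<partial>\<mu>) = (\<integral>x. (\<integral>z. u (x(t := z)) \<partial>K t (pre (t - 1) x)) \<partial>\<mu>)"
proof -
  let ?B = "borel_of (X t)" and ?W = "paths X (t - 1)"
  have "t - 1 \<le> N" using t by auto
  from extension[OF this] obtain e where e: "e \<in> ?W \<rightarrow>\<^sub>M \<mu>"
    and pre_e: "\<And>x. pre (t - 1) (e (pre (t - 1) x)) = pre (t - 1) x" by blast
  define ext where "ext = (\<lambda>(w, z). (e w)(t := z))"
  have ext: "ext \<in> ?W \<Otimes>\<^sub>M ?B \<rightarrow>\<^sub>M \<mu>"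
  proof -
    have "e \<in> ?W \<rightarrow>\<^sub>M paths X N" using e measurable_cong_sets[OF refl sets_law] by blast
    then have "(\<lambda>v. (e (fst v), snd v)) \<in> ?W \<Otimes>\<^sub>M ?B \<rightarrow>\<^sub>M paths X N \<Otimes>\<^sub>M ?B"
      by (intro measurable_Pair measurable_compose[OF measurable_fst] measurable_snd)
    from measurable_compose[OF this measurable_upd[OF t]]
    have "ext \<in> ?W \<Otimes>\<^sub>M ?B \<rightarrow>\<^sub>M paths X N" by (simp add: ext_def case_prod_beta')
    then show ?thesis using measurable_cong_sets[OF refl sets_law] by blast
  qed
  have ext_space: "ext v \<in> space \<mu>" if "v \<in> space (?W \<Otimes>\<^sub>M ?B)" for v
    by (rule measurable_space[OF ext that])
  have pre_ext: "pre t (ext (pre (t - 1) x, z)) = pre t (x(t := z))" for x z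
    unfolding ext_def prod.case by (rule pre_upd_cong[OF pre_e])
  have pre_space: "pre (t - 1) x \<in> space ?W" if "x \<in> space \<mu>" for x
    using that t by (intro measurable_space[OF measurable_pre_law]) auto
  have upd_space: "x(t := z) \<in> space \<mu>" if "x \<in> space \<mu>" "z \<in> space ?B" for x z
    using measurable_space[OF measurable_upd[OF t, of X], of "(x, z)"] that
    by (simp add: space_pair_measure space_law)
  have u_ext: "u (ext (pre (t - 1) x, z)) = u (x(t := z))" if "x \<in> space \<mu>" "z \<in> space ?B" for x z
    using that pre_space by (intro depends ext_space upd_space pre_ext) (simp add: space_pair_measure)
  have "(\<integral>x. u x \<partial>\<mu>) = (\<integral>x. u (ext (pre (t - 1) x, x t)) \<partial>\<mu>)"
  proof (rule Bochner_Integration.integral_cong[OF refl])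
    fix x assume x: "x \<in> space \<mu>"
    then have "x t \<in> space ?B" using t by (auto simp: space_law space_paths)
    from u_ext[OF x this] show "u x = u (ext (pre (t - 1) x, x t))" by simp
  qed
  also have "\<dots> = (\<integral>x. (\<integral>z. u (ext (pre (t - 1) x, z)) \<partial>K t (pre (t - 1) x)) \<partial>\<mu>)"
    using integral_kernel_pair[OF t measurable_compose[OF ext u] bound[OF ext_space]] by simp
  also have "\<dots> = (\<integral>x. (\<integral>z. u (x(t := z)) \<partial>K t (pre (t - 1) x)) \<partial>\<mu>)"
  proof (intro Bochner_Integration.integral_cong[OF refl])
    fix x z assume x: "x \<in> space \<mu>" and z: "z \<in> space (K t (pre (t - 1) x))"
    have "sets (K t (pre (t - 1) x)) = sets ?B"
      using measurable_space[OF kernel_pre[OF t] x] by (auto simp: space_prob_algebra)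
    then have "z \<in> space ?B" using z sets_eq_imp_space_eq by blast
    then show "u (ext (pre (t - 1) x, z)) = u (x(t := z))" by (rule u_ext[OF x])
  qed
  finally show ?thesis .
qed

text \<open>By Fubini, y can be held fixed while the disintegration in x is applied. The second
  factor is left general so that the operator in y can use the lemma as well, after exchanging the
  factors.\<close>

lemma integral_int_x:
  fixes \<phi> :: "('a, 'b) pathfun"
  assumes M: "prob_space M" and t: "t \<in> {1..N}" and \<phi>: "\<phi> \<in> borel_measurable (\<mu> \<Otimes>\<^sub>M M)"
    and bound: "\<And>z. z \<in> space (\<mu> \<Otimes>\<^sub>M M) \<Longrightarrow> \<bar>\<phi> z\<bar> \<le> C"
    and depends: "\<And>x x' y. x \<in> space \<mu> \<Longrightarrow> x' \<in> space \<mu> \<Longrightarrow> y \<in> space M \<Longrightarrow> pre t x = pre t x' \<Longrightarrow>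
      \<phi> (x, y) = \<phi> (x', y)"
    and I: "int_x K t \<phi> \<in> borel_measurable (\<mu> \<Otimes>\<^sub>M M)"
      "\<And>z. z \<in> space (\<mu> \<Otimes>\<^sub>M M) \<Longrightarrow> \<bar>int_x K t \<phi> z\<bar> \<le> C"
  shows "(\<integral>z. int_x K t \<phi> z \<partial>(\<mu> \<Otimes>\<^sub>M M)) = (\<integral>z. \<phi> z \<partial>(\<mu> \<Otimes>\<^sub>M M))"
proof -
  interpret M: prob_space M by fact
  interpret pair_prob_space \<mu> M ..
  have *: "(\<integral>y. (\<integral>x. \<psi> (x, y) \<partial>\<mu>) \<partial>M) = (\<integral>z. \<psi> z \<partial>(\<mu> \<Otimes>\<^sub>M M))"
    if "\<psi> \<in> borel_measurable (\<mu> \<Otimes>\<^sub>M M)" "\<And>z. z \<in> space (\<mu> \<Otimes>\<^sub>M M) \<Longrightarrow> \<bar>\<psi> z\<bar> \<le> C"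
    for \<psi> :: "('a, 'b) pathfun"
  proof -
    have "integrable (\<mu> \<Otimes>\<^sub>M M) \<psi>" using that by (intro P.integrable_const_bound[where B = C] AE_I2) auto
    then show ?thesis using integral_snd[of "\<lambda>x y. \<psi> (x, y)"] by simp
  qed
  have "(\<integral>z. int_x K t \<phi> z \<partial>(\<mu> \<Otimes>\<^sub>M M)) = (\<integral>y. (\<integral>x. int_x K t \<phi> (x, y) \<partial>\<mu>) \<partial>M)"
    by (rule *[OF I, symmetric])
  also have "\<dots> = (\<integral>y. (\<integral>x. \<phi> (x, y) \<partial>\<mu>) \<partial>M)"
  proof (rule Bochner_Integration.integral_cong[OF refl])
    fix y assume y: "y \<in> space M"
    have meas: "(\<lambda>x. \<phi> (x, y)) \<in> borel_measurable \<mu>"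
      by (rule measurable_compose[OF measurable_Pair2'[OF y] \<phi>])
    have "\<bar>\<phi> (x, y)\<bar> \<le> C" if "x \<in> space \<mu>" for x
      by (rule bound) (simp add: space_pair_measure that y)
    from integral_kernel[OF t meas this depends[OF _ _ y]]
    show "(\<integral>x. int_x K t \<phi> (x, y) \<partial>\<mu>) = (\<integral>x. \<phi> (x, y) \<partial>\<mu>)"
      unfolding int_x_def prod.case by (rule sym)
  qed
  also have "\<dots> = (\<integral>z. \<phi> z \<partial>(\<mu> \<Otimes>\<^sub>M M))" by (rule *[OF \<phi> bound])
  finally show ?thesis .
qed

end

definition pre_fst :: "nat \<Rightarrow> (nat \<Rightarrow> 'a) \<times> 'v \<Rightarrow> nat \<Rightarrow> 'a" where
  "pre_fst s z = pre s (fst z)"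

definition pre_snd :: "nat \<Rightarrow> 'u \<times> (nat \<Rightarrow> 'b) \<Rightarrow> nat \<Rightarrow> 'b" where
  "pre_snd t z = pre t (snd z)"

section \<open>Measurability of continuous functions\<close>

lemma second_countable_polish:
  assumes "polish T"
  shows "second_countable T"
proof -
  from assms have "metrizable_space T" "separable_space T"
    by (auto simp: polish_def completely_metrizable_imp_metrizable_space)
  then obtain M d S where "Metric_space M d" and T: "T = Metric_space.mtopology M d"
    and S: "countable S" "S \<subseteq> topspace T" "T closure_of S = topspace T"
    unfolding metrizable_space_def separable_space_def by auto
  interpret Metric_space M d by fact
  define \<B> where "\<B> = (\<lambda>(s, n). mball s (inverse (real (Suc n)))) ` (S \<times> (UNIV :: nat set))"
  show ?thesis
    unfolding second_countable_def
  proof (intro exI conjI ballI allI impI)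
    show "countable \<B>" unfolding \<B>_def using S(1) by (intro countable_image countable_SIGMA) auto
    show "openin T V" if "V \<in> \<B>" for V using that by (auto simp: \<B>_def T)
    fix U x assume "openin T U \<and> x \<in> U"
    then have U: "openin mtopology U" "x \<in> U" by (auto simp: T)
    then obtain r where r: "r > 0" "mball x r \<subseteq> U" and x: "x \<in> M"
      unfolding openin_mtopology by blast
    \<comment> \<open>With a radius below r / 2, the ball about a point of S close to x contains x
      and stays within the r-ball about x.\<close>
    obtain n where n: "inverse (real (Suc n)) < r / 2" using reals_Archimedean[of "r / 2"] r by auto
    have "x \<in> mtopology closure_of S" using S(3) x by (simp add: T)
    then obtain y where y: "y \<in> S" "y \<in> mball x (inverse (real (Suc n)))"
      unfolding metric_closure_of using of_nat_0_less_iff[of "Suc n"] by (auto dest: spec[of _ "inverse (real (Suc n))"])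
    have "mball y (inverse (real (Suc n))) \<subseteq> mball x r"
    proof
      fix w assume w: "w \<in> mball y (inverse (real (Suc n)))"
      then have "d x w \<le> d x y + d y w" using x y by (intro triangle) auto
      also have "\<dots> < r" using w y n by auto
      finally show "w \<in> mball x r" using w x by auto
    qed
    moreover have "x \<in> mball y (inverse (real (Suc n)))" using y by (auto simp: commute)
    moreover have "mball y (inverse (real (Suc n))) \<in> \<B>" using y(1) by (force simp: \<B>_def)
    ultimately show "\<exists>V\<in>\<B>. x \<in> V \<and> V \<subseteq> U" using r(2) by blast
  qed
qed

text \<open>The sets are boxes with sides from countable bases of the factors. Countability is the
  point: it makes every open set of paths a countable union of measurable boxes, hence measurable
  for the product sigma-algebra.\<close>

lemma openin_paths_base:
  assumes polish: "\<And>t. t \<in> {1..N} \<Longrightarrow> polish (X t)"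
  shows "\<exists>\<B>. countable \<B> \<and> \<B> \<subseteq> sets (paths X N) \<and>
    (\<forall>U x. openin (product_topology X {1..N}) U \<longrightarrow> x \<in> U \<longrightarrow> (\<exists>V\<in>\<B>. x \<in> V \<and> V \<subseteq> U))"
proof -
  define I where "I = {1..N}"
  have "finite I" and polish_I: "\<And>i. i \<in> I \<Longrightarrow> polish (X i)" using polish by (simp_all add: I_def)
  have "\<exists>\<B>. \<forall>i\<in>I. countable (\<B> i) \<and> (\<forall>V\<in>\<B> i. openin (X i) V) \<and>
      (\<forall>U x. openin (X i) U \<and> x \<in> U \<longrightarrow> (\<exists>V\<in>\<B> i. x \<in> V \<and> V \<subseteq> U))"
    by (intro bchoice ballI) (rule second_countable_polish[OF polish_I, unfolded second_countable_def])
  then obtain \<B> where \<B>: "\<forall>i\<in>I. countable (\<B> i) \<and> (\<forall>V\<in>\<B> i. openin (X i) V) \<and>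
      (\<forall>U x. openin (X i) U \<and> x \<in> U \<longrightarrow> (\<exists>V\<in>\<B> i. x \<in> V \<and> V \<subseteq> U))" ..
  have cB: "countable (\<B> i)" if "i \<in> I" for i
    using \<B> that by simp
  have oB: "openin (X i) V" if "i \<in> I" "V \<in> \<B> i" for i V
    using \<B> that by simp
  have bB: "\<exists>V\<in>\<B> i. x \<in> V \<and> V \<subseteq> U" if "i \<in> I" "openin (X i) U" "x \<in> U" for i U x
    using \<B> that by simp
  define \<R> where "\<R> = Pi\<^sub>E I ` Pi\<^sub>E I \<B>"
  show ?thesis
    unfolding paths_def I_def[symmetric]
  proof (intro exI[of _ \<R>] conjI allI impI subsetI)
    show "countable \<R>" unfolding \<R>_def by (intro countable_image countable_PiE \<open>finite I\<close> cB)
    fix R assume "R \<in> \<R>"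
    then obtain V where V: "R = Pi\<^sub>E I V" "V \<in> Pi\<^sub>E I \<B>" by (auto simp: \<R>_def)
    have "V i \<in> sets (borel_of (X i))" if "i \<in> I" for i
    proof -
      have "openin (X i) (V i)" using V(2) oB that by auto
      moreover have "sets (borel_of (X i)) = sigma_sets (topspace (X i)) {U. openin (X i) U}"
        unfolding borel_of_def by (rule sets_measure_of) (auto dest: openin_subset)
      ultimately show ?thesis by (simp add: sigma_sets.Basic)
    qed
    then show "R \<in> sets (PiM I (\<lambda>i. borel_of (X i)))" unfolding V(1) by (intro sets_PiM_I_finite \<open>finite I\<close>)
  next
    fix U x assume U: "openin (product_topology X I) U" and x: "x \<in> U"
    then obtain W where W: "\<And>i. i \<in> I \<Longrightarrow> openin (X i) (W i)" "x \<in> Pi\<^sub>E I W" "Pi\<^sub>E I W \<subseteq> U"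
      unfolding openin_product_topology_alt by metis
    have "\<exists>V. \<forall>i\<in>I. V i \<in> \<B> i \<and> x i \<in> V i \<and> V i \<subseteq> W i"
    proof (intro bchoice ballI)
      fix i assume i: "i \<in> I"
      then have "x i \<in> W i" using W(2) by (rule PiE_mem[rotated])
      from bB[OF i W(1)[OF i] this] show "\<exists>V. V \<in> \<B> i \<and> x i \<in> V \<and> V \<subseteq> W i" by blast
    qed
    then obtain V where V: "\<And>i. i \<in> I \<Longrightarrow> V i \<in> \<B> i \<and> x i \<in> V i \<and> V i \<subseteq> W i" by metis
    \<comment> \<open>The members of \<R> are indexed by extensional families, so V has to be
      restricted to I.\<close>
    have "Pi\<^sub>E I V = Pi\<^sub>E I (restrict V I)" by (rule PiE_cong) simp
    then have "Pi\<^sub>E I V \<in> \<R>" using V unfolding \<R>_def by (intro image_eqI) (auto simp: PiE_iff)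
    moreover have "x \<in> Pi\<^sub>E I V" using V W(2) by (auto simp: PiE_iff)
    moreover have "Pi\<^sub>E I V \<subseteq> U" using V W(3) PiE_mono[of I V W] by blast
    ultimately show "\<exists>V\<in>\<R>. x \<in> V \<and> V \<subseteq> U" by blast
  qed
qed

lemma continuous_map_measurable_paths:
  assumes X: "\<And>t. t \<in> {1..N} \<Longrightarrow> polish (X t)" and Y: "\<And>t. t \<in> {1..N} \<Longrightarrow> polish (Y t)"
    and c: "continuous_map (prod_topology (product_topology X {1..N}) (product_topology Y {1..N})) euclideanreal c"
  shows "c \<in> borel_measurable (paths X N \<Otimes>\<^sub>M paths Y N)"
proof (rule borel_measurableI)
  let ?T = "prod_topology (product_topology X {1..N}) (product_topology Y {1..N})"
  let ?M = "paths X N \<Otimes>\<^sub>M paths Y N"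
  have space: "space ?M = topspace ?T" by (simp add: space_pair_measure space_paths)
  fix S :: "real set" assume "open S"
  define U where "U = c -` S \<inter> space ?M"
  have U: "openin ?T U"
    using openin_continuous_map_preimage[OF c, of S] \<open>open S\<close>
    by (simp add: U_def space vimage_def Int_def conj_commute)
  from openin_paths_base[of N X, OF X]
  obtain \<B> where "countable \<B> \<and> \<B> \<subseteq> sets (paths X N) \<and> (\<forall>U x. openin (product_topology X {1..N}) U \<longrightarrow>
    x \<in> U \<longrightarrow> (\<exists>V\<in>\<B>. x \<in> V \<and> V \<subseteq> U))" ..
  then have \<B>: "countable \<B>" "\<B> \<subseteq> sets (paths X N)"
    "\<And>U x. openin (product_topology X {1..N}) U \<Longrightarrow> x \<in> U \<Longrightarrow> \<exists>V\<in>\<B>. x \<in> V \<and> V \<subseteq> U" by simp_all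
  from openin_paths_base[of N Y, OF Y]
  obtain \<C> where "countable \<C> \<and> \<C> \<subseteq> sets (paths Y N) \<and> (\<forall>U x. openin (product_topology Y {1..N}) U \<longrightarrow>
    x \<in> U \<longrightarrow> (\<exists>V\<in>\<C>. x \<in> V \<and> V \<subseteq> U))" ..
  then have \<C>: "countable \<C>" "\<C> \<subseteq> sets (paths Y N)"
    "\<And>U x. openin (product_topology Y {1..N}) U \<Longrightarrow> x \<in> U \<Longrightarrow> \<exists>V\<in>\<C>. x \<in> V \<and> V \<subseteq> U" by simp_all
  \<comment> \<open>Only countably many products of basic boxes fit into U, and they cover
    it.\<close>
  define \<R> where "\<R> = {V \<times> W |V W. V \<in> \<B> \<and> W \<in> \<C> \<and> V \<times> W \<subseteq> U}"
  have "\<R> \<subseteq> (\<lambda>(V, W). V \<times> W) ` (\<B> \<times> \<C>)" by (auto simp: \<R>_def)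
  then have "countable \<R>" using \<B>(1) \<C>(1) by (meson countable_SIGMA countable_image countable_subset)
  moreover have "\<R> \<subseteq> sets ?M" using \<B>(2) \<C>(2) by (auto simp: \<R>_def)
  ultimately have "\<Union>\<R> \<in> sets ?M" by (intro sets.countable_Union) auto
  moreover have "\<Union>\<R> = U"
  proof (intro equalityI subsetI)
    fix z assume z: "z \<in> U"
    obtain x y where xy: "z = (x, y)" by fastforce
    obtain V W where V: "openin (product_topology X {1..N}) V" "x \<in> V"
      and W: "openin (product_topology Y {1..N}) W" "y \<in> W" and VW: "V \<times> W \<subseteq> U"
      using U z unfolding openin_prod_topology_alt xy by metis
    obtain V' where V': "V' \<in> \<B>" "x \<in> V'" "V' \<subseteq> V" using \<B>(3)[OF V] by blast
    obtain W' where W': "W' \<in> \<C>" "y \<in> W'" "W' \<subseteq> W" using \<C>(3)[OF W] by blast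
    have "V' \<times> W' \<subseteq> U" using Sigma_mono[OF V'(3) W'(3)] VW by (rule order_trans)
    then have "V' \<times> W' \<in> \<R>" using V'(1) W'(1) unfolding \<R>_def by blast
    moreover have "z \<in> V' \<times> W'" using V'(2) W'(2) by (simp add: xy)
    ultimately show "z \<in> \<Union>\<R>" by (rule UnionI)
  qed (auto simp: \<R>_def)
  ultimately show "c -` S \<inter> space ?M \<in> sets ?M" by (simp add: U_def)
qed

section \<open>The product law as an instance of the abstract operators\<close>

lemma int_y_eq: "int_y L t \<phi> (x, y) = int_x L t (\<lambda>(y, x). \<phi> (x, y)) (y, x)"
  by (simp add: int_x_def int_y_def)

locale path_laws = X: path_law N X \<mu> K + Y: path_law N Y \<nu> L
  for N X \<mu> K and Y :: "nat \<Rightarrow> 'b topology" and \<nu> L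
begin

abbreviation "P \<equiv> \<mu> \<Otimes>\<^sub>M \<nu>"

sublocale pair_prob_space \<mu> \<nu> ..

lemma in_P: "z \<in> space P \<longleftrightarrow> fst z \<in> space \<mu> \<and> snd z \<in> space \<nu>"
  by (cases z) (simp add: space_pair_measure)

lemma cond_ops_x: "cond_ops P pre_fst pre_snd N (int_x K)"
proof (rule cond_ops_kernel[where upd = "\<lambda>t w z. ((fst z)(t := w), snd z)"
      and \<kappa> = "\<lambda>t z. K t (pre (t - 1) (fst z))" and B = "\<lambda>t. borel_of (X t)"])
  show "prob_space P" by unfold_locales
  fix t assume t: "t \<in> {1..N}"
  show "(\<lambda>z. K t (pre (t - 1) (fst z))) \<in> P \<rightarrow>\<^sub>M prob_algebra (borel_of (X t))"
    by (rule measurable_compose[OF measurable_fst X.kernel_pre[OF t]])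
  have "(\<lambda>(x, z). x(t := z)) \<in> \<mu> \<Otimes>\<^sub>M borel_of (X t) \<rightarrow>\<^sub>M \<mu>"
    using measurable_upd[OF t, of X]
      measurable_cong_sets[OF sets_pair_measure_cong[OF X.sets_law refl] X.sets_law] by blast
  then have "(\<lambda>v. (\<lambda>(x, z). x(t := z)) (fst (fst v), snd v)) \<in> P \<Otimes>\<^sub>M borel_of (X t) \<rightarrow>\<^sub>M \<mu>"
    by (rule measurable_compose[rotated])
      (intro measurable_Pair measurable_compose[OF measurable_fst] measurable_fst measurable_snd)
  then show "(\<lambda>(z, w). ((fst z)(t := w), snd z)) \<in> P \<Otimes>\<^sub>M borel_of (X t) \<rightarrow>\<^sub>M P"
    unfolding case_prod_beta' by (intro measurable_Pair measurable_compose[OF measurable_fst measurable_snd]) simp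
  fix s and \<phi> :: "('a, 'b) pathfun"
  assume \<phi>: "\<phi> \<in> adapted P pre_fst pre_snd t s"
    and I: "int_x K t \<phi> \<in> adapted P pre_fst pre_snd (t - 1) s"
  obtain C where C: "\<forall>z\<in>space P. \<bar>\<phi> z\<bar> \<le> C" using adapted_bounded[OF \<phi>] by blast
  obtain D where D: "\<forall>z\<in>space P. \<bar>int_x K t \<phi> z\<bar> \<le> D" using adapted_bounded[OF I] by blast
  show "(\<integral>z. int_x K t \<phi> z \<partial>P) = (\<integral>z. \<phi> z \<partial>P)"
  proof (rule X.integral_int_x[OF _ t adapted_measurable[OF \<phi>] _ _ adapted_measurable[OF I], where C = "max C D"])
    show "prob_space \<nu>" by unfold_locales
    show "\<bar>\<phi> z\<bar> \<le> max C D" "\<bar>int_x K t \<phi> z\<bar> \<le> max C D" if "z \<in> space P" for z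
      using C D that by (auto simp: le_max_iff_disj)
    show "\<phi> (x, y) = \<phi> (x', y)"
      if "x \<in> space \<mu>" "x' \<in> space \<mu>" "y \<in> space \<nu>" "pre t x = pre t x'" for x x' y
      using that by (intro adapted_eq[OF \<phi>]) (auto simp: in_P pre_fst_def pre_snd_def)
  qed
next
  show "int_x K t \<phi> z = (\<integral>w. \<phi> ((fst z)(t := w), snd z) \<partial>K t (pre (t - 1) (fst z)))" for t z
    and \<phi> :: "('a, 'b) pathfun"
    by (simp add: int_x_def case_prod_beta)
qed (auto simp: pre_fst_def pre_snd_def simp del: One_nat_def intro: pre_eq_mono pre_upd_cong pre_upd_pred)

text \<open>The argument mirrors the one for x; the expectation identity is carried over by
  exchanging the factors, which turns \<open>int_y\<close> into \<open>int_x\<close> on the swapped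
  product.\<close>

lemma cond_ops_y: "cond_ops P pre_snd pre_fst N (int_y L)"
proof (rule cond_ops_kernel[where upd = "\<lambda>t w z. (fst z, (snd z)(t := w))"
      and \<kappa> = "\<lambda>t z. L t (pre (t - 1) (snd z))" and B = "\<lambda>t. borel_of (Y t)"])
  show "prob_space P" by unfold_locales
  fix t assume t: "t \<in> {1..N}"
  show "(\<lambda>z. L t (pre (t - 1) (snd z))) \<in> P \<rightarrow>\<^sub>M prob_algebra (borel_of (Y t))"
    by (rule measurable_compose[OF measurable_snd Y.kernel_pre[OF t]])
  have "(\<lambda>(y, z). y(t := z)) \<in> \<nu> \<Otimes>\<^sub>M borel_of (Y t) \<rightarrow>\<^sub>M \<nu>"
    using measurable_upd[OF t, of Y]
      measurable_cong_sets[OF sets_pair_measure_cong[OF Y.sets_law refl] Y.sets_law] by blast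
  then have "(\<lambda>v. (\<lambda>(y, z). y(t := z)) (snd (fst v), snd v)) \<in> P \<Otimes>\<^sub>M borel_of (Y t) \<rightarrow>\<^sub>M \<nu>"
    by (rule measurable_compose[rotated])
      (intro measurable_Pair measurable_compose[OF measurable_fst] measurable_snd)
  then show "(\<lambda>(z, w). (fst z, (snd z)(t := w))) \<in> P \<Otimes>\<^sub>M borel_of (Y t) \<rightarrow>\<^sub>M P"
    unfolding case_prod_beta' by (intro measurable_Pair measurable_compose[OF measurable_fst measurable_fst]) simp
  fix s and \<phi> :: "('a, 'b) pathfun"
  assume \<phi>: "\<phi> \<in> adapted P pre_snd pre_fst t s"
    and J: "int_y L t \<phi> \<in> adapted P pre_snd pre_fst (t - 1) s"
  obtain C where C: "\<forall>z\<in>space P. \<bar>\<phi> z\<bar> \<le> C" using adapted_bounded[OF \<phi>] by blast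
  obtain D where D: "\<forall>z\<in>space P. \<bar>int_y L t \<phi> z\<bar> \<le> D" using adapted_bounded[OF J] by blast
  let ?\<phi> = "\<lambda>(y, x). \<phi> (x, y)"
  have swap: "(\<lambda>(y, x). int_y L t \<phi> (x, y)) = int_x L t ?\<phi>"
    by (simp add: fun_eq_iff int_y_eq)
  have swap_meas: "(\<lambda>(y, x). \<psi> (x, y)) \<in> borel_measurable (\<nu> \<Otimes>\<^sub>M \<mu>)" if "\<psi> \<in> borel_measurable P"
    for \<psi> :: "('a, 'b) pathfun"
    using that by (simp add: measurable_pair_swap_iff[of \<psi>] case_prod_beta')
  have "(\<integral>z. int_y L t \<phi> z \<partial>P) = (\<integral>z. int_x L t ?\<phi> z \<partial>(\<nu> \<Otimes>\<^sub>M \<mu>))"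
    unfolding swap[symmetric] by (rule integral_product_swap[OF adapted_measurable[OF J], symmetric])
  also have "\<dots> = (\<integral>z. ?\<phi> z \<partial>(\<nu> \<Otimes>\<^sub>M \<mu>))"
  proof (rule Y.integral_int_x[OF _ t swap_meas[OF adapted_measurable[OF \<phi>]], where C = "max C D"])
    show "prob_space \<mu>" by unfold_locales
    show "int_x L t ?\<phi> \<in> borel_measurable (\<nu> \<Otimes>\<^sub>M \<mu>)"
      unfolding swap[symmetric] by (rule swap_meas[OF adapted_measurable[OF J]])
    show "\<bar>?\<phi> z\<bar> \<le> max C D" "\<bar>int_x L t ?\<phi> z\<bar> \<le> max C D" if "z \<in> space (\<nu> \<Otimes>\<^sub>M \<mu>)" for z
    proof -
      obtain x y where z: "z = (y, x)" by fastforce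
      then have "(x, y) \<in> space P" using that by (simp add: space_pair_measure)
      then show "\<bar>?\<phi> z\<bar> \<le> max C D" "\<bar>int_x L t ?\<phi> z\<bar> \<le> max C D"
        using C D by (auto simp: z le_max_iff_disj int_y_eq[symmetric])
    qed
    show "?\<phi> (y, x) = ?\<phi> (y', x)"
      if "y \<in> space \<nu>" "y' \<in> space \<nu>" "x \<in> space \<mu>" "pre t y = pre t y'" for y y' x
      using that unfolding prod.case by (intro adapted_eq[OF \<phi>]) (auto simp: in_P pre_fst_def pre_snd_def)
  qed
  also have "\<dots> = (\<integral>z. \<phi> z \<partial>P)" by (rule integral_product_swap[OF adapted_measurable[OF \<phi>]])
  finally show "(\<integral>z. int_y L t \<phi> z \<partial>P) = (\<integral>z. \<phi> z \<partial>P)" .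
next
  show "int_y L t \<phi> z = (\<integral>w. \<phi> (fst z, (snd z)(t := w)) \<partial>L t (pre (t - 1) (snd z)))" for t z
    and \<phi> :: "('a, 'b) pathfun"
    by (simp add: int_y_def case_prod_beta)
qed (auto simp: pre_fst_def pre_snd_def simp del: One_nat_def intro: pre_eq_mono pre_upd_cong pre_upd_pred)

sublocale I: cond_ops P pre_fst pre_snd N "int_x K" by (rule cond_ops_x)

sublocale J: cond_ops P pre_snd pre_fst N "int_y L" by (rule cond_ops_y)

abbreviation "ad \<equiv> adapted P pre_fst pre_snd"

lemma bdd_meas_adapted:
  assumes "\<phi> \<in> bdd_meas X Y s t" "s \<le> N" "t \<le> N"
  shows "\<phi> \<in> ad s t"
proof -
  from assms(1) obtain \<psi> where \<phi>: "\<phi> = (\<lambda>(x, y). \<psi> (pre s x, pre t y))"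
    and \<psi>: "\<psi> \<in> borel_measurable (paths X s \<Otimes>\<^sub>M paths Y t)" "bounded (\<psi> ` space (paths X s \<Otimes>\<^sub>M paths Y t))"
    by (auto simp: bdd_meas_def)
  from \<psi>(2) obtain C where C: "\<And>w. w \<in> space (paths X s \<Otimes>\<^sub>M paths Y t) \<Longrightarrow> \<bar>\<psi> w\<bar> \<le> C"
    by (auto simp: bounded_iff)
  have pre: "(\<lambda>z. (pre s (fst z), pre t (snd z))) \<in> P \<rightarrow>\<^sub>M paths X s \<Otimes>\<^sub>M paths Y t"
    by (intro measurable_Pair measurable_compose[OF measurable_fst X.measurable_pre_law[OF assms(2)]]
        measurable_compose[OF measurable_snd Y.measurable_pre_law[OF assms(3)]])
  show ?thesis
  proof (rule adaptedI)
    show "\<phi> \<in> borel_measurable P" using measurable_compose[OF pre \<psi>(1)] by (simp add: \<phi> case_prod_beta')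
    show "\<bar>\<phi> z\<bar> \<le> C" if "z \<in> space P" for z
      using C[OF measurable_space[OF pre that]] by (simp add: \<phi> case_prod_beta)
  qed (simp add: \<phi> pre_fst_def pre_snd_def case_prod_beta)
qed

text \<open>The factor is \<phi> evaluated at the completions of the two segments. Agreement holds
  on \<open>space P\<close> only, since adaptedness says nothing about values elsewhere.\<close>

lemma adapted_bdd_meas:
  assumes "\<phi> \<in> ad s t" "s \<le> N" "t \<le> N"
  shows "\<exists>\<phi>'\<in>bdd_meas X Y s t. \<forall>z\<in>space P. \<phi>' z = \<phi> z"
proof -
  obtain e where e: "e \<in> paths X s \<rightarrow>\<^sub>M \<mu>" "\<And>x. pre s (e (pre s x)) = pre s x"
    using X.extension[OF assms(2)] by blast
  obtain e' where e': "e' \<in> paths Y t \<rightarrow>\<^sub>M \<nu>" "\<And>y. pre t (e' (pre t y)) = pre t y"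
    using Y.extension[OF assms(3)] by blast
  obtain C where C: "\<And>z. z \<in> space P \<Longrightarrow> \<bar>\<phi> z\<bar> \<le> C" using adapted_bounded[OF assms(1)] by blast
  define \<psi> where "\<psi> = (\<lambda>w. \<phi> (e (fst w), e' (snd w)))"
  have ee': "(\<lambda>w. (e (fst w), e' (snd w))) \<in> paths X s \<Otimes>\<^sub>M paths Y t \<rightarrow>\<^sub>M P"
    by (intro measurable_Pair measurable_compose[OF measurable_fst e(1)] measurable_compose[OF measurable_snd e'(1)])
  show ?thesis
  proof (intro bexI ballI)
    have "\<psi> \<in> borel_measurable (paths X s \<Otimes>\<^sub>M paths Y t)"
      unfolding \<psi>_def by (rule measurable_compose[OF ee' adapted_measurable[OF assms(1)]])
    moreover have "bounded (\<psi> ` space (paths X s \<Otimes>\<^sub>M paths Y t))"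
      using C[OF measurable_space[OF ee']] by (intro boundedI[where B = C]) (auto simp: \<psi>_def)
    ultimately show "(\<lambda>(x, y). \<psi> (pre s x, pre t y)) \<in> bdd_meas X Y s t"
      by (auto simp: bdd_meas_def)
    fix z assume z: "z \<in> space P"
    then have "(pre s (fst z), pre t (snd z)) \<in> space (paths X s \<Otimes>\<^sub>M paths Y t)"
      using measurable_space[OF X.measurable_pre_law[OF assms(2)]] measurable_space[OF Y.measurable_pre_law[OF assms(3)]]
      by (auto simp: space_pair_measure)
    from measurable_space[OF ee' this]
    have "\<phi> (e (pre s (fst z)), e' (pre t (snd z))) = \<phi> z"
      using z by (intro adapted_eq[OF assms(1)]) (simp_all add: pre_fst_def pre_snd_def e(2) e'(2))
    then show "(case z of (x, y) \<Rightarrow> \<psi> (pre s x, pre t y)) = \<phi> z"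
      by (simp add: \<psi>_def case_prod_beta)
  qed
qed

lemma A_X_centred:
  assumes t: "t \<in> {1..N}" and "f \<in> A_X X Y K t"
  shows "f \<in> I.centred_space t"
proof (cases "t = 1")
  case True
  then show ?thesis
    using assms bdd_meas_adapted[of f 1 0] by (simp add: A_X_def I.centred_space_def)
next
  case False
  then obtain a where a: "a \<in> bdd_meas X Y t (t - 1)" and f: "f = (\<lambda>z. a z - int_x K t a z)"
    using assms(2) by (auto simp: A_X_def)
  have "a \<in> ad t (t - 1)" using t by (intro bdd_meas_adapted[OF a]) auto
  then show ?thesis
    unfolding I.centred_space_def f using I.centred[OF t] adapted_diff I.adapted_pred[OF I.I_adapted[OF t]]
    by blast
qed

text \<open>A centred function represents itself: \<phi> = \<phi> - I t \<phi> on
  \<open>space P\<close>, once \<phi> is replaced by a globally factorized function equal to it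
  there.\<close>

lemma centred_A_X:
  assumes t: "t \<in> {1..N}" and \<phi>: "\<phi> \<in> I.centred_space t"
  shows "\<exists>f\<in>A_X X Y K t. \<forall>z\<in>space P. f z = \<phi> z"
proof -
  have "t \<le> N" "t - 1 \<le> N" using t by auto
  then obtain a where a: "a \<in> bdd_meas X Y t (t - 1)" "\<And>z. z \<in> space P \<Longrightarrow> a z = \<phi> z"
    using adapted_bdd_meas[OF I.centred_spaceD(1)[OF \<phi>]] by blast
  show ?thesis
  proof (cases "t = 1")
    case True
    then show ?thesis using a by (intro bexI[of _ a]) (auto simp: A_X_def)
  next
    case False
    have "a z - int_x K t a z = \<phi> z" if "z \<in> space P" for z
      using I.I_cong[OF t a(2) that] I.centred_spaceD(2)[OF \<phi> False that] a(2)[OF that] by simp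
    then show ?thesis using a False by (intro bexI[of _ "\<lambda>z. a z - int_x K t a z"]) (auto simp: A_X_def)
  qed
qed

lemma A_Y_centred:
  assumes t: "t \<in> {1..N}" and "g \<in> A_Y X Y L t"
  shows "g \<in> J.centred_space t"
proof (cases "t = 1")
  case True
  then show ?thesis
    using assms bdd_meas_adapted[of g 0 1] by (simp add: A_Y_def J.centred_space_def adapted_swap[of P pre_snd pre_fst])
next
  case False
  then obtain a where a: "a \<in> bdd_meas X Y (t - 1) t" and g: "g = (\<lambda>z. a z - int_y L t a z)"
    using assms(2) by (auto simp: A_Y_def)
  have "a \<in> adapted P pre_snd pre_fst t (t - 1)"
    unfolding adapted_swap[of P pre_snd pre_fst] using t by (intro bdd_meas_adapted[OF a]) auto
  then show ?thesis
    unfolding J.centred_space_def g using J.centred[OF t] adapted_diff J.adapted_pred[OF J.I_adapted[OF t]]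
    by blast
qed

lemma centred_A_Y:
  assumes t: "t \<in> {1..N}" and \<phi>: "\<phi> \<in> J.centred_space t"
  shows "\<exists>g\<in>A_Y X Y L t. \<forall>z\<in>space P. g z = \<phi> z"
proof -
  have "t \<le> N" "t - 1 \<le> N" using t by auto
  then obtain a where a: "a \<in> bdd_meas X Y (t - 1) t" "\<And>z. z \<in> space P \<Longrightarrow> a z = \<phi> z"
    using adapted_bdd_meas J.centred_spaceD(1)[OF \<phi>] unfolding adapted_swap[of P pre_snd pre_fst] by blast
  show ?thesis
  proof (cases "t = 1")
    case True
    then show ?thesis using a by (intro bexI[of _ a]) (auto simp: A_Y_def)
  next
    case False
    have "a z - int_y L t a z = \<phi> z" if "z \<in> space P" for z
      using J.I_cong[OF t a(2) that] J.centred_spaceD(2)[OF \<phi> False that] a(2)[OF that] by simp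
    then show ?thesis using a False by (intro bexI[of _ "\<lambda>z. a z - int_y L t a z"]) (auto simp: A_Y_def)
  qed
qed

end

section \<open>First-order condition and decompositions\<close>

text \<open>An explicit second-order bound takes the place of differentiation under the integral in
  the first-order condition.\<close>

lemma exp_le_quadratic:
  fixes x :: real
  assumes "\<bar>x\<bar> \<le> 1"
  shows "exp x \<le> 1 + x + x\<^sup>2"
proof (cases "0 \<le> x")
  case True
  then show ?thesis using exp_bound[of x] assms by simp
next
  case False
  define y where "y = - x"
  have y: "0 < y" using False by (simp add: y_def)
  \<comment> \<open>For negative x = -y this identity bounds 1 / (1 + y), and thus exp (-y), by 1 -
    y + y^2.\<close>
  have "(1 - y + y\<^sup>2) * (1 + y) = 1 + y ^ 3" by (simp add: algebra_simps power2_eq_square power3_eq_cube)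
  then have "1 \<le> (1 - y + y\<^sup>2) * (1 + y)" using y by simp
  also have "\<dots> \<le> (1 - y + y\<^sup>2) * exp y"
  proof (rule mult_left_mono)
    show "1 + y \<le> exp y" by (rule exp_ge_add_one_self)
    have "0 \<le> (1 - y)\<^sup>2 + y" using y by simp
    then show "0 \<le> 1 - y + y\<^sup>2" by (simp add: power2_eq_square algebra_simps)
  qed
  finally have "1 / exp y \<le> 1 - y + y\<^sup>2" by (simp add: field_simps)
  then show ?thesis by (simp add: y_def exp_minus inverse_eq_divide)
qed

lemma linear_le_quadratic_imp_0:
  fixes A Q \<delta> :: real
  assumes "0 < \<delta>" "0 \<le> Q" and le: "\<And>\<epsilon>. \<bar>\<epsilon>\<bar> \<le> \<delta> \<Longrightarrow> \<epsilon> * A \<le> \<epsilon>\<^sup>2 * Q"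
  shows "A = 0"
proof (rule ccontr)
  assume "A \<noteq> 0"
  \<comment> \<open>The second entry forces the quadratic term below the linear one; Q + 1 instead
    of Q avoids division by zero.\<close>
  define r where "r = min \<delta> (\<bar>A\<bar> / (2 * (Q + 1)))"
  have r: "0 < r" "r \<le> \<delta>" using assms(1,2) \<open>A \<noteq> 0\<close> by (auto simp: r_def)
  have "r * \<bar>A\<bar> = (r * sgn A) * A" by (simp add: sgn_mult_abs abs_sgn mult.assoc mult.commute)
  also have "\<dots> \<le> (r * sgn A)\<^sup>2 * Q" using r by (intro le) (simp add: abs_mult abs_sgn_eq)
  also have "\<dots> = r * (r * Q)" using \<open>A \<noteq> 0\<close> by (simp add: power2_eq_square sgn_if)
  finally have "\<bar>A\<bar> \<le> r * Q" using r(1) by simp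
  also have "\<dots> \<le> \<bar>A\<bar> / (2 * (Q + 1)) * Q" using assms(2) by (intro mult_right_mono) (auto simp: r_def)
  also have "\<dots> < \<bar>A\<bar>"
    using assms(2) \<open>A \<noteq> 0\<close> by (simp add: field_simps add_nonneg_pos)
  finally show False by simp
qed

context path_laws
begin

lemma dual_value_cong:
  "(\<And>z. z \<in> space P \<Longrightarrow> h z = h' z) \<Longrightarrow> dual_value P c h = dual_value P c h'"
  unfolding dual_value_def by (metis (no_types, lifting) Bochner_Integration.integral_cong)

text \<open>Along the line h + \<epsilon> k the gain is at least \<epsilon> A - \<epsilon>^2 Q,
  where A is the directional derivative. Optimality for small \<epsilon> of both signs forces A =
  0.\<close>

lemma first_order_condition:
  assumes h: "h \<in> ad N N" and k: "k \<in> ad N N" and c: "c \<in> ad N N"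
    and opt: "\<And>\<epsilon>. dual_value P c (\<lambda>z. h z + \<epsilon> * k z) \<le> dual_value P c h"
  shows "(\<integral>z. k z * exp (h z - c z) \<partial>P) = (\<integral>z. k z \<partial>P)"
proof -
  define e where "e = (\<lambda>z. exp (h z - c z))"
  have e: "e \<in> ad N N" unfolding e_def by (intro adapted_exp adapted_diff h c)
  define A where "A = (\<integral>z. k z \<partial>P) - (\<integral>z. k z * e z \<partial>P)"
  define Q where "Q = (\<integral>z. (k z)\<^sup>2 * e z \<partial>P)"
  obtain C where C: "C > 0" "\<And>z. z \<in> space P \<Longrightarrow> \<bar>k z\<bar> \<le> C" using adapted_bounded[OF k] by blast
  note int = I.adapted_integrable[of _ N N]
  note ad = adapted_add adapted_diff adapted_mult adapted_const adapted_exp h k c e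
  have k2: "(\<lambda>z. (k z)\<^sup>2) \<in> ad N N" unfolding power2_eq_square by (intro ad)
  have "A = 0"
  proof (rule linear_le_quadratic_imp_0)
    show "0 < 1 / C" using C(1) by simp
    show "0 \<le> Q" unfolding Q_def by (intro Bochner_Integration.integral_nonneg) (simp add: e_def)
    fix \<epsilon> :: real assume \<epsilon>: "\<bar>\<epsilon>\<bar> \<le> 1 / C"
    \<comment> \<open>The range |\<epsilon>| \<le> 1 / C keeps |\<epsilon> k| \<le> 1, as the
      quadratic bound for exp requires.\<close>
    have pointwise: "(h z - e z) + (\<epsilon> * (k z - k z * e z) - \<epsilon>\<^sup>2 * ((k z)\<^sup>2 * e z))
        \<le> (h z + \<epsilon> * k z) - exp ((h z + \<epsilon> * k z) - c z)" if "z \<in> space P" for z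
    proof -
      have "\<bar>\<epsilon>\<bar> * \<bar>k z\<bar> \<le> 1 / C * C" using \<epsilon> C that by (intro mult_mono) auto
      then have "exp (\<epsilon> * k z) \<le> 1 + \<epsilon> * k z + (\<epsilon> * k z)\<^sup>2"
        using C(1) by (intro exp_le_quadratic) (simp add: abs_mult)
      then have "e z * exp (\<epsilon> * k z) \<le> e z * (1 + \<epsilon> * k z + (\<epsilon> * k z)\<^sup>2)"
        by (rule mult_left_mono) (simp add: e_def)
      moreover have "exp ((h z + \<epsilon> * k z) - c z) = e z * exp (\<epsilon> * k z)"
        by (simp add: e_def exp_add[symmetric] algebra_simps)
      ultimately show ?thesis by (simp add: algebra_simps power_mult_distrib)
    qed
    have "dual_value P c h - 1 + (\<epsilon> * A - \<epsilon>\<^sup>2 * Q)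
        = (\<integral>z. h z - e z \<partial>P) + ((\<integral>z. \<epsilon> * (k z - k z * e z) \<partial>P) - (\<integral>z. \<epsilon>\<^sup>2 * ((k z)\<^sup>2 * e z) \<partial>P))"
    proof -
      have "(\<integral>z. k z - k z * e z \<partial>P) = A"
        unfolding A_def by (intro Bochner_Integration.integral_diff int ad)
      then show ?thesis by (simp add: dual_value_def e_def Q_def)
    qed
    also have "\<dots> = (\<integral>z. (h z - e z) + (\<epsilon> * (k z - k z * e z) - \<epsilon>\<^sup>2 * ((k z)\<^sup>2 * e z)) \<partial>P)"
    proof -
      have 1: "integrable P (\<lambda>z. h z - e z)" by (intro int ad)
      have 2: "integrable P (\<lambda>z. \<epsilon> * (k z - k z * e z))" by (intro int ad)
      have 3: "integrable P (\<lambda>z. \<epsilon>\<^sup>2 * ((k z)\<^sup>2 * e z))" by (intro int adapted_mult adapted_const k2 e)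
      show ?thesis
        using Bochner_Integration.integral_add[OF 1 Bochner_Integration.integrable_diff[OF 2 3]]
          Bochner_Integration.integral_diff[OF 2 3] by simp
    qed
    also have "\<dots> \<le> (\<integral>z. (h z + \<epsilon> * k z) - exp ((h z + \<epsilon> * k z) - c z) \<partial>P)"
    proof (rule integral_mono[OF _ _ pointwise])
      show "integrable P (\<lambda>z. (h z - e z) + (\<epsilon> * (k z - k z * e z) - \<epsilon>\<^sup>2 * ((k z)\<^sup>2 * e z)))"
        by (intro int adapted_add adapted_diff adapted_mult adapted_const k2 e h k)
      show "integrable P (\<lambda>z. (h z + \<epsilon> * k z) - exp ((h z + \<epsilon> * k z) - c z))" by (intro int ad)
    qed
    also have "\<dots> \<le> dual_value P c h - 1" using opt[of \<epsilon>] by (simp add: dual_value_def)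
    finally show "\<epsilon> * A \<le> \<epsilon>\<^sup>2 * Q" by simp
  qed
  then show ?thesis by (simp add: A_def e_def)
qed

section \<open>Conditional projections along y\<close>

lemma int_y_adapted: "t \<in> {1..N} \<Longrightarrow> \<phi> \<in> ad s t \<Longrightarrow> int_y L t \<phi> \<in> ad s (t - 1)"
  using J.I_adapted unfolding adapted_swap[of P pre_snd pre_fst] .

lemma cond_proj_N: "cond_proj L N gN N = gN"
  by (subst cond_proj.simps) simp

lemma cond_proj_pred: "t \<in> {1..N} \<Longrightarrow> cond_proj L N gN (t - 1) = int_y L t (cond_proj L N gN t)"
  by (subst cond_proj.simps) auto

lemma cond_proj_induct [consumes 1, case_names base step]:
  assumes "t \<le> N" "Q N gN" "\<And>t. t \<in> {1..N} \<Longrightarrow> Q t (cond_proj L N gN t) \<Longrightarrow>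
    Q (t - 1) (int_y L t (cond_proj L N gN t))"
  shows "Q t (cond_proj L N gN t)"
  using assms(1)
proof (induction rule: inc_induct)
  case base
  then show ?case using assms(2) by (simp add: cond_proj_N)
next
  case (step n)
  then show ?case using assms(3)[of "Suc n"] cond_proj_pred[of "Suc n" gN] by simp
qed

lemma cond_proj_adapted: "gN \<in> ad 0 N \<Longrightarrow> t \<le> N \<Longrightarrow> cond_proj L N gN t \<in> ad 0 t"
  by (rule cond_proj_induct) (simp_all add: int_y_adapted del: One_nat_def)

lemma cond_proj_bound:
  assumes "gN \<in> ad 0 N" "t \<le> N" "\<And>z. z \<in> space P \<Longrightarrow> \<bar>gN z\<bar> \<le> B"
  shows "\<forall>z\<in>space P. \<bar>cond_proj L N gN t z\<bar> \<le> B"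
  using assms(2)
proof (induction rule: cond_proj_induct)
  case base
  then show ?case using assms(3) by blast
next
  case (step t)
  then have "cond_proj L N gN t \<in> adapted P pre_snd pre_fst t 0"
    unfolding adapted_swap[of P pre_snd pre_fst] by (intro cond_proj_adapted assms(1)) auto
  from J.I_bound[OF step(1) this] step(2) show ?case by blast
qed

lemma cond_proj_AE_cong:
  assumes "gN \<in> ad 0 N" "gN' \<in> ad 0 N" "t \<le> N" "AE z in P. gN' z = gN z"
  shows "AE z in P. cond_proj L N gN' t z = cond_proj L N gN t z"
  using assms(3)
proof (induction rule: inc_induct)
  case base
  then show ?case using assms(4) by (simp add: cond_proj_N)
next
  case (step n)
  then have n: "Suc n \<in> {1..N}" by simp
  have "cond_proj L N \<phi> (Suc n) \<in> adapted P pre_snd pre_fst (Suc n) 0" if "\<phi> \<in> ad 0 N" for \<phi>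
    unfolding adapted_swap[of P pre_snd pre_fst] using n by (intro cond_proj_adapted that) auto
  from J.I_AE_cong[OF n this[OF assms(2)] this[OF assms(1)] step.IH]
  show ?case using cond_proj_pred[OF n, of gN] cond_proj_pred[OF n, of gN'] by simp
qed

text \<open>Locality is asserted at all points, not only on \<open>space P\<close>, because
  \<open>normalized\<close> is an equality of functions on the whole type.\<close>

lemma cond_proj_local:
  fixes gN :: "('a, 'b) pathfun"
  assumes "gN \<in> bdd_meas X Y 0 N" "t \<le> N"
  shows "\<forall>x x' y y'. pre t y = pre t y' \<longrightarrow> cond_proj L N gN t (x, y) = cond_proj L N gN t (x', y')"
  using assms(2)
proof (induction rule: cond_proj_induct)
  case base
  obtain \<phi> where "gN = (\<lambda>(x, y). \<phi> (pre 0 x, pre N y))" using assms(1) by (auto simp: bdd_meas_def)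
  then show ?case by simp
next
  case (step t)
  show ?case
  proof (intro allI impI)
    fix x x' :: "nat \<Rightarrow> 'a" and y y' :: "nat \<Rightarrow> 'b" assume eq: "pre (t - 1) y = pre (t - 1) y'"
    have "cond_proj L N gN t (x, y(t := z)) = cond_proj L N gN t (x', y'(t := z))" for z
      using step(2) pre_upd_cong[OF eq] by blast
    then show "int_y L t (cond_proj L N gN t) (x, y) = int_y L t (cond_proj L N gN t) (x', y')"
      unfolding int_y_def prod.case eq by simp
  qed
qed

text \<open>Resampling x_1 in a function of x_1 alone erases all dependence on the point, also off
  \<open>space P\<close>; a single point of \<open>space P\<close> then identifies the constant as
  the expectation.\<close>

lemma int_x_1:
  assumes "1 \<le> N" "\<phi> \<in> bdd_meas X Y 1 0"
  shows "int_x K 1 \<phi> = (\<lambda>z. \<integral>w. \<phi> w \<partial>P)"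
proof -
  have 1: "1 \<in> {1..N}" using assms(1) by simp
  obtain z0 where z0: "z0 \<in> space P" using P.not_empty by blast
  obtain \<psi> where \<psi>: "\<phi> = (\<lambda>(x, y). \<psi> (pre 1 x, pre 0 y))" using assms(2) by (auto simp: bdd_meas_def)
  have "int_x K 1 \<phi> (x, y) = int_x K 1 \<phi> (x', y')" for x x' y y'
    using pre_upd_cong[of 1 x x'] by (simp add: int_x_def \<psi>)
  then have const: "int_x K 1 \<phi> z = int_x K 1 \<phi> z0" for z by (metis prod.exhaust)
  have "\<phi> \<in> ad 1 0" using assms by (intro bdd_meas_adapted) auto
  from I.expectation_I[OF 1 this, symmetric] have "(\<integral>z. \<phi> z \<partial>P) = (\<integral>z. int_x K 1 \<phi> z0 \<partial>P)"
    by (rule trans) (rule Bochner_Integration.integral_cong[OF refl const])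
  then have "(\<integral>z. \<phi> z \<partial>P) = int_x K 1 \<phi> z0" by (simp add: P.prob_space)
  with const show ?thesis by auto
qed

lemma int_y_1:
  assumes "1 \<le> N" "\<phi> \<in> ad 0 1"
    and local: "\<And>x x' y y'. pre 1 y = pre 1 y' \<Longrightarrow> \<phi> (x, y) = \<phi> (x', y')"
  shows "int_y L 1 \<phi> = (\<lambda>z. \<integral>w. \<phi> w \<partial>P)"
proof -
  have 1: "1 \<in> {1..N}" using assms(1) by simp
  obtain z0 where z0: "z0 \<in> space P" using P.not_empty by blast
  have "int_y L 1 \<phi> (x, y) = int_y L 1 \<phi> (x', y')" for x x' y y'
  proof -
    have "pre (1 - 1) y = pre (1 - 1) y'" by simp
    from pre_upd_cong[OF this] have "\<phi> (x, y(1 := z)) = \<phi> (x', y'(1 := z))" for z by (rule local)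
    then show ?thesis by (simp add: int_y_def)
  qed
  then have const: "int_y L 1 \<phi> z = int_y L 1 \<phi> z0" for z by (metis prod.exhaust)
  have "\<phi> \<in> adapted P pre_snd pre_fst 1 0" using assms(2) unfolding adapted_swap[of P pre_snd pre_fst] .
  from J.expectation_I[OF 1 this, symmetric] have "(\<integral>z. \<phi> z \<partial>P) = (\<integral>z. int_y L 1 \<phi> z0 \<partial>P)"
    by (rule trans) (rule Bochner_Integration.integral_cong[OF refl const])
  then have "(\<integral>z. \<phi> z \<partial>P) = int_y L 1 \<phi> z0" by (simp add: P.prob_space)
  with const show ?thesis by auto
qed

section \<open>Decompositions in terms of centred functions\<close>

lemma decomposition_f_centred:
  "decomposition m N X Y K L h f gN g \<Longrightarrow> t \<in> {1..N} \<Longrightarrow> f t \<in> I.centred_space t"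
  by (auto simp: decomposition_def intro!: A_X_centred)

text \<open>The g t are the martingale differences of \<open>gN\<close> along y: hence centred, and
  telescoping to \<open>gN\<close>. This puts the causal g into the class of the bicausal
  one.\<close>

lemma decomposition_causal:
  assumes "1 \<le> N" "decomposition Causal N X Y K L h f gN g"
  shows "gN \<in> ad 0 N"
    and "t \<in> {1..N} \<Longrightarrow> g t \<in> ad 0 t"
    and "t \<in> {1..N} \<Longrightarrow> g t \<in> J.centred_space t"
    and "gN z = (\<Sum>t=1..N. g t z)"
proof -
  have gN: "gN \<in> bdd_meas X Y 0 N" and g1: "g 1 = cond_proj L N gN 1"
    and gt: "\<And>t. t \<in> {2..N} \<Longrightarrow> g t = (\<lambda>z. cond_proj L N gN t z - cond_proj L N gN (t - 1) z)"
    using assms(2) by (auto simp: decomposition_def S_Y_def)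
  show gN_ad: "gN \<in> ad 0 N" by (rule bdd_meas_adapted[OF gN]) auto
  have cp: "cond_proj L N gN t \<in> ad 0 t" if "t \<le> N" for t by (rule cond_proj_adapted[OF gN_ad that])
  show g0: "g t \<in> ad 0 t" if t: "t \<in> {1..N}" for t
  proof (cases "t = 1")
    case True
    then show ?thesis using cp[of 1] t g1 by simp
  next
    case False
    then have "t \<in> {2..N}" using t by auto
    then show ?thesis unfolding gt[OF \<open>t \<in> {2..N}\<close>]
      using cp[of t] I.adapted_mono[of 0 0 "t - 1" t, OF _ _ cp[of "t - 1"]] by (intro adapted_diff) auto
  qed
  show "g t \<in> J.centred_space t" if t: "t \<in> {1..N}"
  proof -
    have "g t \<in> ad (t - 1) t" by (rule I.adapted_mono[OF _ _ g0[OF t]]) auto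
    moreover have "int_y L t (g t) z = 0" if ne: "t \<noteq> 1" and z: "z \<in> space P" for z
    proof -
      have t2: "t \<in> {2..N}" using t ne by auto
      have cpt: "cond_proj L N gN t \<in> adapted P pre_snd pre_fst t 0"
        unfolding adapted_swap[of P pre_snd pre_fst] using t by (intro cp) auto
      show ?thesis
        using J.centred[OF t cpt z] unfolding gt[OF t2] cond_proj_pred[OF t] .
    qed
    ultimately show ?thesis unfolding J.centred_space_def adapted_swap[of P pre_snd pre_fst] by blast
  qed
  have "n \<le> N \<Longrightarrow> (\<Sum>t=1..n. g t z) = cond_proj L N gN n z" if "1 \<le> n" for n
    using that
  proof (induction rule: nat_induct_at_least)
    case base
    then show ?case using g1 by simp
  next
    case (Suc n)
    then show ?case using gt[of "Suc n"] by simp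
  qed
  from this[OF assms(1)] show "gN z = (\<Sum>t=1..N. g t z)" by (simp add: cond_proj_N)
qed

lemma decomposition_g:
  assumes "1 \<le> N" "decomposition m N X Y K L h f gN g"
  shows "t \<in> {1..N} \<Longrightarrow> g t \<in> J.centred_space t" and "gN z = (\<Sum>t=1..N. g t z)"
proof -
  show "g t \<in> J.centred_space t" if "t \<in> {1..N}"
  proof (cases m)
    case Causal
    then show ?thesis using decomposition_causal(3) assms that by blast
  next
    case Bicausal
    then show ?thesis using assms(2) that by (intro A_Y_centred) (auto simp: decomposition_def)
  qed
  show "gN z = (\<Sum>t=1..N. g t z)"
  proof (cases m)
    case Causal
    then show ?thesis using decomposition_causal(4) assms by blast
  next
    case Bicausal
    then show ?thesis using assms(2) by (simp add: decomposition_def)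
  qed
qed

lemma decomposition_dual_space:
  assumes "decomposition m N X Y K L h f gN g"
  shows "h \<in> dual_space m N X Y K L"
proof -
  have "(\<lambda>z. \<Sum>t=1..N. f t z) \<in> S_X N X Y K"
    using assms unfolding decomposition_def S_X_def by blast
  moreover have "gN \<in> (case m of Causal \<Rightarrow> S_Y N X Y | Bicausal \<Rightarrow> S_Y_bicausal N X Y L)"
    using assms unfolding decomposition_def S_Y_bicausal_def by (cases m) auto
  moreover have "h = (\<lambda>z. (\<Sum>t=1..N. f t z) + gN z)" using assms by (simp add: decomposition_def)
  ultimately show ?thesis unfolding dual_space_def by (intro CollectI exI conjI)
qed

lemma normalized_iff:
  assumes "1 \<le> N" "decomposition m N X Y K L h f gN g"
  shows "normalized K L f g \<longleftrightarrow> (\<integral>z. f 1 z \<partial>P) = (\<integral>z. g 1 z \<partial>P)"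
proof -
  have 1: "1 \<in> {1..N}" using assms(1) by simp
  have "f 1 \<in> A_X X Y K 1" using assms(2) 1 unfolding decomposition_def by blast
  then have f: "f 1 \<in> bdd_meas X Y 1 0" by (simp add: A_X_def)
  have "g 1 \<in> J.centred_space 1" by (rule decomposition_g(1)[OF assms 1])
  then have "g 1 \<in> ad 0 1" by (simp add: J.centred_space_def adapted_swap[of P pre_snd pre_fst])
  moreover have "g 1 (x, y) = g 1 (x', y')" if eq: "pre 1 y = pre 1 y'" for x x' y y'
  proof (cases m)
    case Causal
    then have "gN \<in> bdd_meas X Y 0 N" "g 1 = cond_proj L N gN 1"
      using assms(2) by (auto simp: decomposition_def S_Y_def)
    then show ?thesis using cond_proj_local[of gN 1] assms(1) eq by metis
  next
    case Bicausal
    then have "g 1 \<in> A_Y X Y L 1" using assms(2) 1 unfolding decomposition_def by simp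
    then have "g 1 \<in> bdd_meas X Y 0 1" by (simp add: A_Y_def)
    then obtain \<phi> where "g 1 = (\<lambda>(x, y). \<phi> (pre 0 x, pre 1 y))" by (auto simp: bdd_meas_def)
    then show ?thesis using eq by simp
  qed
  ultimately have "int_y L 1 (g 1) = (\<lambda>z. \<integral>w. g 1 w \<partial>P)" by (rule int_y_1[OF assms(1)])
  with int_x_1[OF assms(1) f] show ?thesis by (auto simp: normalized_def fun_eq_iff)
qed

text \<open>Off \<open>space P\<close> the classes \<open>A_X\<close>, \<open>A_Y\<close> need not be linear, hence the equalities on
  \<open>space P\<close> only.\<close>

lemma decomposition_exists:
  assumes f: "\<And>t. t \<in> {1..N} \<Longrightarrow> f t \<in> I.centred_space t"
    and g: "\<And>t. m = Bicausal \<Longrightarrow> t \<in> {1..N} \<Longrightarrow> g t \<in> J.centred_space t"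
      "\<And>z. m = Bicausal \<Longrightarrow> z \<in> space P \<Longrightarrow> gN z = (\<Sum>t=1..N. g t z)"
    and gN: "m = Causal \<Longrightarrow> gN \<in> ad 0 N"
  shows "\<exists>h' f' gN' g'. decomposition m N X Y K L h' f' gN' g' \<and>
    (\<forall>z\<in>space P. h' z = (\<Sum>t=1..N. f t z) + gN z \<and> gN' z = gN z \<and>
      (\<forall>t\<in>{1..N}. f' t z = f t z \<and> (m = Bicausal \<longrightarrow> g' t z = g t z)))"
proof -
  have "\<exists>f'. \<forall>t\<in>{1..N}. f' t \<in> A_X X Y K t \<and> (\<forall>z\<in>space P. f' t z = f t z)"
    using centred_A_X[OF _ f] by (intro bchoice) blast
  then obtain f' where f': "\<And>t. t \<in> {1..N} \<Longrightarrow> f' t \<in> A_X X Y K t"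
    "\<And>t z. t \<in> {1..N} \<Longrightarrow> z \<in> space P \<Longrightarrow> f' t z = f t z" by blast
  show ?thesis
  proof (cases m)
    case Causal
    from adapted_bdd_meas[OF gN[OF Causal]] obtain gN' where gN': "gN' \<in> bdd_meas X Y 0 N"
      "\<And>z. z \<in> space P \<Longrightarrow> gN' z = gN z" by auto
    define g' where "g' t = (if t = 1 then cond_proj L N gN' 1
      else (\<lambda>z. cond_proj L N gN' t z - cond_proj L N gN' (t - 1) z))" for t
    have "decomposition m N X Y K L (\<lambda>z. (\<Sum>t=1..N. f' t z) + gN' z) f' gN' g'"
      using f'(1) gN'(1) by (auto simp: decomposition_def Causal S_Y_def g'_def)
    then show ?thesis using f'(2) gN'(2) Causal
      by (intro exI[of _ "\<lambda>z. (\<Sum>t=1..N. f' t z) + gN' z"] exI[of _ f'] exI[of _ gN'] exI[of _ g']) simp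
  next
    case Bicausal
    have "\<exists>g'. \<forall>t\<in>{1..N}. g' t \<in> A_Y X Y L t \<and> (\<forall>z\<in>space P. g' t z = g t z)"
      using centred_A_Y[OF _ g(1)[OF Bicausal]] by (intro bchoice) blast
    then obtain g' where g': "\<And>t. t \<in> {1..N} \<Longrightarrow> g' t \<in> A_Y X Y L t"
      "\<And>t z. t \<in> {1..N} \<Longrightarrow> z \<in> space P \<Longrightarrow> g' t z = g t z" by blast
    define gN' where "gN' = (\<lambda>z. \<Sum>t=1..N. g' t z)"
    have "decomposition m N X Y K L (\<lambda>z. (\<Sum>t=1..N. f' t z) + gN' z) f' gN' g'"
      using f'(1) g'(1) by (auto simp: decomposition_def Bicausal gN'_def)
    then show ?thesis using f'(2) g'(2) g(2)[OF Bicausal]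
      by (intro exI[of _ "\<lambda>z. (\<Sum>t=1..N. f' t z) + gN' z"] exI[of _ f'] exI[of _ gN'] exI[of _ g'])
        (simp add: gN'_def)
  qed
qed

text \<open>Treating the whole path \<open>x\<close> as a single coordinate, hence the filtration \<open>pre_fst (s * N)\<close>
  below, brings the marginal of \<open>P\<close> under the same interface as the kernels.\<close>

definition marginal :: "nat \<Rightarrow> ('a, 'b) pathfun \<Rightarrow> ('a, 'b) pathfun" where
  "marginal t \<phi> = (\<lambda>(x, y). \<integral>x'. \<phi> (x', y) \<partial>\<mu>)"

lemma cond_ops_marginal: "cond_ops P (\<lambda>s. pre_fst (s * N)) pre_snd 1 marginal"
proof (rule cond_ops_kernel[where upd = "\<lambda>t w z. (w, snd z)" and \<kappa> = "\<lambda>t z. \<mu>" and B = "\<lambda>t. \<mu>"])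
  show "prob_space P" by unfold_locales
  show "(\<lambda>z. \<mu>) \<in> P \<rightarrow>\<^sub>M prob_algebra \<mu>"
    by (rule measurable_const) (simp add: space_prob_algebra X.prob_space_axioms)
  show "(\<lambda>(z, w). (w, snd z)) \<in> P \<Otimes>\<^sub>M \<mu> \<rightarrow>\<^sub>M P"
    unfolding case_prod_beta' by (intro measurable_Pair measurable_compose[OF measurable_fst measurable_snd] measurable_snd)
  show "marginal t \<phi> z = (\<integral>w. \<phi> (w, snd z) \<partial>\<mu>)" for t \<phi> z
    by (simp add: marginal_def case_prod_beta)
  fix t s and \<phi> :: "('a, 'b) pathfun"
  assume \<phi>: "\<phi> \<in> adapted P (\<lambda>s. pre_fst (s * N)) pre_snd t s"
    and m: "marginal t \<phi> \<in> adapted P (\<lambda>s. pre_fst (s * N)) pre_snd (t - 1) s"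
  have int: "integrable P \<psi>" if "\<psi> \<in> adapted P (\<lambda>s. pre_fst (s * N)) pre_snd r s" for \<psi> r
  proof -
    from adapted_bounded[OF that] obtain C where C: "\<And>z. z \<in> space P \<Longrightarrow> \<bar>\<psi> z\<bar> \<le> C" by blast
    then show ?thesis by (intro P.integrable_const_bound[where B = C] adapted_measurable[OF that] AE_I2) simp
  qed
  have "(\<integral>z. marginal t \<phi> z \<partial>P) = (\<integral>y. (\<integral>x. marginal t \<phi> (x, y) \<partial>\<mu>) \<partial>\<nu>)"
    using integral_snd[of "\<lambda>x y. marginal t \<phi> (x, y)"] int[OF m] by simp
  also have "\<dots> = (\<integral>y. (\<integral>x. \<phi> (x, y) \<partial>\<mu>) \<partial>\<nu>)"
    by (simp add: marginal_def X.prob_space)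
  also have "\<dots> = (\<integral>z. \<phi> z \<partial>P)"
    using integral_snd[of "\<lambda>x y. \<phi> (x, y)"] int[OF \<phi>] by simp
  finally show "(\<integral>z. marginal t \<phi> z \<partial>P) = (\<integral>z. \<phi> z \<partial>P)" .
qed (auto simp: pre_fst_def pre_snd_def simp del: One_nat_def intro: pre_eq_mono mult_le_mono1)

sublocale M: cond_ops P "\<lambda>s. pre_fst (s * N)" pre_snd 1 marginal
  by (rule cond_ops_marginal)

lemma adapted_marginal: "adapted P (\<lambda>s. pre_fst (s * N)) pre_snd s t = ad (s * N) t"
  by (simp add: adapted_def)

end

section \<open>Dual maximizers\<close>

locale dual_optimum = path_laws N X \<mu> K Y \<nu> L
  for N and X :: "nat \<Rightarrow> 'a topology" and \<mu> K and Y :: "nat \<Rightarrow> 'b topology" and \<nu> L +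
  fixes m :: mode and c h :: "('a, 'b) pathfun" and f :: "nat \<Rightarrow> ('a, 'b) pathfun"
    and gN :: "('a, 'b) pathfun" and g :: "nat \<Rightarrow> ('a, 'b) pathfun"
  assumes N: "1 \<le> N"
    and c_measurable: "c \<in> borel_measurable P"
    and c_bounded: "bounded (c ` space P)"
    and optimal: "is_arg_max (dual_value P c) (\<lambda>k. k \<in> dual_space m N X Y K L) h"
    and decomposition: "decomposition m N X Y K L h f gN g"
begin

definition c_norm :: real where
  "c_norm = sup_norm (space P) c"

lemma c_le: "z \<in> space P \<Longrightarrow> \<bar>c z\<bar> \<le> c_norm"
proof -
  assume "z \<in> space P"
  moreover have "bdd_above ((\<lambda>z. \<bar>c z\<bar>) ` space P)"
    using c_bounded by (auto simp: bounded_iff bdd_above_def)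
  ultimately show ?thesis unfolding c_norm_def sup_norm_def by (intro cSUP_upper)
qed

lemma c_norm_nonneg: "0 \<le> c_norm"
proof -
  obtain z where "z \<in> space P" using P.not_empty by blast
  then show ?thesis using c_le[of z] by linarith
qed

lemma c_adapted: "c \<in> ad N N"
proof (rule adaptedI[OF c_measurable c_le])
  fix z z' assume "z \<in> space P" "z' \<in> space P" "pre_fst N z = pre_fst N z'" "pre_snd N z = pre_snd N z'"
  \<comment> \<open>Full paths are their own initial segments of length N.\<close>
  then have "z = z'"
    using pre_self[of "fst z" X N] pre_self[of "fst z'" X N] pre_self[of "snd z" Y N] pre_self[of "snd z'" Y N]
    by (simp add: in_P pre_fst_def pre_snd_def X.space_law Y.space_law prod_eq_iff)
  then show "c z = c z'" by simp
qed

lemmas f_centred = decomposition_f_centred[OF decomposition]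
lemmas g_centred = decomposition_g(1)[OF N decomposition]
lemmas gN_eq = decomposition_g(2)[OF N decomposition]

lemma f_adapted: "t \<in> {1..N} \<Longrightarrow> f t \<in> ad t (t - 1)"
  by (rule I.centred_spaceD(1)[OF f_centred])

lemma g_adapted: "t \<in> {1..N} \<Longrightarrow> g t \<in> ad (t - 1) t"
  using J.centred_spaceD(1)[OF g_centred] unfolding adapted_swap[of P pre_snd pre_fst] .

lemma h_eq_gN: "h z = (\<Sum>t=1..N. f t z) + gN z"
  using decomposition by (simp add: decomposition_def)

lemma h_eq: "h z = (\<Sum>t=1..N. f t z + g t z)"
  by (simp add: h_eq_gN gN_eq sum.distrib)

lemma h_adapted: "h \<in> ad N N"
  unfolding h_eq[abs_def]
  by (intro adapted_sum adapted_add I.adapted_mono[OF _ _ f_adapted] I.adapted_mono[OF _ _ g_adapted]) auto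

text \<open>The dual value sees only \<open>space P\<close>, so a competitor may be given there by
  centred functions; \<open>decomposition_exists\<close> supplies a genuine member of the dual space
  that agrees with it.\<close>

lemma dual_value_le:
  assumes "\<And>t. t \<in> {1..N} \<Longrightarrow> f' t \<in> I.centred_space t"
    and "\<And>t. m = Bicausal \<Longrightarrow> t \<in> {1..N} \<Longrightarrow> g' t \<in> J.centred_space t"
    and "\<And>z. m = Bicausal \<Longrightarrow> z \<in> space P \<Longrightarrow> gN' z = (\<Sum>t=1..N. g' t z)"
    and "m = Causal \<Longrightarrow> gN' \<in> ad 0 N"
    and "\<And>z. z \<in> space P \<Longrightarrow> k z = (\<Sum>t=1..N. f' t z) + gN' z"
  shows "dual_value P c k \<le> dual_value P c h"
proof -
  from decomposition_exists[of f' m g' gN', OF assms(1-4)] obtain h1 f1 gN1 g1 where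
    "decomposition m N X Y K L h1 f1 gN1 g1" and eq: "\<forall>z\<in>space P. h1 z = (\<Sum>t=1..N. f' t z) + gN' z"
    by blast
  then have "dual_value P c h1 \<le> dual_value P c h"
    using optimal decomposition_dual_space unfolding is_arg_max_linorder by blast
  moreover have "dual_value P c h1 = dual_value P c k"
    using eq assms(5) by (intro dual_value_cong) simp
  ultimately show ?thesis by simp
qed

lemma sum_perturb:
  fixes u :: "nat \<Rightarrow> 'c \<Rightarrow> real"
  assumes "t \<in> {1..N}"
  shows "(\<Sum>s=1..N. (u(t := (\<lambda>z. u t z + \<epsilon> * k z))) s z) = (\<Sum>s=1..N. u s z) + \<epsilon> * k z"
proof -
  have "(\<Sum>s=1..N. (u(t := (\<lambda>z. u t z + \<epsilon> * k z))) s z) = (\<Sum>s=1..N. u s z + (if s = t then \<epsilon> * k z else 0))"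
    by (rule sum.cong) auto
  also have "\<dots> = (\<Sum>s=1..N. u s z) + \<epsilon> * k z" using assms by (simp add: sum.distrib)
  finally show ?thesis .
qed

lemma first_order_x:
  assumes t: "t \<in> {1..N}" and k: "k \<in> I.centred_space t"
  shows "(\<integral>z. k z * exp (h z - c z) \<partial>P) = (\<integral>z. k z \<partial>P)"
proof (rule first_order_condition[OF h_adapted _ c_adapted])
  show "k \<in> ad N N" using t by (intro I.adapted_mono[OF _ _ I.centred_spaceD(1)[OF k]]) auto
  fix \<epsilon> :: real
  show "dual_value P c (\<lambda>z. h z + \<epsilon> * k z) \<le> dual_value P c h"
  proof (rule dual_value_le)
    show "(f(t := (\<lambda>z. f t z + \<epsilon> * k z))) s \<in> I.centred_space s" if "s \<in> {1..N}" for s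
      using I.centred_space_add_scale[OF t f_centred[OF t] k] f_centred[OF that] by simp
    show "g s \<in> J.centred_space s" if "s \<in> {1..N}" for s by (rule g_centred[OF that])
    show "gN z = (\<Sum>t=1..N. g t z)" for z by (rule gN_eq)
    show "gN \<in> ad 0 N" if "m = Causal"
      using decomposition_causal(1)[OF N] decomposition that by blast
    show "h z + \<epsilon> * k z = (\<Sum>s=1..N. (f(t := (\<lambda>z. f t z + \<epsilon> * k z))) s z) + gN z" for z
      by (simp only: sum_perturb[OF t] h_eq_gN)
  qed
qed

lemma first_order_y:
  assumes m: "m = Bicausal" and t: "t \<in> {1..N}" and k: "k \<in> J.centred_space t"
  shows "(\<integral>z. k z * exp (h z - c z) \<partial>P) = (\<integral>z. k z \<partial>P)"
proof (rule first_order_condition[OF h_adapted _ c_adapted])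
  have "k \<in> ad (t - 1) t" using J.centred_spaceD(1)[OF k] unfolding adapted_swap[of P pre_snd pre_fst] .
  then show "k \<in> ad N N" using t by (intro I.adapted_mono[of "t - 1" N t N]) auto
  fix \<epsilon> :: real
  show "dual_value P c (\<lambda>z. h z + \<epsilon> * k z) \<le> dual_value P c h"
  proof (rule dual_value_le)
    show "f s \<in> I.centred_space s" if "s \<in> {1..N}" for s by (rule f_centred[OF that])
    show "(g(t := (\<lambda>z. g t z + \<epsilon> * k z))) s \<in> J.centred_space s" if "s \<in> {1..N}" for s
      using J.centred_space_add_scale[OF t g_centred[OF t] k] g_centred[OF that] by simp
    show "gN z + \<epsilon> * k z = (\<Sum>s=1..N. (g(t := (\<lambda>z. g t z + \<epsilon> * k z))) s z)" for z
      by (simp only: sum_perturb[OF t] gN_eq)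
    show "h z + \<epsilon> * k z = (\<Sum>s=1..N. f s z) + (gN z + \<epsilon> * k z)" for z
      by (simp add: h_eq_gN)
  qed (simp add: m)
qed

lemma first_order_marginal:
  assumes m: "m = Causal" and k: "k \<in> ad 0 N"
  shows "(\<integral>z. k z * exp (h z - c z) \<partial>P) = (\<integral>z. k z \<partial>P)"
proof (rule first_order_condition[OF h_adapted _ c_adapted])
  show "k \<in> ad N N" by (rule I.adapted_mono[OF _ _ k]) auto
  have gN: "gN \<in> ad 0 N" using decomposition_causal(1)[OF N] decomposition m by blast
  fix \<epsilon> :: real
  show "dual_value P c (\<lambda>z. h z + \<epsilon> * k z) \<le> dual_value P c h"
  proof (rule dual_value_le)
    show "f s \<in> I.centred_space s" if "s \<in> {1..N}" for s by (rule f_centred[OF that])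
    show "(\<lambda>z. gN z + \<epsilon> * k z) \<in> ad 0 N" by (intro adapted_add adapted_mult adapted_const gN k)
    show "h z + \<epsilon> * k z = (\<Sum>s=1..N. f s z) + (gN z + \<epsilon> * k z)" for z
      by (simp add: h_eq_gN)
  qed (simp_all add: m)
qed

sublocale F: causal_system P pre_fst pre_snd N "int_x K" "int_y L" c f g
  using N c_adapted f_centred g_adapted first_order_x
  by unfold_locales (simp_all only: h_eq)

lemma anticausal: "m = Bicausal \<Longrightarrow> causal_system P pre_snd pre_fst N (int_y L) (int_x K) c g f"
  using N c_adapted g_centred f_adapted first_order_y
  by unfold_locales (simp_all only: h_eq add.commute adapted_swap[of P pre_snd pre_fst])

section \<open>The causal equation for g and the bounds on the potentials\<close>

definition f_mean :: real where
  "f_mean = (\<integral>z. f 1 z \<partial>P)"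

text \<open>Integrating out all of x turns exp(h - c) into exp(gN - s), with s the soft integral on
  the right. In causal mode every bounded function of y is a test function, so this density is
  1.\<close>

lemma marginal_eq:
  assumes m: "m = Causal"
  shows "AE z in P. gN z = soft_int marginal 1 (\<lambda>z. (\<Sum>t=1..N. f t z) - c z) z"
proof -
  let ?v = "\<lambda>z. (\<Sum>t=1..N. f t z) - c z"
  have 1: "1 \<in> {1..1::nat}" by simp
  have gN: "gN \<in> adapted P (\<lambda>s. pre_fst (s * N)) pre_snd (1 - 1) N"
    using decomposition_causal(1)[OF N] decomposition m by (simp add: adapted_marginal)
  have "?v \<in> ad N N"
    by (intro adapted_diff adapted_sum c_adapted I.adapted_mono[OF _ _ f_adapted]) auto
  then have v: "?v \<in> adapted P (\<lambda>s. pre_fst (s * N)) pre_snd 1 N" by (simp add: adapted_marginal)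
  have e: "(\<lambda>z. exp (gN z + ?v z)) \<in> adapted P (\<lambda>s. pre_fst (s * N)) pre_snd 1 N"
    by (intro adapted_exp adapted_add M.adapted_pred[OF gN] v)
  have gs: "(\<lambda>z. gN z - soft_int marginal 1 ?v z) \<in> adapted P (\<lambda>s. pre_fst (s * N)) pre_snd (1 - 1) N"
    by (intro adapted_diff gN M.soft_int_adapted 1 v)
  have "AE z in P. exp (gN z - soft_int marginal 1 ?v z) = 1"
  proof (rule M.AE_eq_1[OF adapted_exp[OF gs]])
    fix k assume k: "k \<in> adapted P (\<lambda>s. pre_fst (s * N)) pre_snd (1 - 1) N"
    then have k0: "k \<in> ad 0 N" by (simp add: adapted_marginal)
    have "(\<integral>z. k z * exp (gN z - soft_int marginal 1 ?v z) \<partial>P)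
        = (\<integral>z. k z * marginal 1 (\<lambda>z. exp (gN z + ?v z)) z \<partial>P)"
      by (rule Bochner_Integration.integral_cong[OF refl]) (simp only: M.I_exp_add[OF 1 gN v])
    also have "\<dots> = (\<integral>z. k z * exp (gN z + ?v z) \<partial>P)" by (rule M.expectation_mult_I[OF 1 k e])
    also have "\<dots> = (\<integral>z. k z * exp (h z - c z) \<partial>P)" by (simp add: h_eq_gN algebra_simps)
    also have "\<dots> = (\<integral>z. k z \<partial>P)" by (rule first_order_marginal[OF m k0])
    finally show "(\<integral>z. k z * exp (gN z - soft_int marginal 1 ?v z) \<partial>P) = (\<integral>z. k z \<partial>P)" .
  qed
  then show ?thesis by eventually_elim simp
qed

text \<open>By \<open>marginal_eq\<close> and nonexpansiveness, \<open>gN\<close> inherits the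
  distance of the argument from the constant \<open>f_mean\<close>: N estimates for the f t plus the
  cost. The soft integral of that constant is \<open>- f_mean\<close>.\<close>

lemma gN_bound_causal:
  fixes \<gamma> :: real
  assumes m: "m = Causal"
    and f_bound: "\<And>t. t \<in> {1..N} \<Longrightarrow> AE z in P. \<bar>f t z - (if t = 1 then f_mean else 0)\<bar> \<le> \<gamma>"
  shows "AE z in P. \<bar>gN z + f_mean\<bar> \<le> N * \<gamma> + c_norm"
proof -
  let ?v = "\<lambda>z. (\<Sum>t=1..N. f t z) - c z"
  have 1: "1 \<in> {1..1::nat}" by simp
  have "?v \<in> ad N N"
    by (intro adapted_diff adapted_sum c_adapted I.adapted_mono[OF _ _ f_adapted]) auto
  then have v: "?v \<in> adapted P (\<lambda>s. pre_fst (s * N)) pre_snd 1 N" by (simp add: adapted_marginal)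
  have "AE z in P. \<forall>t\<in>{1..N}. \<bar>f t z - (if t = 1 then f_mean else 0)\<bar> \<le> \<gamma>"
    by (intro AE_finite_allI f_bound) auto
  then have "AE z in P. \<bar>?v z - f_mean\<bar> \<le> N * \<gamma> + c_norm"
    using AE_space
  proof eventually_elim
    fix z assume le: "\<forall>t\<in>{1..N}. \<bar>f t z - (if t = 1 then f_mean else 0)\<bar> \<le> \<gamma>" and z: "z \<in> space P"
    have "(\<Sum>t=1..N. f t z) - f_mean = (\<Sum>t=1..N. f t z - (if t = 1 then f_mean else 0))"
      using N by (simp add: sum_subtractf)
    then have "\<bar>(\<Sum>t=1..N. f t z) - f_mean\<bar> \<le> (\<Sum>t=1..N. \<bar>f t z - (if t = 1 then f_mean else 0)\<bar>)"
      by (simp only: sum_abs)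
    also have "\<dots> \<le> (\<Sum>t=1..N. \<gamma>)" using le by (intro sum_mono) blast
    finally have "\<bar>(\<Sum>t=1..N. f t z) - f_mean\<bar> \<le> N * \<gamma>" by simp
    then show "\<bar>?v z - f_mean\<bar> \<le> N * \<gamma> + c_norm" using c_le[OF z] by linarith
  qed
  from M.soft_int_AE_close[OF 1 v adapted_const this]
  have "AE z in P. \<bar>soft_int marginal 1 ?v z - soft_int marginal 1 (\<lambda>z. f_mean) z\<bar> \<le> N * \<gamma> + c_norm" .
  moreover have "soft_int marginal 1 (\<lambda>z. f_mean) z = - f_mean" for z
    by (simp add: soft_int_def marginal_def X.prob_space case_prod_beta)
  ultimately have "AE z in P. \<bar>soft_int marginal 1 ?v z + f_mean\<bar> \<le> N * \<gamma> + c_norm" by simp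
  with marginal_eq[OF m] show ?thesis by eventually_elim simp
qed

lemma expectation_h: "(\<integral>z. h z \<partial>P) = f_mean + (\<integral>z. g 1 z \<partial>P)"
proof -
  have int_f: "integrable P (f t)" and int_g: "integrable P (g t)" if "t \<in> {1..N}" for t
    using I.adapted_integrable[OF f_adapted[OF that]] I.adapted_integrable[OF g_adapted[OF that]] by auto
  have 0: "(\<integral>z. f t z \<partial>P) = 0" "(\<integral>z. g t z \<partial>P) = 0" if "t \<in> {2..N}" for t
    using I.centred_space_expectation[OF that f_centred] J.centred_space_expectation[OF that g_centred] that
    by auto
  have "(\<integral>z. h z \<partial>P) = (\<Sum>t=1..N. (\<integral>z. f t z + g t z \<partial>P))"
    unfolding h_eq[abs_def] using int_f int_g by (intro Bochner_Integration.integral_sum) auto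
  also have "\<dots> = (\<Sum>t=1..N. (\<integral>z. f t z \<partial>P) + (\<integral>z. g t z \<partial>P))"
    using int_f int_g by (intro sum.cong Bochner_Integration.integral_add) auto
  also have "\<dots> = ((\<integral>z. f 1 z \<partial>P) + (\<integral>z. g 1 z \<partial>P)) + (\<Sum>t=2..N. (\<integral>z. f t z \<partial>P) + (\<integral>z. g t z \<partial>P))"
    using N by (simp add: sum.atLeast_Suc_atMost numeral_2_eq_2)
  also have "(\<Sum>t=2..N. (\<integral>z. f t z \<partial>P) + (\<integral>z. g t z \<partial>P)) = 0" using 0 by (intro sum.neutral) auto
  finally show ?thesis by (simp add: f_mean_def)
qed

text \<open>Testing with the constant 1 shows that exp(h - c) has mass 1, so the optimal dual value
  is \<integral>h. The upper bound is 1 + u \<le> exp u with u = h - c; the lower one compares h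
  with a constant.\<close>

lemma expectation_h_bound: "\<bar>\<integral>z. h z \<partial>P\<bar> \<le> c_norm"
proof -
  have 1: "1 \<in> {1..N}" using N by simp
  have "(\<lambda>z. 1) \<in> I.centred_space 1" by (simp add: I.centred_space_def)
  from first_order_x[OF 1 this] have mass: "(\<integral>z. exp (h z - c z) \<partial>P) = 1" by (simp add: P.prob_space)
  have int_h: "integrable P h" by (rule I.adapted_integrable[OF h_adapted])
  have int_e: "integrable P (\<lambda>z. exp (h z - c z))"
    by (rule I.adapted_integrable[of _ N N]) (intro adapted_exp adapted_diff h_adapted c_adapted)
  have "(\<integral>z. h z \<partial>P) \<le> (\<integral>z. exp (h z - c z) + (c_norm - 1) \<partial>P)"
  proof (rule integral_mono[OF int_h])
    fix z assume "z \<in> space P"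
    then show "h z \<le> exp (h z - c z) + (c_norm - 1)"
      using exp_ge_add_one_self[of "h z - c z"] c_le[of z] by linarith
  qed (intro Bochner_Integration.integrable_add int_e P.integrable_const)
  also have "\<dots> = c_norm" using int_e by (simp add: mass P.prob_space)
  finally have upper: "(\<integral>z. h z \<partial>P) \<le> c_norm" .
  have int_c: "integrable P (\<lambda>z. exp (- c_norm - c z))"
    by (rule I.adapted_integrable[of _ N N]) (intro adapted_exp adapted_diff adapted_const c_adapted)
  have "(\<integral>z. exp (- c_norm - c z) \<partial>P) \<le> (\<integral>z. 1 \<partial>P)"
  proof (rule integral_mono[OF int_c])
    fix z assume "z \<in> space P"
    then show "exp (- c_norm - c z) \<le> 1" using c_le[of z] by simp
  qed simp
  \<comment> \<open>The competitor \<open>- c_norm\<close> has exp(- c_norm - c) \<le> 1, so the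
    penalty is at most the added 1.\<close>
  then have "- c_norm \<le> dual_value P c (\<lambda>z. - c_norm)"
    using int_c by (simp add: dual_value_def P.prob_space)
  also have "\<dots> \<le> dual_value P c h"
  proof (rule dual_value_le)
    show "(\<lambda>z. 0) \<in> I.centred_space t" if "t \<in> {1..N}" for t
      using I.I_pull[OF that adapted_const] by (simp add: I.centred_space_def)
    show "(\<lambda>z. if t = 1 then - c_norm else 0) \<in> J.centred_space t" if "t \<in> {1..N}" for t
      using J.I_pull[OF that adapted_const[of 0]] by (simp add: J.centred_space_def)
    show "- c_norm = (\<Sum>t=1..N. if t = 1 then - c_norm else 0)" using N by simp
  qed simp_all
  also have "\<dots> = (\<integral>z. h z \<partial>P)" using int_h int_e by (simp add: dual_value_def mass)
  finally show ?thesis using upper by linarith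
qed

text \<open>The term 2 * 3 ^ N covers the bicausal estimate and the factor 2 of the causal one. In
  the causal bound on \<open>gN\<close>, 2 * N collects the estimates for the f t, and the last 2
  leaves room for the cost and the mean.\<close>

definition bound_const :: real where
  "bound_const = 2 * 3 ^ N + 2 * real N + 2"

lemma potential_bounds:
  assumes "normalized K L f g"
  shows "t \<in> {1..N} \<Longrightarrow> AE z in P. \<bar>f t z\<bar> \<le> bound_const * c_norm"
    and "m = Bicausal \<Longrightarrow> t \<in> {1..N} \<Longrightarrow> AE z in P. \<bar>g t z\<bar> \<le> bound_const * c_norm"
    and "m = Causal \<Longrightarrow> AE z in P. \<bar>gN z\<bar> \<le> bound_const * c_norm"
proof -
  have g_mean: "(\<integral>z. g 1 z \<partial>P) = f_mean"
    using normalized_iff[OF N decomposition] assms by (simp add: f_mean_def)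
  \<comment> \<open>Under the normalization both time-1 means are half of \<integral>h.\<close>
  then have mean: "\<bar>f_mean\<bar> \<le> c_norm / 2" using expectation_h expectation_h_bound by simp
  have pow: "1 \<le> (3::real) ^ N" by simp
  have C: "2 * 3 ^ N * c_norm + 2 * N * c_norm + 2 * c_norm = bound_const * c_norm"
    by (simp add: bound_const_def algebra_simps)
  have C2: "2 * c_norm \<le> 2 * 3 ^ N * c_norm" using mult_right_mono[OF pow c_norm_nonneg] by simp
  have C3: "0 \<le> 2 * N * c_norm" using c_norm_nonneg by simp
  have uncentre: "\<bar>x\<bar> \<le> bound_const * c_norm"
    if "\<bar>x - (if b then f_mean else 0)\<bar> \<le> 2 * 3 ^ N * c_norm" for x b
  proof -
    have "\<bar>if b then f_mean else 0\<bar> \<le> c_norm / 2" using mean c_norm_nonneg by simp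
    then show ?thesis using that C C3 c_norm_nonneg by linarith
  qed
  have causal: "AE z in P. \<bar>f t z - (if t = 1 then f_mean else 0)\<bar> \<le> 2 * c_norm"
    if "m = Causal" "t \<in> {1..N}" for t
  proof -
    have "g s \<in> ad 0 s" if "s \<in> {1..N}" for s
      using decomposition_causal(2)[OF N] decomposition \<open>m = Causal\<close> that by blast
    from F.f_bound_causal[OF c_le this that(2)] show ?thesis unfolding f_mean_def .
  qed
  have bicausal: "AE z in P. \<bar>f t z - (if t = 1 then f_mean else 0)\<bar> \<le> 2 * 3 ^ N * c_norm"
      "AE z in P. \<bar>g t z - (if t = 1 then f_mean else 0)\<bar> \<le> 2 * 3 ^ N * c_norm"
    if "m = Bicausal" "t \<in> {1..N}" for t
    using bicausal_bound[OF F.causal_system_axioms anticausal[OF that(1)] c_le that(2)] 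
    unfolding f_mean_def[symmetric] g_mean by blast+
  show "AE z in P. \<bar>f t z\<bar> \<le> bound_const * c_norm" if t: "t \<in> {1..N}"
  proof -
    have "AE z in P. \<bar>f t z - (if t = 1 then f_mean else 0)\<bar> \<le> 2 * 3 ^ N * c_norm"
    proof (cases m)
      case Causal
      from causal[OF this t] show ?thesis by eventually_elim (use C2 in linarith)
    qed (rule bicausal(1)[OF _ t])
    then show ?thesis
      by eventually_elim (rule uncentre)
  qed
  show "AE z in P. \<bar>g t z\<bar> \<le> bound_const * c_norm" if "m = Bicausal" "t \<in> {1..N}"
    using bicausal(2)[OF that]
    by eventually_elim (rule uncentre)
  show "AE z in P. \<bar>gN z\<bar> \<le> bound_const * c_norm" if "m = Causal"
  proof -
    have "AE z in P. \<bar>gN z + f_mean\<bar> \<le> N * (2 * c_norm) + c_norm"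
      by (rule gN_bound_causal[OF that causal[OF that]])
    then show ?thesis
    proof eventually_elim
      fix z assume "\<bar>gN z + f_mean\<bar> \<le> N * (2 * c_norm) + c_norm"
      moreover have "N * (2 * c_norm) = 2 * N * c_norm" by simp
      ultimately show "\<bar>gN z\<bar> \<le> bound_const * c_norm" using mean C C2 c_norm_nonneg by linarith
    qed
  qed
qed

text \<open>In causal mode \<open>gN\<close> itself is truncated and g' recomputed as its martingale
  differences: conditional projections stay within B, so differences stay within 2 * B. In bicausal
  mode each g t is truncated and centred again.\<close>

lemma bounded_version:
  assumes normalized: "normalized K L f g"
  shows "\<exists>h' f' gN' g'. decomposition m N X Y K L h' f' gN' g' \<and>
    (\<forall>t\<in>{1..N}. (AE z in P. f' t z = f t z) \<and> (AE z in P. g' t z = g t z)) \<and>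
    (\<forall>t\<in>{1..N}. \<forall>z\<in>space P. \<bar>f' t z\<bar> \<le> 2 * (bound_const * c_norm) \<and> \<bar>g' t z\<bar> \<le> 2 * (bound_const * c_norm))"
proof -
  define B where "B = bound_const * c_norm"
  have B: "0 \<le> B" using c_norm_nonneg by (simp add: B_def bound_const_def)
  note bounds = potential_bounds[OF normalized, folded B_def]
  have "\<forall>t\<in>{1..N}. \<exists>\<phi>. \<phi> \<in> I.centred_space t \<and> (\<forall>z\<in>space P. \<bar>\<phi> z\<bar> \<le> 2 * B) \<and> (AE z in P. \<phi> z = f t z)"
    using I.centred_clip[OF _ f_centred B bounds(1)] by blast
  from bchoice[OF this] obtain f1 where
    "\<forall>t\<in>{1..N}. f1 t \<in> I.centred_space t \<and> (\<forall>z\<in>space P. \<bar>f1 t z\<bar> \<le> 2 * B) \<and> (AE z in P. f1 t z = f t z)" ..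
  then have f1: "\<And>t. t \<in> {1..N} \<Longrightarrow> f1 t \<in> I.centred_space t"
    "\<And>t z. t \<in> {1..N} \<Longrightarrow> z \<in> space P \<Longrightarrow> \<bar>f1 t z\<bar> \<le> 2 * B"
    "\<And>t. t \<in> {1..N} \<Longrightarrow> AE z in P. f1 t z = f t z" by simp_all
  show ?thesis
  proof (cases m)
    case Causal
    have dec: "decomposition Causal N X Y K L h f gN g" using decomposition Causal by simp
    have gN: "gN \<in> ad 0 N" by (rule decomposition_causal(1)[OF N dec])
    define gN1 where "gN1 = (\<lambda>z. clip B (gN z))"
    have gN1: "gN1 \<in> ad 0 N" unfolding gN1_def by (rule adapted_clip[OF gN B])
    from decomposition_exists[of f1 Causal g gN1, OF f1(1)] gN1
    obtain h' f' gN' g' where dec': "decomposition Causal N X Y K L h' f' gN' g'"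
      and eq: "\<forall>z\<in>space P. gN' z = gN1 z \<and> (\<forall>t\<in>{1..N}. f' t z = f1 t z)" by auto
    have gN': "gN' \<in> ad 0 N" by (rule decomposition_causal(1)[OF N dec'])
    have gN'_le: "\<bar>gN' z\<bar> \<le> B" if "z \<in> space P" for z
      using eq that abs_clip_le[OF B] by (simp add: gN1_def)
    have gN'_eq: "AE z in P. gN' z = gN z"
      using bounds(3)[OF Causal] AE_space by eventually_elim (use eq in \<open>simp add: gN1_def clip_eq\<close>)
    have cp_eq: "AE z in P. cond_proj L N gN' t z = cond_proj L N gN t z" if "t \<le> N" for t
      by (rule cond_proj_AE_cong[OF gN gN' that gN'_eq])
    have cp_le: "\<bar>cond_proj L N gN' t z\<bar> \<le> B" if "t \<le> N" "z \<in> space P" for t z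
      using cond_proj_bound[OF gN' that(1) gN'_le] that(2) by blast
    have g'_cases: "t = 1 \<and> g t = cond_proj L N gN 1 \<and> g' t = cond_proj L N gN' 1 \<or>
        g t = (\<lambda>z. cond_proj L N gN t z - cond_proj L N gN (t - 1) z) \<and>
        g' t = (\<lambda>z. cond_proj L N gN' t z - cond_proj L N gN' (t - 1) z)" if "t \<in> {1..N}" for t
    proof (cases "t = 1")
      case True
      then show ?thesis using dec dec' by (simp add: decomposition_def)
    next
      case False
      then have "t \<in> {2..N}" using that by auto
      then show ?thesis using dec dec' unfolding decomposition_def by simp
    qed
    show ?thesis
    proof (intro exI conjI ballI)
      show "decomposition m N X Y K L h' f' gN' g'" using dec' Causal by simp
      fix t assume t: "t \<in> {1..N}"
      then have tN: "t \<le> N" "t - 1 \<le> N" "1 \<le> N" by auto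
      show "AE z in P. f' t z = f t z"
        using f1(3)[OF t] AE_space by eventually_elim (use eq t in simp)
      show "AE z in P. g' t z = g t z"
        using g'_cases[OF t]
      proof (elim disjE conjE)
        assume "g t = cond_proj L N gN 1" "g' t = cond_proj L N gN' 1"
        then show ?thesis using cp_eq[OF tN(3)] by simp
      next
        assume *: "g t = (\<lambda>z. cond_proj L N gN t z - cond_proj L N gN (t - 1) z)"
          "g' t = (\<lambda>z. cond_proj L N gN' t z - cond_proj L N gN' (t - 1) z)"
        show ?thesis unfolding * using cp_eq[OF tN(1)] cp_eq[OF tN(2)] by eventually_elim simp
      qed
      fix z assume z: "z \<in> space P"
      show "\<bar>f' t z\<bar> \<le> 2 * (bound_const * c_norm)" using f1(2)[OF t z] eq z t by (simp add: B_def)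
      show "\<bar>g' t z\<bar> \<le> 2 * (bound_const * c_norm)"
        using g'_cases[OF t] cp_le[OF tN(1) z] cp_le[OF tN(2) z] cp_le[OF tN(3) z] B
        unfolding B_def[symmetric] by (elim disjE conjE) force+
    qed
  next
    case Bicausal
    have "\<forall>t\<in>{1..N}. \<exists>\<phi>. \<phi> \<in> J.centred_space t \<and> (\<forall>z\<in>space P. \<bar>\<phi> z\<bar> \<le> 2 * B) \<and> (AE z in P. \<phi> z = g t z)"
      using J.centred_clip[OF _ g_centred B bounds(2)[OF Bicausal]] by blast
    from bchoice[OF this] obtain g1 where
      "\<forall>t\<in>{1..N}. g1 t \<in> J.centred_space t \<and> (\<forall>z\<in>space P. \<bar>g1 t z\<bar> \<le> 2 * B) \<and> (AE z in P. g1 t z = g t z)" ..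
    then have g1: "\<And>t. t \<in> {1..N} \<Longrightarrow> g1 t \<in> J.centred_space t"
      "\<And>t z. t \<in> {1..N} \<Longrightarrow> z \<in> space P \<Longrightarrow> \<bar>g1 t z\<bar> \<le> 2 * B"
      "\<And>t. t \<in> {1..N} \<Longrightarrow> AE z in P. g1 t z = g t z" by simp_all
    from decomposition_exists[of f1 Bicausal g1 "\<lambda>z. \<Sum>t=1..N. g1 t z", OF f1(1) g1(1)]
    obtain h' f' gN' g' where dec': "decomposition Bicausal N X Y K L h' f' gN' g'"
      and eq: "\<forall>z\<in>space P. \<forall>t\<in>{1..N}. f' t z = f1 t z \<and> g' t z = g1 t z" by auto
    show ?thesis
    proof (intro exI conjI ballI)
      show "decomposition m N X Y K L h' f' gN' g'" using dec' Bicausal by simp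
      fix t assume t: "t \<in> {1..N}"
      show "AE z in P. f' t z = f t z"
        using f1(3)[OF t] AE_space by eventually_elim (use eq t in simp)
      show "AE z in P. g' t z = g t z"
        using g1(3)[OF t] AE_space by eventually_elim (use eq t in simp)
      fix z assume z: "z \<in> space P"
      show "\<bar>f' t z\<bar> \<le> 2 * (bound_const * c_norm)" using f1(2)[OF t z] eq z t by (simp add: B_def)
      show "\<bar>g' t z\<bar> \<le> 2 * (bound_const * c_norm)" using g1(2)[OF t z] eq z t by (simp add: B_def)
    qed
  qed
qed

lemma normalized_bound:
  assumes normalized: "normalized K L f g"
  shows "\<exists>h' f' gN' g'. decomposition m N X Y K L h' f' gN' g' \<and> normalized K L f' g' \<and>
    (AE z in P. h' z = h z) \<and>
    (\<forall>t\<in>{1..N}. (AE z in P. f' t z = f t z) \<and> (AE z in P. g' t z = g t z)) \<and>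
    Max ({sup_norm (space P) h'} \<union> (\<lambda>t. sup_norm (space P) (f' t)) ` {1..N}
        \<union> (\<lambda>t. sup_norm (space P) (g' t)) ` {1..N}) \<le> 4 * real N * bound_const * c_norm"
proof -
  from bounded_version[OF normalized] obtain h' f' gN' g' where
    dec': "decomposition m N X Y K L h' f' gN' g'"
    and AE_eq: "\<forall>t\<in>{1..N}. (AE z in P. f' t z = f t z) \<and> (AE z in P. g' t z = g t z)"
    and le: "\<forall>t\<in>{1..N}. \<forall>z\<in>space P. \<bar>f' t z\<bar> \<le> 2 * (bound_const * c_norm) \<and> \<bar>g' t z\<bar> \<le> 2 * (bound_const * c_norm)"
    by blast
  have 1: "1 \<in> {1..N}" using N by simp
  have h'_eq: "h' z = (\<Sum>t=1..N. f' t z + g' t z)" for z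
    using dec' decomposition_g(2)[OF N dec', of z] by (simp add: decomposition_def sum.distrib)
  have AE_all: "AE z in P. \<forall>t\<in>{1..N}. f' t z = f t z \<and> g' t z = g t z"
    using AE_eq by (intro AE_finite_allI AE_conjI) auto
  then have h'_AE: "AE z in P. h' z = h z"
    by eventually_elim (simp add: h'_eq h_eq)
  have f'_ad: "f' 1 \<in> ad 1 (1 - 1)"
    by (rule I.centred_spaceD(1)[OF decomposition_f_centred[OF dec' 1]])
  have g'_ad: "g' 1 \<in> adapted P pre_snd pre_fst 1 (1 - 1)"
    by (rule J.centred_spaceD(1)[OF decomposition_g(1)[OF N dec' 1]])
  have "(\<integral>z. f' 1 z \<partial>P) = (\<integral>z. f 1 z \<partial>P)"
    using AE_eq 1 adapted_measurable[OF f'_ad] adapted_measurable[OF f_adapted[OF 1]]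
    by (intro integral_cong_AE) auto
  also have "\<dots> = (\<integral>z. g 1 z \<partial>P)" using normalized normalized_iff[OF N decomposition] by simp
  also have "\<dots> = (\<integral>z. g' 1 z \<partial>P)"
    using AE_eq 1 adapted_measurable[OF g'_ad] adapted_measurable[OF g_adapted[OF 1]]
    by (intro integral_cong_AE[symmetric]) auto
  finally have normalized': "normalized K L f' g'" using normalized_iff[OF N dec'] by simp
  define B where "B = bound_const * c_norm"
  have B: "0 \<le> B" using c_norm_nonneg by (simp add: B_def bound_const_def)
  \<comment> \<open>h' is a sum of 2 * N functions, each bounded by 2 * B.\<close>
  define R where "R = 4 * N * B"
  have NB: "2 * B \<le> R"
    using mult_right_mono[of 2 "4 * real N" B] N B by (simp add: R_def)
  have h'_le: "\<bar>h' z\<bar> \<le> R" if "z \<in> space P" for z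
  proof -
    have "\<bar>h' z\<bar> \<le> (\<Sum>t=1..N. \<bar>f' t z + g' t z\<bar>)" unfolding h'_eq by (rule sum_abs)
    also have "\<dots> \<le> (\<Sum>t=1..N. 4 * B)"
    proof (rule sum_mono)
      fix t assume "t \<in> {1..N}"
      then have "\<bar>f' t z\<bar> \<le> 2 * B" "\<bar>g' t z\<bar> \<le> 2 * B" using le that by (auto simp: B_def)
      then show "\<bar>f' t z + g' t z\<bar> \<le> 4 * B" by linarith
    qed
    finally show ?thesis by (simp add: R_def)
  qed
  have fg'_le: "\<bar>f' t z\<bar> \<le> R" "\<bar>g' t z\<bar> \<le> R" if "t \<in> {1..N}" "z \<in> space P" for t z
    using le[folded B_def] that NB order_trans by blast+
  have sup: "sup_norm (space P) k \<le> R" if "\<And>z. z \<in> space P \<Longrightarrow> \<bar>k z\<bar> \<le> R" for k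
    unfolding sup_norm_def by (rule cSUP_least[OF P.not_empty that])
  have "Max ({sup_norm (space P) h'} \<union> (\<lambda>t. sup_norm (space P) (f' t)) ` {1..N}
        \<union> (\<lambda>t. sup_norm (space P) (g' t)) ` {1..N}) \<le> R"
    by (intro Max.boundedI) (auto intro!: sup h'_le fg'_le)
  then show ?thesis
    using dec' normalized' h'_AE AE_eq by (intro exI conjI) (simp_all add: R_def B_def mult.assoc)
qed

end

text \<open>Topology enters here: Polish factors make the continuous c measurable for the product
  sigma-algebra.\<close>

lemma dual_optimumI:
  assumes "1 \<le> N" and X: "law_on_paths N X \<mu> K" and Y: "law_on_paths N Y \<nu> L" and P: "P = \<mu> \<Otimes>\<^sub>M \<nu>"
    and c: "continuous_map (prod_topology (product_topology X {1..N}) (product_topology Y {1..N})) euclideanreal c"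
    and "bounded (c ` space P)"
    and "is_arg_max (dual_value P c) (\<lambda>k. k \<in> dual_space m N X Y K L) h"
    and "decomposition m N X Y K L h f gN g"
  shows "dual_optimum N X \<mu> K Y \<nu> L m c h f gN g"
proof -
  interpret path_laws N X \<mu> K Y \<nu> L by (intro path_laws.intro path_law.intro X Y)
  have "c \<in> borel_measurable (paths X N \<Otimes>\<^sub>M paths Y N)"
    using X Y by (intro continuous_map_measurable_paths[OF _ _ c]) (auto simp: law_on_paths_def)
  then have "c \<in> borel_measurable (\<mu> \<Otimes>\<^sub>M \<nu>)"
    using measurable_cong_sets[OF sets_pair_measure_cong[OF X.sets_law Y.sets_law] refl] by blast
  then show ?thesis using assms by unfold_locales simp_all
qed

text \<open>A change of the potentials on a null set, within their classes, leaves h a maximizer. A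
  bound on the supremum over all points is therefore claimed for suitable versions h', f', g', which
  are again a normalized decomposition.\<close>

theorem lemma6p8:
  fixes N :: nat
  assumes "N \<ge> 1"
  shows "\<exists>C :: real.
    \<forall>(m :: mode) (X :: nat \<Rightarrow> 'a topology) (Y :: nat \<Rightarrow> 'b topology) \<mu> \<nu> K L c h f gN g P.
      law_on_paths N X \<mu> K \<and> law_on_paths N Y \<nu> L \<and> P = \<mu> \<Otimes>\<^sub>M \<nu> \<and>
      continuous_map (prod_topology (product_topology X {1..N}) (product_topology Y {1..N}))
        euclideanreal c \<and>
      bounded (c ` space P) \<and>
      is_arg_max (dual_value P c) (\<lambda>k. k \<in> dual_space m N X Y K L) h \<and>
      decomposition m N X Y K L h f gN g
      \<longrightarrow>
      (AE z in P. f 1 z = potential (int_x K) (int_y L) N c g 1 z) \<and>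
      (\<forall>t\<in>{1..<N}. AE z in P.
         f (t + 1) z = potential (int_x K) (int_y L) N c g (t + 1) z
                       - value_fun (int_x K) (int_y L) N c g t z) \<and>
      (m = Bicausal \<longrightarrow>
        (AE z in P. g 1 z = potential (int_y L) (int_x K) N c f 1 z) \<and>
        (\<forall>t\<in>{1..<N}. AE z in P.
           g (t + 1) z = potential (int_y L) (int_x K) N c f (t + 1) z
                         - value_fun (int_y L) (int_x K) N c f t z)) \<and>
      (m = Causal \<longrightarrow>
        (AE (x, y) in P.
           gN (x, y) = - ln (\<integral> x'. exp ((\<Sum>t=1..N. f t (x', y)) - c (x', y)) \<partial>\<mu>))) \<and>
      (normalized K L f g \<longrightarrow>
        (\<exists>h' f' gN' g'.
           decomposition m N X Y K L h' f' gN' g' \<and> normalized K L f' g' \<and>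
           (AE z in P. h' z = h z) \<and>
           (\<forall>t\<in>{1..N}. (AE z in P. f' t z = f t z) \<and> (AE z in P. g' t z = g t z)) \<and>
           Max ({sup_norm (space P) h'} \<union> (\<lambda>t. sup_norm (space P) (f' t)) ` {1..N}
                                      \<union> (\<lambda>t. sup_norm (space P) (g' t)) ` {1..N})
             \<le> C * sup_norm (space P) c))"
\<comment> \<open>The witness is 4 * N times \<open>bound_const\<close>, written out because it must
  be chosen before the spaces and the locale parameters are fixed.\<close>
proof (intro exI[of _ "4 * real N * (2 * 3 ^ N + 2 * real N + 2)"] allI impI, elim conjE)
  fix m and X :: "nat \<Rightarrow> 'a topology" and Y :: "nat \<Rightarrow> 'b topology" and \<mu> \<nu> K L c h f gN g P
  assume X: "law_on_paths N X \<mu> K" and Y: "law_on_paths N Y \<nu> L" and P: "P = \<mu> \<Otimes>\<^sub>M \<nu>"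
    and c: "continuous_map (prod_topology (product_topology X {1..N}) (product_topology Y {1..N})) euclideanreal c"
      "bounded (c ` space P)"
    and opt: "is_arg_max (dual_value P c) (\<lambda>k. k \<in> dual_space m N X Y K L) h"
      "decomposition m N X Y K L h f gN g"
  interpret dual_optimum N X \<mu> K Y \<nu> L m c h f gN g
    by (rule dual_optimumI[OF assms X Y P c opt])
  show "(AE z in P. f 1 z = potential (int_x K) (int_y L) N c g 1 z) \<and>
      (\<forall>t\<in>{1..<N}. AE z in P.
         f (t + 1) z = potential (int_x K) (int_y L) N c g (t + 1) z
                       - value_fun (int_x K) (int_y L) N c g t z) \<and>
      (m = Bicausal \<longrightarrow>
        (AE z in P. g 1 z = potential (int_y L) (int_x K) N c f 1 z) \<and>
        (\<forall>t\<in>{1..<N}. AE z in P.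
           g (t + 1) z = potential (int_y L) (int_x K) N c f (t + 1) z
                         - value_fun (int_y L) (int_x K) N c f t z)) \<and>
      (m = Causal \<longrightarrow>
        (AE (x, y) in P.
           gN (x, y) = - ln (\<integral> x'. exp ((\<Sum>t=1..N. f t (x', y)) - c (x', y)) \<partial>\<mu>))) \<and>
      (normalized K L f g \<longrightarrow>
        (\<exists>h' f' gN' g'.
           decomposition m N X Y K L h' f' gN' g' \<and> normalized K L f' g' \<and>
           (AE z in P. h' z = h z) \<and>
           (\<forall>t\<in>{1..N}. (AE z in P. f' t z = f t z) \<and> (AE z in P. g' t z = g t z)) \<and>
           Max ({sup_norm (space P) h'} \<union> (\<lambda>t. sup_norm (space P) (f' t)) ` {1..N}
                                      \<union> (\<lambda>t. sup_norm (space P) (g' t)) ` {1..N})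
             \<le> 4 * real N * (2 * 3 ^ N + 2 * real N + 2) * sup_norm (space P) c))"
    unfolding P
  proof (intro conjI impI ballI)
    show "AE z in \<mu> \<Otimes>\<^sub>M \<nu>. f 1 z = potential (int_x K) (int_y L) N c g 1 z"
      unfolding F.potential_eq by (rule F.f_1_eq)
    show "AE z in \<mu> \<Otimes>\<^sub>M \<nu>. f (t + 1) z = potential (int_x K) (int_y L) N c g (t + 1) z
        - value_fun (int_x K) (int_y L) N c g t z" if "t \<in> {1..<N}" for t
      using F.f_eq[of "t + 1"] that by (simp add: F.potential_eq)
    show "AE z in \<mu> \<Otimes>\<^sub>M \<nu>. g 1 z = potential (int_y L) (int_x K) N c f 1 z" if "m = Bicausal"
    proof -
      interpret G: causal_system "\<mu> \<Otimes>\<^sub>M \<nu>" pre_snd pre_fst N "int_y L" "int_x K" c g f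
        by (rule anticausal[OF that])
      show ?thesis unfolding G.potential_eq by (rule G.f_1_eq)
    qed
    show "AE z in \<mu> \<Otimes>\<^sub>M \<nu>. g (t + 1) z = potential (int_y L) (int_x K) N c f (t + 1) z
        - value_fun (int_y L) (int_x K) N c f t z" if "m = Bicausal" "t \<in> {1..<N}" for t
    proof -
      interpret G: causal_system "\<mu> \<Otimes>\<^sub>M \<nu>" pre_snd pre_fst N "int_y L" "int_x K" c g f
        by (rule anticausal[OF that(1)])
      show ?thesis using G.f_eq[of "t + 1"] that(2) by (simp add: G.potential_eq)
    qed
    show "AE (x, y) in \<mu> \<Otimes>\<^sub>M \<nu>.
        gN (x, y) = - ln (\<integral> x'. exp ((\<Sum>t=1..N. f t (x', y)) - c (x', y)) \<partial>\<mu>)" if "m = Causal"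
      using marginal_eq[OF that]
      by eventually_elim (simp add: soft_int_def marginal_def case_prod_beta)
    show "\<exists>h' f' gN' g'.
           decomposition m N X Y K L h' f' gN' g' \<and> normalized K L f' g' \<and>
           (AE z in \<mu> \<Otimes>\<^sub>M \<nu>. h' z = h z) \<and>
           (\<forall>t\<in>{1..N}. (AE z in \<mu> \<Otimes>\<^sub>M \<nu>. f' t z = f t z) \<and> (AE z in \<mu> \<Otimes>\<^sub>M \<nu>. g' t z = g t z)) \<and>
           Max ({sup_norm (space (\<mu> \<Otimes>\<^sub>M \<nu>)) h'} \<union> (\<lambda>t. sup_norm (space (\<mu> \<Otimes>\<^sub>M \<nu>)) (f' t)) ` {1..N}
                                      \<union> (\<lambda>t. sup_norm (space (\<mu> \<Otimes>\<^sub>M \<nu>)) (g' t)) ` {1..N})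
             \<le> 4 * real N * (2 * 3 ^ N + 2 * real N + 2) * sup_norm (space (\<mu> \<Otimes>\<^sub>M \<nu>)) c"
      if "normalized K L f g"
      using normalized_bound[OF that] unfolding bound_const_def c_norm_def .
  qed
qed

end
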